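(* Suppose that $\Theta$ is an inner function which has an angular derivative in the sense of Carathéodory at $\zeta\in\mathbb T$. Let $p\in(2,+\infty)$. Then the following are equivalent: (1) the bounded truncated Toeplitz operator $k_\zeta^\Theta\otimes k_\zeta^\Theta$ has a symbol $\psi\in L^p$; (2) $k_\zeta^\Theta\in L^p$. In particular, if $k_\zeta^\Theta\notin L^p$ for some $p\in(2,\infty)$, then $k_\zeta^\Theta\otimes k_\zeta^\Theta$ is a bounded truncated Toeplitz operator with no bounded symbol.
   Context: $\mathbb D$ is the open unit disc, $\mathbb T$ the unit circle with normalized Lebesgue measure $m$, $L^p=L^p(\mathbb T,m)$, and $H^p$ is the Hardy space, regarded as a subspace of $L^p$ via boundary values. An inner function is a nonconstant $\Theta\in H^\infty$ with $|\Theta|=1$ a.e. on $\mathbb T$. $K_\Theta=H^2\ominus\Theta H^2$ and $P_\Theta$ is the orthogonal projection of $L^2$ onto $K_\Theta$. For $\phi\in L^2$, the truncated Toeplitz operator $A_\phi^\Theta$ is the (possibly unbounded) densely defined operator in $K_\Theta$ with domain $K_\Theta\cap H^\infty$, $A_\phi^\Theta f=P_\Theta(\phi f)$. It is called bounded if it extends to a bounded operator on $K_\Theta$ (with which it is then identified). A symbol of a truncated Toeplitz operator $A$ is any $\phi\in L^2$ with $A=A_\phi^\Theta$; it is not unique. A bounded symbol is a symbol in $L^\infty$. $\Theta$ has an angular derivative in the sense of Carathéodory at $\zeta\in\mathbb T$ if $\Theta$ and $\Theta'$ have a non-tangential limit at $\zeta$ and $|\Theta(\zeta)|=1$. In this case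 evaluation at $\zeta$ is continuous on $K_\Theta$ and $k_\zeta^\Theta(z)=\frac{1-\overline{\Theta(\zeta)}\Theta(z)}{1-\bar\zeta z}$ belongs to $K_\Theta$ and is the corresponding reproducing kernel. For $x,y\in K_\Theta$, $x\otimes y$ is the rank one operator $f\mapsto\langle f,y\rangle x$. It is known that $k_\zeta^\Theta\otimes k_\zeta^\Theta$ is then a bounded truncated Toeplitz operator on $K_\Theta$. *)

theory Defs
  imports "HOL-Analysis.Analysis"
begin

section \<open>Lebesgue spaces on the unit circle\<close>

text \<open>Completing the measure makes a function defined almost everywhere by a limiting process,
  such as \<open>bdry F\<close> below, measurable no matter what its values on the exceptional null set are.\<close>

definition circle_measure :: "complex measure" where
  "circle_measure =
     completion (distr (uniform_measure lborel {0..<2 * pi}) (restrict_space borel (sphere 0 1)) cis)"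

text \<open>Elements of the Lebesgue spaces are represented by functions, and equality in these spaces is
  equality almost everywhere. Only the values on the unit circle matter.\<close>

definition Lp :: "real \<Rightarrow> (complex \<Rightarrow> complex) set" where
  "Lp p = {f \<in> borel_measurable circle_measure. integrable circle_measure (\<lambda>z. norm (f z) powr p)}"

definition Linf :: "(complex \<Rightarrow> complex) set" where
  "Linf = {f \<in> borel_measurable circle_measure. \<exists>C. AE z in circle_measure. norm (f z) \<le> C}"

definition L2_inner :: "(complex \<Rightarrow> complex) \<Rightarrow> (complex \<Rightarrow> complex) \<Rightarrow> complex" where
  "L2_inner f g = (LINT z|circle_measure. f z * cnj (g z))"

definition L2_norm :: "(complex \<Rightarrow> complex) \<Rightarrow> real" where
  "L2_norm f = sqrt (LINT z|circle_measure. (norm (f z))\<^sup>2)"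

section \<open>Non-tangential limits and Hardy spaces\<close>

definition stolz_angle :: "complex \<Rightarrow> real \<Rightarrow> complex set" where
  "stolz_angle \<zeta> a = {z \<in> ball 0 1. norm (z - \<zeta>) \<le> a * (1 - norm z)}"

definition has_nt_limit :: "(complex \<Rightarrow> complex) \<Rightarrow> complex \<Rightarrow> complex \<Rightarrow> bool" where
  "has_nt_limit F \<zeta> l \<longleftrightarrow> (\<forall>a>1. (F \<longlongrightarrow> l) (at \<zeta> within stolz_angle \<zeta> a))"

definition bdry :: "(complex \<Rightarrow> complex) \<Rightarrow> complex \<Rightarrow> complex" where
  "bdry F \<zeta> = (THE l. has_nt_limit F \<zeta> l)"

text \<open>The Hardy spaces of functions in the disc, followed by the corresponding spaces of boundary
  functions on the circle.\<close>

definition hardy_disc :: "real \<Rightarrow> (complex \<Rightarrow> complex) set" where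
  "hardy_disc p = {F. F holomorphic_on ball 0 1 \<and>
     (\<exists>C. \<forall>r\<in>{0..<1}. (LINT z|circle_measure. norm (F (of_real r * z)) powr p) \<le> C)}"

definition hardy_disc_inf :: "(complex \<Rightarrow> complex) set" where
  "hardy_disc_inf = {F. F holomorphic_on ball 0 1 \<and> bounded (F ` ball 0 1)}"

definition hardy :: "real \<Rightarrow> (complex \<Rightarrow> complex) set" where
  "hardy p = {f \<in> Lp p. \<exists>F\<in>hardy_disc p. AE z in circle_measure. has_nt_limit F z (f z)}"

definition hardy_inf :: "(complex \<Rightarrow> complex) set" where
  "hardy_inf = {f \<in> Linf. \<exists>F\<in>hardy_disc_inf. AE z in circle_measure. has_nt_limit F z (f z)}"

section \<open>Inner functions and model spaces\<close>

text \<open>An inner function is given as a function in the disc; its boundary function is \<open>bdry \<Theta>\<close>.\<close>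

definition inner_function :: "(complex \<Rightarrow> complex) \<Rightarrow> bool" where
  "inner_function \<Theta> \<longleftrightarrow> \<Theta> \<in> hardy_disc_inf \<and> \<not> \<Theta> constant_on ball 0 1 \<and>
     (AE z in circle_measure. \<exists>l. has_nt_limit \<Theta> z l \<and> norm l = 1)"

definition model_space :: "(complex \<Rightarrow> complex) \<Rightarrow> (complex \<Rightarrow> complex) set" where
  "model_space \<Theta> = {f \<in> hardy 2. \<forall>h\<in>hardy 2. L2_inner f (\<lambda>z. bdry \<Theta> z * h z) = 0}"

definition has_angular_derivative :: "(complex \<Rightarrow> complex) \<Rightarrow> complex \<Rightarrow> bool" where
  "has_angular_derivative \<Theta> \<zeta> \<longleftrightarrow>
     (\<exists>l. has_nt_limit \<Theta> \<zeta> l \<and> norm l = 1) \<and> (\<exists>d. has_nt_limit (deriv \<Theta>) \<zeta> d)"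

definition boundary_kernel :: "(complex \<Rightarrow> complex) \<Rightarrow> complex \<Rightarrow> complex \<Rightarrow> complex" where
  "boundary_kernel \<Theta> \<zeta> z = (1 - cnj (bdry \<Theta> \<zeta>) * \<Theta> z) / (1 - cnj \<zeta> * z)"

text \<open>The kernel above is a function in the disc; the following is the element of \<open>L\<^sup>2\<close> it
  stands for.\<close>

definition kernel_fun :: "(complex \<Rightarrow> complex) \<Rightarrow> complex \<Rightarrow> complex \<Rightarrow> complex" where
  "kernel_fun \<Theta> \<zeta> = bdry (boundary_kernel \<Theta> \<zeta>)"

section \<open>Truncated Toeplitz operators\<close>

text \<open>As functions only represent elements of \<open>L\<^sup>2\<close>, the orthogonal projection of \<open>f\<close> onto \<open>S\<close> is a
  function determined up to null sets: \<open>is_orth_proj S f g\<close> says that \<open>g\<close> represents it.\<close>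

definition is_orth_proj ::
    "(complex \<Rightarrow> complex) set \<Rightarrow> (complex \<Rightarrow> complex) \<Rightarrow> (complex \<Rightarrow> complex) \<Rightarrow> bool" where
  "is_orth_proj S f g \<longleftrightarrow> g \<in> S \<and> (\<forall>h\<in>S. L2_inner (\<lambda>z. f z - g z) h = 0)"

text \<open>Linearity is required almost everywhere. Together with the norm bound it makes \<open>A\<close> respect
  equality almost everywhere.\<close>

definition bounded_operator_on ::
    "(complex \<Rightarrow> complex) set \<Rightarrow> ((complex \<Rightarrow> complex) \<Rightarrow> (complex \<Rightarrow> complex)) \<Rightarrow> bool" where
  "bounded_operator_on S A \<longleftrightarrow>
     (\<forall>f\<in>S. A f \<in> S) \<and>
     (\<forall>f\<in>S. \<forall>g\<in>S. AE z in circle_measure. A (\<lambda>w. f w + g w) z = A f z + A g z) \<and>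
     (\<forall>c. \<forall>f\<in>S. AE z in circle_measure. A (\<lambda>w. c * f w) z = c * A f z) \<and>
     (\<exists>C. \<forall>f\<in>S. L2_norm (A f) \<le> C * L2_norm f)"

text \<open>\<open>is_symbol \<Theta> A \<phi>\<close>: the densely defined operator that maps \<open>f\<close> in
  \<open>model_space \<Theta> \<inter> hardy_inf\<close> to the projection of \<open>\<phi> f\<close> onto the model space is bounded, and \<open>A\<close> is
  its bounded extension to the model space.\<close>

definition is_symbol ::
    "(complex \<Rightarrow> complex) \<Rightarrow> ((complex \<Rightarrow> complex) \<Rightarrow> (complex \<Rightarrow> complex)) \<Rightarrow>
     (complex \<Rightarrow> complex) \<Rightarrow> bool" where
  "is_symbol \<Theta> A \<phi> \<longleftrightarrow> \<phi> \<in> Lp 2 \<and> bounded_operator_on (model_space \<Theta>) A \<and>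
     (\<forall>f \<in> model_space \<Theta> \<inter> hardy_inf. is_orth_proj (model_space \<Theta>) (\<lambda>z. \<phi> z * f z) (A f))"

definition bounded_truncated_toeplitz ::
    "(complex \<Rightarrow> complex) \<Rightarrow> ((complex \<Rightarrow> complex) \<Rightarrow> (complex \<Rightarrow> complex)) \<Rightarrow> bool" where
  "bounded_truncated_toeplitz \<Theta> A \<longleftrightarrow> (\<exists>\<phi>. is_symbol \<Theta> A \<phi>)"

definition rank_one ::
    "(complex \<Rightarrow> complex) \<Rightarrow> (complex \<Rightarrow> complex) \<Rightarrow> (complex \<Rightarrow> complex) \<Rightarrow> complex \<Rightarrow> complex" where
  "rank_one x y f = (\<lambda>z. L2_inner f y * x z)"

end

theory Submission
  imports Defs "HOL-Complex_Analysis.Complex_Analysis"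
begin

text \<open>
  Write \<open>k\<close> for the kernel at \<open>\<zeta>\<close> and \<open>k\<^sub>w\<close> for the reproducing kernel of the model space at a point \<open>w\<close>
  of the disc.

  Angular derivative and kernel. The identity \<open>\<parallel>k\<^sub>w\<parallel>\<^sup>2 = (1 - |\<Theta> w|\<^sup>2) / (1 - |w|\<^sup>2)\<close> and the bound on
  \<open>\<Theta>'\<close> along the radius to \<open>\<zeta>\<close> keep \<open>\<parallel>k\<^sub>w\<parallel>\<close> bounded as \<open>w \<rightarrow> \<zeta>\<close> radially. Bounded norms together with
  convergence almost everywhere give weak convergence in \<open>L\<^sup>2\<close> (\<open>weak_convergence_L2\<close>). So \<open>k\<close> lies in
  the model space, and whatever holds for the \<open>k\<^sub>w\<close> and is weakly continuous holds for \<open>k\<close>. The same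
  weak convergence, applied to the dilations of a Hardy function, yields the Cauchy formula for
  boundary values (\<open>hardy_cauchy_formula\<close>), from which all facts about model spaces below are
  computed.

  A symbol that is as good as the kernel. For \<open>w\<close> in the disc the rank one operator built from \<open>k\<^sub>w\<close>
  and its conjugate kernel \<open>(\<Theta> - \<Theta> w) / (z - w)\<close> has an explicit symbol
  (\<open>symbol_identity_interior\<close>). On the circle, the conjugate kernels converge to
  a multiple of \<open>k\<close>, and in the limit \<open>k + \<zeta> \<cdot> cnj z \<cdot> cnj k\<close> becomes a symbol of the rank one
  operator. It is dominated by \<open>2|k|\<close>, hence lies in every \<open>L\<^sup>p\<close> that contains \<open>k\<close>; with \<open>p = 2\<close> this
  also shows that the operator is a bounded truncated Toeplitz operator.

  A symbol in \<open>L\<^sup>p\<close> forces the kernel into \<open>L\<^sup>p\<close>. Let \<open>\<psi>\<close> be such a symbol and apply the operator to the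
  bounded function \<open>k\<^sub>0\<close>: up to a nonzero factor, \<open>k\<close> is the projection of \<open>v = \<psi> k\<^sub>0\<close>. Pairing with
  \<open>k\<^sub>w\<close> turns the projection into \<open>C v - \<Theta> \<cdot> C (cnj \<Theta> \<cdot> v)\<close>, where \<open>C\<close> is the Cauchy transform. By the
  theorem of M. Riesz (\<open>cauchy_transform_Lp_bound\<close>) the \<open>L\<^sup>p\<close> means of a Cauchy transform over
  the circles of radius less than one are bounded when \<open>p > 2\<close>, and Fatou's lemma puts \<open>k\<close> into \<open>L\<^sup>p\<close>. Since \<open>L\<^sup>\<infinity> \<subseteq> L\<^sup>p\<close>, a
  kernel outside some \<open>L\<^sup>p\<close> leaves no room for a bounded symbol.

  Riesz's theorem. For real \<open>g\<close> the real part of \<open>C g\<close> is an average of \<open>g\<close> against a positive kernel,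
  so its \<open>L\<^sup>p\<close> means are harmless. The imaginary part is controlled by a smooth function \<open>\<Phi>\<close> of the
  plane (\<open>riesz_fun\<close>) such that \<open>\<Phi>\<close> composed with a holomorphic function is subharmonic, while
  \<open>\<Phi> (u + \<i> v) \<le> C (1 + |u|\<^sup>p) - c |u + \<i> v|\<^sup>p\<close>: its means over circles are nonnegative because \<open>\<Phi>\<close> is
  positive at the real number \<open>C g 0\<close>.
\<close>

section \<open>Integration on the unit circle\<close>

lemma uniform_angle_density:
  "uniform_measure lborel {0..<2 * pi} = density lborel (\<lambda>t. ennreal (indicator {0..<2 * pi} t / (2 * pi)))"
  unfolding uniform_measure_def
  by (intro density_cong) (auto simp: indicator_def divide_ennreal[symmetric] simp flip: ennreal_1)

lemma cis_measurable_circle: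
  "cis \<in> uniform_measure lborel {0..<2 * pi} \<rightarrow>\<^sub>M restrict_space borel (sphere 0 1)"
proof (rule measurable_restrict_space2)
  have "cis \<in> borel_measurable borel"
    by (intro borel_measurable_continuous_onI continuous_intros)
  then show "cis \<in> borel_measurable (uniform_measure lborel {0..<2 * pi})"
    by (simp cong: measurable_cong_sets)
qed auto

lemma space_circle [simp]: "space circle_measure = sphere 0 1"
  by (simp add: circle_measure_def space_restrict_space)

lemma emeasure_circle: "emeasure circle_measure (sphere 0 1) = 1"
proof -
  have "emeasure circle_measure (sphere 0 1) =
      emeasure (uniform_measure lborel {0..<2 * pi}) (cis -` sphere 0 1 \<inter> UNIV)"
    unfolding circle_measure_def
    using sets.top[of "restrict_space borel (sphere 0 1 :: complex set)"]
    by (simp add: emeasure_distr[OF cis_measurable_circle] space_restrict_space)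
  also have "cis -` sphere 0 1 \<inter> UNIV = UNIV" by auto
  finally show ?thesis by (simp add: divide_ennreal)
qed

interpretation circle: finite_measure circle_measure
  by (rule finite_measureI) (simp add: emeasure_circle)

interpretation circle: complete_measure circle_measure
  unfolding circle_measure_def by unfold_locales (rule completion.complete)

lemma measure_circle [simp]: "measure circle_measure (sphere 0 1) = 1"
  by (simp add: measure_def emeasure_circle)

lemma measurable_circle_cont:
  fixes f :: "complex \<Rightarrow> 'a :: topological_space"
  assumes "continuous_on (sphere 0 1) f"
  shows "f \<in> borel_measurable circle_measure"
  unfolding circle_measure_def
  by (rule measurable_completion)
     (use borel_measurable_continuous_on_restrict[OF assms] in \<open>simp cong: measurable_cong_sets\<close>)

lemma integrable_circle_bounded:
  fixes f :: "complex \<Rightarrow> 'a :: {banach, second_countable_topology}"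
  assumes "f \<in> borel_measurable circle_measure" "AE z in circle_measure. norm (f z) \<le> B"
  shows "integrable circle_measure f"
  using assms by (intro circle.integrable_const_bound)

lemma integrable_circle_cont:
  fixes f :: "complex \<Rightarrow> 'a :: {banach, second_countable_topology}"
  assumes "continuous_on (sphere 0 1) f"
  shows "integrable circle_measure f"
proof -
  obtain B where B: "\<forall>x\<in>f ` sphere 0 1. norm x \<le> B"
    using compact_imp_bounded[OF compact_continuous_image[OF assms compact_sphere]]
    unfolding bounded_iff by blast
  from B show ?thesis
    by (intro integrable_circle_bounded[of _ B] measurable_circle_cont assms) auto
qed

lemma circle_integral_cont:
  fixes f :: "complex \<Rightarrow> 'a :: euclidean_space"
  assumes "continuous_on (sphere 0 1) f"
  shows "(LINT z|circle_measure. f z) = (1 / (2 * pi)) *\<^sub>R integral {0..2 * pi} (\<lambda>t. f (cis t))"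
proof -
  have m: "f \<in> borel_measurable (restrict_space borel (sphere 0 1))"
    by (rule borel_measurable_continuous_on_restrict[OF assms])
  have c: "continuous_on A (\<lambda>t. f (cis t))" for A
    by (rule continuous_on_compose2[OF assms]) (auto intro!: continuous_intros)
  have mc: "(\<lambda>t. f (cis t)) \<in> borel_measurable borel"
    by (intro borel_measurable_continuous_onI c)
  have ai: "set_integrable lborel {0..2 * pi} (\<lambda>t. f (cis t))"
    unfolding set_integrable_def by (rule borel_integrable_compact) (auto intro: c)
  have "(LINT z|circle_measure. f z) = (LINT t|uniform_measure lborel {0..<2 * pi}. f (cis t))"
    unfolding circle_measure_def
    using m by (subst integral_completion, simp cong: measurable_cong_sets,
      subst integral_distr[OF cis_measurable_circle], auto)
  also have "\<dots> = (LINT t|lborel. (indicator {0..<2 * pi} t / (2 * pi)) *\<^sub>R f (cis t))"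
    unfolding uniform_angle_density using mc
    by (subst integral_density) auto
  also have "\<dots> = (LINT t|lborel. (1 / (2 * pi)) *\<^sub>R (indicator {0..2 * pi} t *\<^sub>R f (cis t)))"
  proof (rule integral_cong_AE)
    show "AE t in lborel. (indicator {0..<2 * pi} t / (2 * pi)) *\<^sub>R f (cis t)
        = (1 / (2 * pi)) *\<^sub>R (indicator {0..2 * pi} t *\<^sub>R f (cis t))"
      using AE_lborel_singleton[of "2 * pi"] by eventually_elim (auto simp: indicator_def)
  qed (use mc in measurable)
  also have "\<dots> = (1 / (2 * pi)) *\<^sub>R (LINT t:{0..2 * pi}|lborel. f (cis t))"
    unfolding set_lebesgue_integral_def using ai[unfolded set_integrable_def]
    by (subst integral_scaleR_right[symmetric]) (auto simp: mult.commute)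
  also have "(LINT t:{0..2 * pi}|lborel. f (cis t)) = integral {0..2 * pi} (\<lambda>t. f (cis t))"
    by (rule set_borel_integral_eq_integral(2)[OF ai])
  finally show ?thesis .
qed

lemma AE_circle_neq: "AE z in circle_measure. z \<noteq> \<zeta>"
proof -
  have *: "AE t in lborel. t \<in> {0..<2 * pi} \<longrightarrow> cis t \<noteq> \<zeta>"
  proof (rule AE_mp)
    show "AE t in lborel. t \<noteq> Arg2pi \<zeta>" by (rule AE_lborel_singleton)
    show "AE t in lborel. t \<noteq> Arg2pi \<zeta> \<longrightarrow> t \<in> {0..<2 * pi} \<longrightarrow> cis t \<noteq> \<zeta>"
    proof (rule AE_I2, safe)
      fix t assume t: "t \<noteq> Arg2pi (cis t)" "t \<in> {0..<2 * pi}"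
      have "Arg2pi (cis t) = t"
        using Arg2pi_unique[of 1 t "cis t"] t(2) by (simp add: cis_conv_exp)
      with t show False by simp
    qed
  qed
  have "AE t in uniform_measure lborel {0..<2 * pi}. cis t \<noteq> \<zeta>"
    by (rule AE_uniform_measureI) (use * in auto)
  then have "AE z in distr (uniform_measure lborel {0..<2 * pi}) (restrict_space borel (sphere 0 1)) cis. z \<noteq> \<zeta>"
    by (subst AE_distr_iff[OF cis_measurable_circle]) (auto simp: space_restrict_space sets_restrict_space)
  then show ?thesis unfolding circle_measure_def by (rule AE_completion)
qed

text \<open>This is where completeness of the measure on the circle enters: it makes
  functions that are only determined almost everywhere, such as boundary functions, measurable.\<close>

lemma measurable_circle_AE_cong:
  fixes f :: "complex \<Rightarrow> complex"
  assumes "g \<in> borel_measurable circle_measure" "AE z in circle_measure. f z = g z"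
  shows "f \<in> borel_measurable circle_measure"
proof (rule measurableI)
  fix A :: "complex set" assume A: "A \<in> sets borel"
  show "f -` A \<inter> space circle_measure \<in> sets circle_measure"
  proof (rule circle.in_sets_AE)
    show "g -` A \<inter> space circle_measure \<in> sets circle_measure"
      using measurable_sets[OF assms(1) A] .
    show "AE z in circle_measure. (z \<in> g -` A \<inter> space circle_measure) = (z \<in> f -` A \<inter> space circle_measure)"
      using assms(2) by eventually_elim auto
  qed auto
qed auto

lemma measurable_circle_AE_limit:
  fixes f :: "complex \<Rightarrow> complex"
  assumes m: "\<And>n. g n \<in> borel_measurable circle_measure"
    and l: "AE z in circle_measure. (\<lambda>n. g n z) \<longlonglongrightarrow> f z"
  shows "f \<in> borel_measurable circle_measure"
proof (rule measurable_circle_AE_cong)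
  show "(\<lambda>z. lim (\<lambda>n. g n z)) \<in> borel_measurable circle_measure"
    by (rule borel_measurable_lim_metric[OF m])
  show "AE z in circle_measure. f z = lim (\<lambda>n. g n z)"
    using l by eventually_elim (simp add: limI)
qed

text \<open>On the circle \<open>dz / (z - w) = \<i> dt / (1 - w \<cdot> cnj z)\<close>, so this is Cauchy's integral formula written
  against the normalized measure.\<close>

lemma circle_cauchy_formula:
  assumes c: "continuous_on (cball 0 1) F" and h: "F holomorphic_on ball 0 1" and l: "norm w < 1"
  shows "(LINT z|circle_measure. F z / (1 - w * cnj z)) = F w"
proof -
  have nz: "1 - w * cnj z \<noteq> 0" if "norm z = 1" for z
  proof
    assume "1 - w * cnj z = 0"
    then have "norm (w * cnj z) = 1" by (metis eq_iff_diff_eq_0 norm_one)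
    with l that show False by (simp add: norm_mult)
  qed
  have cont: "continuous_on (sphere 0 1) (\<lambda>z. F z / (1 - w * cnj z))"
    using nz by (intro continuous_intros continuous_on_subset[OF c]) auto
  have "((\<lambda>u. F u / (u - w)) has_contour_integral 2 * of_real pi * \<i> * F w) (circlepath 0 1)"
    using Cauchy_integral_circlepath[OF c h] l by simp
  then have "((\<lambda>t. F (cis t) / (cis t - w) * \<i> * cis t) has_integral 2 * of_real pi * \<i> * F w) {0..2*pi}"
    unfolding circlepath_def by (subst (asm) has_contour_integral_part_circlepath_iff) auto
  then have "((\<lambda>t. (F (cis t) / (cis t - w) * \<i> * cis t) / (2 * of_real pi * \<i>)) has_integral F w) {0..2*pi}"
    by (drule_tac has_integral_divide[where c="2 * of_real pi * \<i>"]) simp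
  moreover have "(F (cis t) / (cis t - w) * \<i> * cis t) / (2 * of_real pi * \<i>)
      = (1 / (2 * pi)) *\<^sub>R (F (cis t) / (1 - w * cnj (cis t)))" for t
  proof -
    have "cis t - w \<noteq> 0" using l by (metis norm_cis eq_iff_diff_eq_0 less_irrefl)
    moreover have "cis t * (1 - w * cnj (cis t)) = cis t - w"
      by (simp add: algebra_simps cis_cnj cis_mult)
    ultimately show ?thesis using nz[of "cis t"]
      by (simp add: scaleR_conv_of_real divide_simps mult_ac) (simp add: algebra_simps)
  qed
  ultimately have "((\<lambda>t. (1 / (2 * pi)) *\<^sub>R (F (cis t) / (1 - w * cnj (cis t)))) has_integral F w) {0..2*pi}"
    by simp
  then show ?thesis
    by (subst circle_integral_cont[OF cont]) (simp add: integral_unique flip: integral_cmul)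
qed

section \<open>A plane function with subharmonic compositions\<close>

text \<open>With \<open>F = u + \<i> v\<close> and \<open>N = |F|\<^sup>2 + 1\<close> this is \<open>(1 - 1/\<alpha>\<^sup>2) N\<^sup>\<alpha> + N\<^sup>\<alpha>\<^sup>-\<^sup>1 Re F\<^sup>2\<close>. Homogeneity would suggest
  \<open>|F|\<^sup>2\<close> in place of \<open>N\<close>; adding one makes the function smooth at the origin. The factor
  \<open>1 - 1/\<alpha>\<^sup>2\<close> is the least one for which the compositions are subharmonic, and that it is less than
  one makes the function negative far out along the imaginary axis. The exponent that this serves is
  \<open>p = 2\<alpha>\<close>.\<close>

definition riesz_fun :: "real \<Rightarrow> real \<Rightarrow> real \<Rightarrow> real" where
  "riesz_fun \<alpha> u v = (1 - 1 / \<alpha>\<^sup>2) * (u\<^sup>2 + v\<^sup>2 + 1) powr \<alpha>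
     + (u\<^sup>2 + v\<^sup>2 + 1) powr (\<alpha> - 1) * (u\<^sup>2 - v\<^sup>2)"

text \<open>The first and second derivatives of \<open>riesz_fun\<close> along a curve \<open>u + \<i> v\<close> in the plane, in terms of the
  derivatives of \<open>u\<close> and \<open>v\<close>.\<close>

definition riesz_fun_deriv :: "real \<Rightarrow> real \<Rightarrow> real \<Rightarrow> real \<Rightarrow> real \<Rightarrow> real" where
  "riesz_fun_deriv \<alpha> u v u1 v1 =
     (let N = u\<^sup>2 + v\<^sup>2 + 1; S = u\<^sup>2 - v\<^sup>2; N1 = 2 * (u * u1 + v * v1); S1 = 2 * (u * u1 - v * v1)
      in (1 - 1 / \<alpha>\<^sup>2) * \<alpha> * N powr (\<alpha> - 1) * N1
         + (\<alpha> - 1) * N powr (\<alpha> - 2) * N1 * S + N powr (\<alpha> - 1) * S1)"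

definition riesz_fun_deriv2 :: "real \<Rightarrow> real \<Rightarrow> real \<Rightarrow> real \<Rightarrow> real \<Rightarrow> real \<Rightarrow> real \<Rightarrow> real" where
  "riesz_fun_deriv2 \<alpha> u v u1 v1 u2 v2 =
     (let N = u\<^sup>2 + v\<^sup>2 + 1; S = u\<^sup>2 - v\<^sup>2; N1 = 2 * (u * u1 + v * v1); S1 = 2 * (u * u1 - v * v1);
          N2 = 2 * (u1\<^sup>2 + u * u2 + v1\<^sup>2 + v * v2); S2 = 2 * (u1\<^sup>2 + u * u2 - v1\<^sup>2 - v * v2)
      in (1 - 1 / \<alpha>\<^sup>2) * \<alpha> * ((\<alpha> - 1) * N powr (\<alpha> - 2) * N1 * N1 + N powr (\<alpha> - 1) * N2)
         + (\<alpha> - 1) * ((\<alpha> - 2) * N powr (\<alpha> - 3) * N1 * N1 * S + N powr (\<alpha> - 2) * N2 * S + N powr (\<alpha> - 2) * N1 * S1)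
         + ((\<alpha> - 1) * N powr (\<alpha> - 2) * N1 * S1 + N powr (\<alpha> - 1) * S2))"

lemma riesz_base_pos: "u\<^sup>2 + v\<^sup>2 + 1 > (0::real)"
  by (simp add: add_nonneg_pos)

lemma DERIV_riesz_powr:
  assumes "(u has_real_derivative u1) (at s)" "(v has_real_derivative v1) (at s)"
  shows "((\<lambda>s. ((u s)\<^sup>2 + (v s)\<^sup>2 + 1) powr b) has_real_derivative
    b * ((u s)\<^sup>2 + (v s)\<^sup>2 + 1) powr (b - 1) * (2 * (u s * u1 + v s * v1))) (at s)"
proof -
  have "((\<lambda>s. (u s)\<^sup>2 + (v s)\<^sup>2 + 1) has_real_derivative 2 * (u s * u1 + v s * v1)) (at s)"
    by (auto intro!: derivative_eq_intros assms simp: algebra_simps)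
  from DERIV_chain2[OF has_real_derivative_powr[OF riesz_base_pos] this] show ?thesis .
qed

lemma DERIV_riesz_fun:
  assumes "(u has_real_derivative u1) (at s)" "(v has_real_derivative v1) (at s)"
  shows "((\<lambda>s. riesz_fun \<alpha> (u s) (v s)) has_real_derivative riesz_fun_deriv \<alpha> (u s) (v s) u1 v1) (at s)"
  unfolding riesz_fun_def riesz_fun_deriv_def Let_def
  by (rule DERIV_riesz_powr assms derivative_eq_intros refl)+ (simp add: algebra_simps add_divide_distrib)

lemma DERIV_riesz_fun_deriv:
  assumes "(u has_real_derivative u1 s) (at s)" "(v has_real_derivative v1 s) (at s)"
    "(u1 has_real_derivative u2) (at s)" "(v1 has_real_derivative v2) (at s)"
  shows "((\<lambda>s. riesz_fun_deriv \<alpha> (u s) (v s) (u1 s) (v1 s)) has_real_derivative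
     riesz_fun_deriv2 \<alpha> (u s) (v s) (u1 s) (v1 s) u2 v2) (at s)"
  unfolding riesz_fun_deriv2_def riesz_fun_deriv_def Let_def
  by (rule DERIV_riesz_powr assms derivative_eq_intros refl)+
     (simp add: algebra_simps power2_eq_square)

text \<open>If \<open>A + \<i> B\<close> and \<open>C + \<i> D\<close> are the first two derivatives of a holomorphic function in the real
  direction, then those in the imaginary direction are obtained by multiplying with \<open>\<i>\<close> and \<open>-1\<close>. So
  the sum is the Laplacian of the composition with that function. The second derivatives cancel, and
  what remains is \<open>|A + \<i> B|\<^sup>2\<close> times a polynomial expression that is smallest on the imaginary axis,
  where it is a positive multiple of \<open>(\<alpha>\<^sup>2 - \<alpha> + 1) X + \<alpha> + 1 > 0\<close> with \<open>X = |F|\<^sup>2\<close>.\<close>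

lemma riesz_fun_laplacian_nonneg:
  assumes "\<alpha> > 1"
  shows "riesz_fun_deriv2 \<alpha> u v A B C D + riesz_fun_deriv2 \<alpha> u v (- B) A (- C) (- D) \<ge> 0"
proof -
  define N where "N = u\<^sup>2 + v\<^sup>2 + 1"
  define S where "S = u\<^sup>2 - v\<^sup>2"
  define X where "X = u\<^sup>2 + v\<^sup>2"
  define E where "E = A\<^sup>2 + B\<^sup>2"
  define P where "P = N powr (\<alpha> - 3)"
  define k where "k = (1 - 1 / \<alpha>\<^sup>2) * \<alpha>"
  have N: "N > 0" unfolding N_def by (rule riesz_base_pos)
  have P2: "N powr (\<alpha> - 2) = P * N"
    using powr_add[of N "\<alpha> - 3" 1] N by (simp add: P_def)
  have P1: "N powr (\<alpha> - 1) = P * N * N"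
    using powr_add[of N "\<alpha> - 3" 2] N by (simp add: P_def power2_eq_square)
  have a: "(2 * (u * A + v * B)) * (2 * (u * A + v * B)) + (2 * (u * (-B) + v * A)) * (2 * (u * (-B) + v * A)) = 4 * X * E"
    by (simp add: X_def E_def power2_eq_square algebra_simps)
  have b: "(2 * (u * A + v * B)) * (2 * (u * A - v * B)) + (2 * (u * (-B) + v * A)) * (2 * (u * (-B) - v * A)) = 4 * S * E"
    by (simp add: S_def E_def power2_eq_square algebra_simps)
  have "riesz_fun_deriv2 \<alpha> u v A B C D + riesz_fun_deriv2 \<alpha> u v (- B) A (- C) (- D)
     = k * ((\<alpha> - 1) * (P * N) * (4 * X * E) + P * N * N * (4 * E))
       + (\<alpha> - 1) * ((\<alpha> - 2) * P * (4 * X * E) * S + P * N * (4 * E) * S + 2 * P * N * (4 * S * E))"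
    unfolding a[symmetric] b[symmetric]
    unfolding riesz_fun_deriv2_def Let_def N_def[symmetric] S_def[symmetric] P_def[symmetric] P1 P2 k_def[symmetric] E_def
    by (simp add: algebra_simps power2_eq_square)
  also have "\<dots> = 4 * E * P * (k * ((\<alpha> - 1) * X * N + N\<^sup>2) + (\<alpha> - 1) * S * ((\<alpha> - 2) * X + 3 * N))"
    by (simp add: algebra_simps power2_eq_square)
  also have "\<dots> \<ge> 0"
  proof -
    have X: "X \<ge> 0" "N = X + 1" "- X \<le> S" by (auto simp: X_def N_def S_def)
    have "0 \<le> (\<alpha> + 1) * X" using assms X by simp
    then have "0 \<le> (\<alpha> - 2) * X + 3 * N" using X by (simp add: algebra_simps)
    then have "(- X) * ((\<alpha> - 2) * X + 3 * N) \<le> S * ((\<alpha> - 2) * X + 3 * N)"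
      using X(3) by (rule mult_right_mono[rotated])
    then have s: "(\<alpha> - 1) * ((- X) * ((\<alpha> - 2) * X + 3 * N)) \<le> (\<alpha> - 1) * (S * ((\<alpha> - 2) * X + 3 * N))"
      using assms by (intro mult_left_mono) auto
    have k: "\<alpha> * k = (\<alpha> - 1) * (\<alpha> + 1)" using assms
      by (simp add: k_def field_simps power2_eq_square)
    have "\<alpha> * (k * ((\<alpha> - 1) * X * N + N\<^sup>2) + (\<alpha> - 1) * ((- X) * ((\<alpha> - 2) * X + 3 * N)))
       = (\<alpha> - 1) * ((\<alpha>\<^sup>2 - \<alpha> + 1) * X + \<alpha> + 1)"
      unfolding distrib_left mult.assoc[symmetric] k X(2)
      by (simp add: algebra_simps power2_eq_square)
    also have "\<dots> \<ge> 0"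
    proof -
      have "\<alpha>\<^sup>2 \<ge> \<alpha>" using assms by (simp add: power2_eq_square)
      then have "(\<alpha>\<^sup>2 - \<alpha> + 1) * X \<ge> 0" using X by simp
      then show ?thesis using assms by (intro mult_nonneg_nonneg) auto
    qed
    finally have "0 \<le> k * ((\<alpha> - 1) * X * N + N\<^sup>2) + (\<alpha> - 1) * ((- X) * ((\<alpha> - 2) * X + 3 * N))"
      using assms by (simp add: zero_le_mult_iff)
    with s have "0 \<le> k * ((\<alpha> - 1) * X * N + N\<^sup>2) + (\<alpha> - 1) * S * ((\<alpha> - 2) * X + 3 * N)"
      by (simp add: mult.assoc)
    moreover have "E \<ge> 0" "P \<ge> 0" by (auto simp: E_def P_def)
    ultimately show ?thesis by simp
  qed
  finally show ?thesis .
qed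

text \<open>The function equals \<open>- N\<^sup>\<alpha> / \<alpha>\<^sup>2 + N\<^sup>\<alpha>\<^sup>-\<^sup>1 y\<close> with \<open>y = 2u\<^sup>2 + 1\<close>. The second term is absorbed by half of the
  first one when \<open>y\<close> is small compared to \<open>N\<close>, and is bounded by a multiple of \<open>y\<^sup>\<alpha>\<close> otherwise.\<close>

lemma riesz_fun_upper_bound:
  assumes "\<alpha> > 1"
  shows "riesz_fun \<alpha> u v \<le>
    - (1 / (2 * \<alpha>\<^sup>2)) * (u\<^sup>2 + v\<^sup>2 + 1) powr \<alpha> + (1 / (2 * \<alpha>\<^sup>2)) powr (1 - \<alpha>) * (2 * u\<^sup>2 + 1) powr \<alpha>"
proof -
  define N where "N = u\<^sup>2 + v\<^sup>2 + 1"
  define y where "y = 2 * u\<^sup>2 + 1"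
  define d where "d = 1 / (2 * \<alpha>\<^sup>2)"
  have N: "N > 0" unfolding N_def by (rule riesz_base_pos)
  have y: "y > 0" unfolding y_def by (simp add: add_nonneg_pos)
  have d: "d > 0" using assms by (simp add: d_def)
  have P: "N powr \<alpha> = N powr (\<alpha> - 1) * N"
    using powr_add[of N "\<alpha> - 1" 1] N by simp
  have "riesz_fun \<alpha> u v = (1 - 2 * d) * N powr \<alpha> + N powr (\<alpha> - 1) * (y - N)"
    by (simp add: riesz_fun_def N_def y_def d_def algebra_simps)
  also have "\<dots> = - 2 * d * N powr \<alpha> + N powr (\<alpha> - 1) * y"
    unfolding P by (simp add: algebra_simps)
  finally have 1: "riesz_fun \<alpha> u v = - 2 * d * N powr \<alpha> + N powr (\<alpha> - 1) * y" .
  have "N powr (\<alpha> - 1) * y \<le> d * N powr \<alpha> + d powr (1 - \<alpha>) * y powr \<alpha>"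
  proof (cases "y \<le> d * N")
    case True
    then have "N powr (\<alpha> - 1) * y \<le> N powr (\<alpha> - 1) * (d * N)"
      by (intro mult_left_mono) auto
    also have "\<dots> = d * N powr \<alpha>" by (simp add: P)
    finally show ?thesis by (smt (verit) powr_ge_zero mult_nonneg_nonneg)
  next
    case False
    then have "N \<le> y / d" using d by (simp add: field_simps)
    then have "N powr (\<alpha> - 1) * y \<le> (y / d) powr (\<alpha> - 1) * y"
      using assms N y by (intro mult_right_mono powr_mono2) auto
    also have "\<dots> = d powr (1 - \<alpha>) * y powr \<alpha>"
      using powr_add[of y "\<alpha> - 1" 1] y d by (simp add: powr_divide powr_minus_divide[of d "\<alpha> - 1", simplified])
    finally show ?thesis using d by (smt (verit) powr_ge_zero mult_nonneg_nonneg)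
  qed
  then show ?thesis unfolding 1 N_def[symmetric] y_def[symmetric] d_def[symmetric] by simp
qed


lemma continuous_riesz_fun [continuous_intros]:
  assumes "continuous_on A u" "continuous_on A v"
  shows "continuous_on A (\<lambda>x. riesz_fun \<alpha> (u x) (v x))"
  unfolding riesz_fun_def
  by (intro continuous_intros assms ballI) (metis riesz_base_pos less_irrefl)+

lemma continuous_riesz_fun_deriv:
  assumes "continuous_on A u" "continuous_on A v" "continuous_on A u1" "continuous_on A v1"
  shows "continuous_on A (\<lambda>x. riesz_fun_deriv \<alpha> (u x) (v x) (u1 x) (v1 x))"
  unfolding riesz_fun_deriv_def Let_def
  by (intro continuous_intros assms ballI) (metis riesz_base_pos less_irrefl)+

lemma continuous_riesz_fun_deriv2:
  assumes "continuous_on A u" "continuous_on A v" "continuous_on A u1" "continuous_on A v1"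
    "continuous_on A u2" "continuous_on A v2"
  shows "continuous_on A (\<lambda>x. riesz_fun_deriv2 \<alpha> (u x) (v x) (u1 x) (v1 x) (u2 x) (v2 x))"
  unfolding riesz_fun_deriv2_def Let_def
  by (intro continuous_intros assms ballI) (metis riesz_base_pos less_irrefl)+

text \<open>In logarithmic coordinates \<open>z = exp (x + \<i> t)\<close> let \<open>K x\<close> be the integral over \<open>t\<close>. Its second
  derivative is the integral of the Laplacian, because the second \<open>t\<close>-derivative integrates to zero
  over a period. So \<open>K\<close> is convex; as it stays bounded when \<open>x \<rightarrow> -\<infinity>\<close>, it is nondecreasing. Near
  \<open>-\<infinity>\<close> it is positive, since the function is positive at the real number \<open>F 0\<close>.\<close>

lemma riesz_fun_circle_mean_nonneg:
  assumes F: "F holomorphic_on ball 0 1" and real0: "Im (F 0) = 0" and al: "\<alpha> > 1"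
    and r: "0 \<le> r" "r < 1"
  shows "0 \<le> integral {0..2 * pi} (\<lambda>t. riesz_fun \<alpha> (Re (F (of_real r * cis t))) (Im (F (of_real r * cis t))))"
proof -
  have al2: "\<alpha>\<^sup>2 > 1" using al by (intro one_less_power) auto
  have c0: "0 < 1 - 1 / \<alpha>\<^sup>2" using al2 less_trans[OF zero_less_one al2] by (simp only: diff_gt_0_iff_gt divide_less_eq_1_pos)
  have pos0: "riesz_fun \<alpha> (Re (F 0)) (Im (F 0)) > 0"
    unfolding riesz_fun_def real0 using c0 riesz_base_pos[of "Re (F 0)" 0]
    by (intro add_pos_nonneg mult_pos_pos mult_nonneg_nonneg) auto
  show ?thesis
  proof (cases "r = 0")
    case True
    then show ?thesis using pos0 by (simp add: less_imp_le)
  next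
    case False
    with r have r0: "r > 0" by simp
    define E where "E = (\<lambda>(x::real) (t::real). exp (of_real x) * cis t)"
    define F1 where "F1 = deriv F"
    define F2 where "F2 = deriv F1"
    have F1h: "F1 holomorphic_on ball 0 1" and F2h: "F2 holomorphic_on ball 0 1"
      unfolding F2_def F1_def by (intro holomorphic_deriv F open_ball)+
    have dF: "(F has_field_derivative F1 z) (at z)" "(F1 has_field_derivative F2 z) (at z)"
      if "z \<in> ball 0 1" for z
      unfolding F1_def F2_def using that F F1h
      by (auto intro!: holomorphic_derivI[of _ "ball 0 1"] simp: F1_def)
    have Eb: "E x t \<in> ball 0 1" if "x < 0" for x t
      using that by (simp add: E_def norm_mult)
    define g where "g = (\<lambda>x t. F (E x t))"
    define g1 where "g1 = (\<lambda>x t. E x t * F1 (E x t))"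
    define g2 where "g2 = (\<lambda>x t. E x t * (F1 (E x t) + E x t * F2 (E x t)))"
    have Ex: "((\<lambda>x. E x t) has_vector_derivative E x t) (at x)" for x t
      unfolding E_def
      by (auto intro!: derivative_eq_intros has_vector_derivative_mult_left
            field_vector_diff_chain_at[of of_real 1 x exp "exp (of_real x)", unfolded o_def, simplified])
    have Et: "((\<lambda>t. E x t) has_vector_derivative \<i> * E x t) (at t)" for x t
    proof -
      have "((\<lambda>t. \<i> * of_real t) has_vector_derivative \<i> * 1) (at t)"
        by (intro has_vector_derivative_mult_right has_vector_derivative_of_real) (auto intro!: derivative_eq_intros)
      from field_vector_diff_chain_at[OF this DERIV_exp]
      have "((\<lambda>t. cis t) has_vector_derivative \<i> * cis t) (at t)"
        by (simp add: o_def cis_conv_exp)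
      from has_vector_derivative_mult_right[OF this, of "exp (of_real x)"] show ?thesis
        by (simp add: E_def mult_ac)
    qed
    have gx: "((\<lambda>x. g x t) has_vector_derivative g1 x t) (at x)" if "x < 0" for x t
      unfolding g_def g1_def
      using field_vector_diff_chain_at[OF Ex dF(1)[OF Eb[OF that]]] by (simp add: o_def)
    have gt: "((\<lambda>t. g x t) has_vector_derivative \<i> * g1 x t) (at t)" if "x < 0" for x t
      unfolding g_def g1_def
      using field_vector_diff_chain_at[OF Et dF(1)[OF Eb[OF that]]] by (simp add: o_def mult_ac)
    have d2: "((\<lambda>z. z * F1 z) has_field_derivative (F1 z + z * F2 z)) (at z)" if "z \<in> ball 0 1" for z
      by (auto intro!: derivative_eq_intros dF(2) that)
    have g1x: "((\<lambda>x. g1 x t) has_vector_derivative g2 x t) (at x)" if "x < 0" for x t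
      unfolding g1_def g2_def
      using field_vector_diff_chain_at[OF Ex d2[OF Eb[OF that]]] by (simp add: o_def)
    have g1t: "((\<lambda>t. g1 x t) has_vector_derivative \<i> * g2 x t) (at t)" if "x < 0" for x t
      unfolding g1_def g2_def
      using field_vector_diff_chain_at[OF Et d2[OF Eb[OF that]]] by (simp add: o_def mult_ac)
    have contE: "continuous_on ({..<0} \<times> T) (\<lambda>(x, t). E x t)" for T
      unfolding E_def case_prod_unfold by (intro continuous_intros)
    have comp: "continuous_on ({..<0} \<times> T) (\<lambda>(x, t). H (E x t))" if "H holomorphic_on ball 0 1" for H T
    proof -
      have "(\<lambda>(x, t). E x t) ` ({..<0} \<times> T) \<subseteq> ball 0 1" using Eb by auto
      from continuous_on_compose2[OF holomorphic_on_imp_continuous_on[OF that] contE this]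
      show ?thesis by (simp add: case_prod_unfold)
    qed
    have cg: "continuous_on ({..<0} \<times> T) (\<lambda>(x, t). g x t)" for T
      unfolding g_def by (rule comp[OF F])
    have cg1: "continuous_on ({..<0} \<times> T) (\<lambda>(x, t). g1 x t)" for T
      unfolding g1_def case_prod_unfold
      by (intro continuous_intros comp[OF F1h, unfolded case_prod_unfold] contE[unfolded case_prod_unfold])
    have cg2: "continuous_on ({..<0} \<times> T) (\<lambda>(x, t). g2 x t)" for T
      unfolding g2_def case_prod_unfold
      by (intro continuous_intros comp[OF F1h, unfolded case_prod_unfold]
            comp[OF F2h, unfolded case_prod_unfold] contE[unfolded case_prod_unfold])
    \<comment> \<open>\<open>U\<close> is the composition, \<open>U1\<close> and \<open>U2\<close> its \<open>x\<close>-derivatives, \<open>V1\<close> and \<open>V2\<close> its \<open>t\<close>-derivatives;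
      going from \<open>x\<close> to \<open>t\<close> multiplies \<open>g1\<close> by \<open>\<i>\<close> and \<open>g2\<close> by \<open>-1\<close>.\<close>
    define U where "U = (\<lambda>x t. riesz_fun \<alpha> (Re (g x t)) (Im (g x t)))"
    define U1 where "U1 = (\<lambda>x t. riesz_fun_deriv \<alpha> (Re (g x t)) (Im (g x t)) (Re (g1 x t)) (Im (g1 x t)))"
    define U2 where "U2 = (\<lambda>x t. riesz_fun_deriv2 \<alpha> (Re (g x t)) (Im (g x t)) (Re (g1 x t)) (Im (g1 x t))
       (Re (g2 x t)) (Im (g2 x t)))"
    define V1 where "V1 = (\<lambda>x t. riesz_fun_deriv \<alpha> (Re (g x t)) (Im (g x t)) (- Im (g1 x t)) (Re (g1 x t)))"
    define V2 where "V2 = (\<lambda>x t. riesz_fun_deriv2 \<alpha> (Re (g x t)) (Im (g x t)) (- Im (g1 x t)) (Re (g1 x t))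
       (- Re (g2 x t)) (- Im (g2 x t)))"
    have Ux: "((\<lambda>x. U x t) has_real_derivative U1 x t) (at x)" if "x < 0" for x t
      unfolding U_def U1_def
      by (rule DERIV_riesz_fun) (intro has_field_derivative_Re has_field_derivative_Im gx that)+
    have U1x: "((\<lambda>x. U1 x t) has_real_derivative U2 x t) (at x)" if "x < 0" for x t
      unfolding U1_def U2_def
      by (rule DERIV_riesz_fun_deriv) (intro has_field_derivative_Re has_field_derivative_Im gx g1x that)+
    have Vt: "((\<lambda>t. V1 x t) has_real_derivative V2 x t) (at t)" if "x < 0" for x t
      unfolding V1_def V2_def
    proof (rule DERIV_riesz_fun_deriv)
      show "((\<lambda>t. Re (g x t)) has_real_derivative - Im (g1 x t)) (at t)"
        using has_field_derivative_Re[OF gt[OF that]] by simp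
      show "((\<lambda>t. Im (g x t)) has_real_derivative Re (g1 x t)) (at t)"
        using has_field_derivative_Im[OF gt[OF that]] by simp
      show "((\<lambda>t. - Im (g1 x t)) has_real_derivative - Re (g2 x t)) (at t)"
        using has_field_derivative_Im[OF g1t[OF that]] by (auto intro: DERIV_minus)
      show "((\<lambda>t. Re (g1 x t)) has_real_derivative - Im (g2 x t)) (at t)"
        using has_field_derivative_Re[OF g1t[OF that]] by simp
    qed
    have cU: "continuous_on ({..<0} \<times> T) (\<lambda>(x, t). U x t)" for T
      using cg[of T] unfolding U_def case_prod_unfold by (intro continuous_intros)
    have cU1: "continuous_on ({..<0} \<times> T) (\<lambda>(x, t). U1 x t)" for T
      using cg[of T] cg1[of T] unfolding U1_def case_prod_unfold
      by (intro continuous_riesz_fun_deriv continuous_intros)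
    have cU2: "continuous_on ({..<0} \<times> T) (\<lambda>(x, t). U2 x t)" for T
      using cg[of T] cg1[of T] cg2[of T] unfolding U2_def case_prod_unfold
      by (intro continuous_riesz_fun_deriv2 continuous_intros)
    have slice: "continuous_on T (\<lambda>t. H x t)" if "continuous_on ({..<0} \<times> T) (\<lambda>(x, t). H x t)" "x < 0"
      for H :: "real \<Rightarrow> real \<Rightarrow> real" and T x
    proof -
      have "continuous_on T (\<lambda>t. (case (x, t) of (x, t) \<Rightarrow> H x t))"
        by (rule continuous_on_compose2[OF that(1)]) (use that(2) in \<open>auto intro!: continuous_intros\<close>)
      then show ?thesis by simp
    qed
    define K where "K = (\<lambda>x. integral {0..2*pi} (U x))"
    define J where "J = (\<lambda>x. integral {0..2*pi} (U1 x))"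
    have iU: "U x integrable_on {0..2*pi}" if "x < 0" for x
      using slice[OF cU that, of "{0..2*pi}"] by (intro integrable_continuous_real) (simp add: eta_contract_eq)
    have iU1: "U1 x integrable_on {0..2*pi}" if "x < 0" for x
      using slice[OF cU1 that, of "{0..2*pi}"] by (intro integrable_continuous_real) simp
    have iU2: "U2 x integrable_on {0..2*pi}" if "x < 0" for x
      using slice[OF cU2 that, of "{0..2*pi}"] by (intro integrable_continuous_real) simp
    have at0: "at x within {..<0} = at x" if "x < 0" for x :: real
      using that by (intro at_within_open) auto
    have dK: "(K has_real_derivative J x) (at x)" if "x < 0" for x
    proof -
      have "((\<lambda>x. integral (cbox 0 (2*pi)) (U x)) has_field_derivative integral (cbox 0 (2*pi)) (U1 x)) (at x within {..<0})"
        using Ux iU cU1 that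
        by (intro leibniz_rule_field_derivative) (auto intro: has_field_derivative_at_within)
      then show ?thesis using at0[OF that] by (simp add: K_def J_def)
    qed
    have dJ: "(J has_real_derivative integral {0..2*pi} (U2 x)) (at x)" if "x < 0" for x
    proof -
      have "((\<lambda>x. integral (cbox 0 (2*pi)) (U1 x)) has_field_derivative integral (cbox 0 (2*pi)) (U2 x)) (at x within {..<0})"
        using U1x iU1 cU2 that
        by (intro leibniz_rule_field_derivative) (auto intro: has_field_derivative_at_within)
      then show ?thesis using at0[OF that] by (simp add: J_def)
    qed
    have J'_nonneg: "0 \<le> integral {0..2*pi} (U2 x)" if x: "x < 0" for x
    proof -
      have "(V2 x has_integral (V1 x (2*pi) - V1 x 0)) {0..2*pi}"
        using Vt[OF x]
        by (intro fundamental_theorem_of_calculus)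
          (simp_all add: has_real_derivative_iff_has_vector_derivative has_vector_derivative_at_within)
      moreover have "V1 x (2*pi) = V1 x 0"
        by (simp add: V1_def g_def g1_def E_def)
      ultimately have V: "(V2 x has_integral 0) {0..2*pi}" by simp
      have sum: "((\<lambda>t. U2 x t + V2 x t) has_integral (integral {0..2*pi} (U2 x) + 0)) {0..2*pi}"
        by (intro has_integral_add V integrable_integral iU2 x)
      have "0 \<le> U2 x t + V2 x t" for t
        unfolding U2_def V2_def by (rule riesz_fun_laplacian_nonneg[OF al])
      then show ?thesis using has_integral_nonneg[OF sum] by simp
    qed
    have J_mono: "J x \<le> J y" if "x \<le> y" "y < 0" for x y
    proof (rule DERIV_nonneg_imp_nondecreasing[OF that(1)])
      fix s assume "x \<le> s" "s \<le> y"
      then have "s < 0" using that by simp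
      with dJ J'_nonneg show "\<exists>d. (J has_real_derivative d) (at s) \<and> 0 \<le> d" by blast
    qed
    have J_nonneg: "0 \<le> J y" if y: "y < 0" for y
    proof (rule ccontr)
      assume "\<not> 0 \<le> J y"
      then have neg: "J y < 0" by simp
      have lin: "K y - J y * (y - x) \<le> K x" if "x \<le> y" for x
      proof -
        have "(\<lambda>x. J y * x - K x) x \<le> (\<lambda>x. J y * x - K x) y"
        proof (rule DERIV_nonneg_imp_nondecreasing[OF that])
          fix s assume s: "x \<le> s" "s \<le> y"
          have "((\<lambda>x. J y * x - K x) has_real_derivative J y - J s) (at s)"
            using dK[of s] s y by (auto intro!: derivative_eq_intros)
          moreover have "0 \<le> J y - J s" using J_mono[OF s(2) y] by simp
          ultimately show "\<exists>d. ((\<lambda>x. J y * x - K x) has_real_derivative d) (at s) \<and> 0 \<le> d"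
            by blast
        qed
        then show ?thesis by (simp add: algebra_simps)
      qed
      have "compact ((\<lambda>z. riesz_fun \<alpha> (Re (F z)) (Im (F z))) ` cball 0 (exp y))"
        using le_less_trans[of _ "exp y" 1] y by (intro compact_continuous_image continuous_intros compact_cball
            continuous_on_subset[OF holomorphic_on_imp_continuous_on[OF F]]) auto
      from compact_imp_bounded[OF this]
      obtain B where "\<forall>s\<in>(\<lambda>z. riesz_fun \<alpha> (Re (F z)) (Im (F z))) ` cball 0 (exp y). norm s \<le> B"
        unfolding bounded_iff by blast
      then have B: "\<bar>riesz_fun \<alpha> (Re (F z)) (Im (F z))\<bar> \<le> B" if "z \<in> cball 0 (exp y)" for z
        using that by auto
      have UB: "U x t \<le> B" if "x \<le> y" for x t
      proof -
        have "E x t \<in> cball 0 (exp y)" using that by (simp add: E_def norm_mult)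
        from B[OF this] show ?thesis by (simp add: U_def g_def)
      qed
      have KB: "K x \<le> 2 * pi * B" if "x \<le> y" for x
      proof -
        have "K x \<le> integral {0..2*pi} (\<lambda>t. B)"
          unfolding K_def using that y by (intro integral_le iU UB) auto
        then show ?thesis by simp
      qed
      \<comment> \<open>far enough to the left, the tangent line at \<open>y\<close> exceeds the bound for \<open>K\<close>\<close>
      define x where "x = y - (2 * pi * \<bar>B\<bar> + \<bar>K y\<bar> + 1) / (- J y)"
      have xy: "x \<le> y" using neg by (simp add: x_def divide_nonneg_neg divide_nonpos_neg)
      have "J y * (y - x) = - (2 * pi * \<bar>B\<bar> + \<bar>K y\<bar> + 1)"
        using neg by (simp add: x_def)
      with lin[OF xy] KB[OF xy] have "K y + (2 * pi * \<bar>B\<bar> + \<bar>K y\<bar> + 1) \<le> 2 * pi * B" by linarith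
      moreover have "2 * pi * B \<le> 2 * pi * \<bar>B\<bar>" by simp
      ultimately show False by linarith
    qed
    have K_mono: "K x \<le> K y" if "x \<le> y" "y < 0" for x y
    proof (rule DERIV_nonneg_imp_nondecreasing[OF that(1)])
      fix s assume "x \<le> s" "s \<le> y"
      then have "s < 0" using that by simp
      with dK J_nonneg show "\<exists>d. (K has_real_derivative d) (at s) \<and> 0 \<le> d" by blast
    qed
    have "continuous_on (ball 0 1) (\<lambda>z. riesz_fun \<alpha> (Re (F z)) (Im (F z)))"
      using holomorphic_on_imp_continuous_on[OF F] by (intro continuous_intros)
    then have "isCont (\<lambda>z. riesz_fun \<alpha> (Re (F z)) (Im (F z))) 0"
      by (simp add: continuous_on_eq_continuous_at)
    from order_tendstoD(1)[OF this[unfolded isCont_def] pos0]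
    obtain d where "d > 0" "\<And>z. z \<noteq> 0 \<Longrightarrow> norm z < d \<Longrightarrow> riesz_fun \<alpha> (Re (F z)) (Im (F z)) > 0"
      unfolding eventually_at by auto
    with pos0 have d: "d > 0" "\<And>z. norm z < d \<Longrightarrow> riesz_fun \<alpha> (Re (F z)) (Im (F z)) > 0"
      by metis+
    define x where "x = min (ln r) (ln (d / 2))"
    have "exp x \<le> exp (ln (d / 2))" unfolding exp_le_cancel_iff by (simp add: x_def)
    also have "\<dots> = d / 2" using d(1) by simp
    finally have "exp x \<le> d / 2" .
    then have "norm (E x t) < d" for t using d(1) by (simp add: E_def norm_mult)
    then have "0 \<le> K x" unfolding K_def
      by (intro integral_nonneg iU) (use r r0 d(2) in \<open>auto simp: x_def U_def g_def less_imp_le ln_less_zero min_less_iff_disj\<close>)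
    also have "K x \<le> K (ln r)" using r r0 by (intro K_mono) (auto simp: x_def)
    also have "\<dots> = integral {0..2 * pi} (\<lambda>t. riesz_fun \<alpha> (Re (F (of_real r * cis t))) (Im (F (of_real r * cis t))))"
      using r0 by (simp add: K_def U_def g_def E_def exp_of_real)
    finally show ?thesis .
  qed
qed

section \<open>Cauchy transforms of real functions\<close>

definition cauchy_transform :: "(complex \<Rightarrow> complex) \<Rightarrow> complex \<Rightarrow> complex" where
  "cauchy_transform f w = (LINT z|circle_measure. f z / (1 - w * cnj z))"

lemma cauchy_denominator:
  assumes "norm w < 1" "norm z = 1"
  shows "1 - w * cnj z \<noteq> 0" "1 - norm w \<le> norm (1 - w * cnj z)"
proof -
  show *: "1 - norm w \<le> norm (1 - w * cnj z)"
    using norm_triangle_ineq2[of 1 "w * cnj z"] assms by (simp add: norm_mult)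
  then show "1 - w * cnj z \<noteq> 0" using assms by auto
qed

lemma continuous_cauchy_kernel:
  assumes "norm w < 1"
  shows "continuous_on (sphere 0 1) (\<lambda>z. 1 / (1 - w * cnj z))"
  using cauchy_denominator[OF assms] by (intro continuous_intros) auto

lemma integrable_mult_bounded:
  fixes f g :: "complex \<Rightarrow> 'a :: {real_normed_field, banach, second_countable_topology}"
  assumes "integrable circle_measure f" "g \<in> borel_measurable circle_measure"
    "AE z in circle_measure. norm (g z) \<le> B"
  shows "integrable circle_measure (\<lambda>z. f z * g z)"
proof (rule Bochner_Integration.integrable_bound)
  show "integrable circle_measure (\<lambda>z. B * norm (f z))" using assms(1) by simp
  show "(\<lambda>z. f z * g z) \<in> borel_measurable circle_measure"
    using assms by simp
  show "AE z in circle_measure. norm (f z * g z) \<le> norm (B * norm (f z))"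
    using assms(3)
  proof eventually_elim
    case (elim z)
    then have "norm (f z) * norm (g z) \<le> norm (f z) * \<bar>B\<bar>"
      by (intro mult_left_mono) auto
    then show ?case by (simp add: norm_mult abs_mult mult.commute)
  qed
qed

lemma integrable_mult_cont:
  fixes f g :: "complex \<Rightarrow> 'a :: {real_normed_field, banach, second_countable_topology}"
  assumes "integrable circle_measure f" "continuous_on (sphere 0 1) g"
  shows "integrable circle_measure (\<lambda>z. f z * g z)"
proof -
  obtain B where B: "\<forall>x\<in>g ` sphere 0 1. norm x \<le> B"
    using compact_imp_bounded[OF compact_continuous_image[OF assms(2) compact_sphere]]
    unfolding bounded_iff by blast
  show ?thesis
    by (rule integrable_mult_bounded[OF assms(1) measurable_circle_cont[OF assms(2)], of B]) (use B in auto)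
qed

lemma integrable_cauchy_integrand:
  assumes "integrable circle_measure f" "norm w < 1"
  shows "integrable circle_measure (\<lambda>z. f z / (1 - w * cnj z))"
  using integrable_mult_cont[OF assms(1) continuous_cauchy_kernel[OF assms(2)]] by simp

text \<open>Expand the kernel into a geometric series and integrate term by term.\<close>

lemma holomorphic_cauchy_transform:
  assumes f: "integrable circle_measure f"
  shows "cauchy_transform f holomorphic_on ball 0 1"
proof (rule power_series_holomorphic)
  fix w :: complex assume "w \<in> ball 0 1"
  then have w: "norm w < 1" by simp
  have int: "integrable circle_measure (\<lambda>z. f z * (w * cnj z) ^ n)" for n
    by (intro integrable_mult_cont f continuous_intros)
  have norm_eq: "(LINT z|circle_measure. norm (f z * (w * cnj z) ^ n))
      = norm w ^ n * (LINT z|circle_measure. norm (f z))" for n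
  proof -
    have "(LINT z|circle_measure. norm (f z * (w * cnj z) ^ n)) = (LINT z|circle_measure. norm w ^ n * norm (f z))"
      by (rule Bochner_Integration.integral_cong) (auto simp: norm_mult norm_power)
    then show ?thesis using f by simp
  qed
  have "(\<lambda>n. LINT z|circle_measure. f z * (w * cnj z) ^ n) sums
      (LINT z|circle_measure. (\<Sum>n. f z * (w * cnj z) ^ n))"
  proof (rule sums_integral[OF int])
    show "AE z in circle_measure. summable (\<lambda>n. norm (f z * (w * cnj z) ^ n))"
      using w by (intro AE_I2) (auto simp: norm_mult norm_power intro!: summable_mult summable_geometric)
    show "summable (\<lambda>n. LINT z|circle_measure. norm (f z * (w * cnj z) ^ n))"
      unfolding norm_eq using w by (intro summable_mult2 summable_geometric) auto
  qed
  also have "(LINT z|circle_measure. (\<Sum>n. f z * (w * cnj z) ^ n)) = cauchy_transform f w"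
    unfolding cauchy_transform_def
  proof (rule Bochner_Integration.integral_cong[OF refl])
    fix z :: complex assume "z \<in> space circle_measure"
    then have "norm (w * cnj z) < 1" using w by (simp add: norm_mult)
    from geometric_sums[OF this] show "(\<Sum>n. f z * (w * cnj z) ^ n) = f z / (1 - w * cnj z)"
      by (subst suminf_mult) (auto simp: sums_iff)
  qed
  finally show "(\<lambda>n. (LINT z|circle_measure. f z * cnj z ^ n) * (w - 0) ^ n) sums cauchy_transform f w"
  proof -
    have "(LINT z|circle_measure. f z * (w * cnj z) ^ n) = (LINT z|circle_measure. f z * cnj z ^ n) * (w - 0) ^ n" for n
    proof -
      have "(LINT z|circle_measure. f z * (w * cnj z) ^ n) = (LINT z|circle_measure. f z * cnj z ^ n * w ^ n)"
        by (simp add: power_mult_distrib mult_ac)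
      also have "\<dots> = (LINT z|circle_measure. f z * cnj z ^ n) * w ^ n"
        by (rule Bochner_Integration.integral_mult_left) (intro integrable_mult_cont f continuous_intros)
      finally show ?thesis by simp
    qed
    then show "(\<lambda>n. LINT z|circle_measure. f z * (w * cnj z) ^ n) sums cauchy_transform f w \<Longrightarrow> ?thesis"
      by simp
  qed
qed

text \<open>The average of the Poisson kernel and of the constant one. It serves the same purpose as the
  Poisson kernel and is directly the real part of the Cauchy kernel.\<close>

definition re_kernel :: "complex \<Rightarrow> complex \<Rightarrow> real" where
  "re_kernel w z = Re (1 / (1 - w * cnj z))"

lemma re_kernel_nonneg: "norm w < 1 \<Longrightarrow> norm z = 1 \<Longrightarrow> re_kernel w z \<ge> 0"
proof -
  assume "norm w < 1" "norm z = 1"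
  then have "Re (w * cnj z) \<le> 1"
    using complex_Re_le_cmod[of "w * cnj z"] by (simp add: norm_mult)
  then show ?thesis unfolding re_kernel_def by (simp add: Re_divide)
qed

text \<open>Symmetry makes the averaging operator a contraction on \<open>L\<^sup>p\<close>: after interchanging the integrals
  the kernel again has total mass one.\<close>

lemma re_kernel_sym: "re_kernel (of_real r * w) z = re_kernel (of_real r * z) w"
proof -
  have "1 / (1 - of_real r * w * cnj z) = cnj (1 / (1 - of_real r * z * cnj w))" by (simp add: mult_ac)
  then show ?thesis unfolding re_kernel_def by (simp only: cnj.simps(1))
qed

lemma continuous_re_kernel: "norm w < 1 \<Longrightarrow> continuous_on (sphere 0 1) (re_kernel w)"
  unfolding re_kernel_def by (intro continuous_intros continuous_cauchy_kernel)

lemma integral_re_kernel: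
  assumes "norm w < 1"
  shows "(LINT z|circle_measure. re_kernel w z) = 1"
proof -
  have "(LINT z|circle_measure. 1 / (1 - w * cnj z)) = 1"
    using circle_cauchy_formula[of "\<lambda>_. 1" w] assms by simp
  then show ?thesis unfolding re_kernel_def
    by (subst integral_Re[OF integrable_circle_cont[OF continuous_cauchy_kernel[OF assms]]]) simp
qed

text \<open>Jensen's inequality for the probability density \<open>re_kernel w\<close>. With \<open>m\<close> the average of \<open>|g|\<close>,
  integrate Young's inequality for the product \<open>|g| \<cdot> m\<^sup>p\<^sup>-\<^sup>1\<close>.\<close>

lemma powr_integral_re_kernel_le:
  fixes g :: "complex \<Rightarrow> real"
  assumes g: "integrable circle_measure g" and gp: "integrable circle_measure (\<lambda>z. \<bar>g z\<bar> powr p)"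
    and p: "p > 1" and w: "norm w < 1"
  shows "\<bar>LINT z|circle_measure. g z * re_kernel w z\<bar> powr p
     \<le> (LINT z|circle_measure. \<bar>g z\<bar> powr p * re_kernel w z)"
proof -
  define m where "m = (LINT z|circle_measure. \<bar>g z\<bar> * re_kernel w z)"
  define q where "q = p / (p - 1)"
  have q: "q > 1" "1 / p + 1 / q = 1" using p by (auto simp: q_def field_simps)
  have nn: "AE z in circle_measure. re_kernel w z \<ge> 0"
    using w by (intro AE_I2) (auto intro: re_kernel_nonneg)
  have i1: "integrable circle_measure (\<lambda>z. \<bar>g z\<bar> * re_kernel w z)"
    by (intro integrable_mult_cont continuous_re_kernel w integrable_abs g)
  have i2: "integrable circle_measure (\<lambda>z. \<bar>g z\<bar> powr p * re_kernel w z)"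
    by (intro integrable_mult_cont continuous_re_kernel w gp)
  have i3: "integrable circle_measure (re_kernel w)"
    by (intro integrable_circle_cont continuous_re_kernel w)
  have m0: "m \<ge> 0" unfolding m_def using nn by (intro integral_nonneg_AE) auto
  have le_m: "\<bar>LINT z|circle_measure. g z * re_kernel w z\<bar> \<le> m"
  proof -
    have "\<bar>LINT z|circle_measure. g z * re_kernel w z\<bar> \<le> (LINT z|circle_measure. \<bar>g z * re_kernel w z\<bar>)"
      by (rule integral_abs_bound)
    also have "\<dots> = m" unfolding m_def
      using w by (intro Bochner_Integration.integral_cong) (auto simp: abs_mult re_kernel_nonneg)
    finally show ?thesis .
  qed
  have mq: "(m powr (p - 1)) powr q = m powr p" using p by (simp add: powr_powr q_def)
  have "m powr p = m * m powr (p - 1)"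
    using m0 p by (cases "m = 0") (auto simp: powr_add[of m 1 "p - 1", simplified])
  also have "\<dots> = (LINT z|circle_measure. m powr (p - 1) * (\<bar>g z\<bar> * re_kernel w z))"
    unfolding m_def by (simp add: mult.commute)
  also have "\<dots> \<le> (LINT z|circle_measure. (1 / p) * (\<bar>g z\<bar> powr p * re_kernel w z) + (m powr p / q) * re_kernel w z)"
  proof (rule integral_mono_AE)
    show "AE z in circle_measure. m powr (p - 1) * (\<bar>g z\<bar> * re_kernel w z)
        \<le> (1 / p) * (\<bar>g z\<bar> powr p * re_kernel w z) + (m powr p / q) * re_kernel w z"
      using nn
    proof eventually_elim
      case (elim z)
      have "\<bar>g z\<bar> * m powr (p - 1) \<le> \<bar>g z\<bar> powr p / p + m powr p / q"
        using Youngs_inequality[OF p q, of "\<bar>g z\<bar>" "m powr (p - 1)"] mq by simp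
      from mult_right_mono[OF this elim] show ?case by (simp add: algebra_simps)
    qed
  qed (use i1 i2 i3 in auto)
  also have "\<dots> = (1 / p) * (LINT z|circle_measure. \<bar>g z\<bar> powr p * re_kernel w z) + m powr p / q"
    using i2 i3 integral_re_kernel[OF w] by simp
  finally have "m powr p * (1 - 1 / q) \<le> (1 / p) * (LINT z|circle_measure. \<bar>g z\<bar> powr p * re_kernel w z)"
    by (simp add: algebra_simps)
  moreover have "1 - 1 / q = 1 / p" using q(2) by simp
  ultimately have "m powr p \<le> (LINT z|circle_measure. \<bar>g z\<bar> powr p * re_kernel w z)"
    using p by (simp add: field_simps)
  moreover have "\<bar>LINT z|circle_measure. g z * re_kernel w z\<bar> powr p \<le> m powr p"
    using le_m p by (intro powr_mono2) auto
  ultimately show ?thesis by linarith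
qed

lemma integral_re_kernel_powr_circle:
  fixes g :: "complex \<Rightarrow> real"
  assumes g: "integrable circle_measure g" and gp: "integrable circle_measure (\<lambda>z. \<bar>g z\<bar> powr p)"
    and p: "p > 1" and r: "0 \<le> r" "r < 1"
  shows "(\<integral>\<^sup>+ v. ennreal (\<bar>LINT z|circle_measure. g z * re_kernel (of_real r * v) z\<bar> powr p) \<partial>circle_measure)
     \<le> ennreal (LINT z|circle_measure. \<bar>g z\<bar> powr p)"
proof -
  interpret P: pair_sigma_finite circle_measure circle_measure ..
  have rv: "norm (of_real r * v) < 1" if "v \<in> space circle_measure" for v :: complex
    using that r by (simp add: norm_mult)
  have id[measurable]: "(\<lambda>x. x) \<in> borel_measurable circle_measure"
    by (intro measurable_circle_cont continuous_intros)
  have cnj[measurable]: "cnj \<in> borel_measurable borel"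
    by (intro borel_measurable_continuous_onI continuous_intros)
  have Re[measurable]: "Re \<in> borel_measurable borel"
    by (intro borel_measurable_continuous_onI continuous_intros)
  have f[measurable]: "(\<lambda>z. \<bar>g z\<bar> powr p) \<in> borel_measurable circle_measure" using gp by simp
  have k[measurable]: "(\<lambda>(v, z). re_kernel (of_real r * v) z) \<in> borel_measurable (circle_measure \<Otimes>\<^sub>M circle_measure)"
    unfolding re_kernel_def case_prod_unfold by measurable
  have "(\<integral>\<^sup>+ v. ennreal (\<bar>LINT z|circle_measure. g z * re_kernel (of_real r * v) z\<bar> powr p) \<partial>circle_measure)
    \<le> (\<integral>\<^sup>+ v. (\<integral>\<^sup>+ z. ennreal (\<bar>g z\<bar> powr p * re_kernel (of_real r * v) z) \<partial>circle_measure) \<partial>circle_measure)"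
  proof (rule nn_integral_mono)
    fix v :: complex assume v: "v \<in> space circle_measure"
    have "(\<integral>\<^sup>+ z. ennreal (\<bar>g z\<bar> powr p * re_kernel (of_real r * v) z) \<partial>circle_measure)
       = ennreal (LINT z|circle_measure. \<bar>g z\<bar> powr p * re_kernel (of_real r * v) z)"
      using rv[OF v]
      by (intro nn_integral_eq_integral integrable_mult_cont gp continuous_re_kernel AE_I2)
         (auto intro!: mult_nonneg_nonneg re_kernel_nonneg)
    then show "ennreal (\<bar>LINT z|circle_measure. g z * re_kernel (of_real r * v) z\<bar> powr p)
       \<le> (\<integral>\<^sup>+ z. ennreal (\<bar>g z\<bar> powr p * re_kernel (of_real r * v) z) \<partial>circle_measure)"
      using powr_integral_re_kernel_le[OF g gp p rv[OF v]] by (simp add: ennreal_leI)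
  qed
  also have "\<dots> = (\<integral>\<^sup>+ z. (\<integral>\<^sup>+ v. ennreal (\<bar>g z\<bar> powr p * re_kernel (of_real r * v) z) \<partial>circle_measure) \<partial>circle_measure)"
    by (rule P.Fubini'[symmetric]) measurable
  also have "\<dots> = (\<integral>\<^sup>+ z. ennreal (\<bar>g z\<bar> powr p) \<partial>circle_measure)"
  proof (rule nn_integral_cong)
    fix z :: complex assume z: "z \<in> space circle_measure"
    have c: "continuous_on (sphere 0 1) (\<lambda>v. re_kernel (of_real r * z) v)"
      by (rule continuous_re_kernel[OF rv[OF z]])
    have "(\<integral>\<^sup>+ v. ennreal (\<bar>g z\<bar> powr p * re_kernel (of_real r * v) z) \<partial>circle_measure)
       = (\<integral>\<^sup>+ v. ennreal (\<bar>g z\<bar> powr p * re_kernel (of_real r * z) v) \<partial>circle_measure)"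
      by (simp only: re_kernel_sym)
    also have "\<dots> = ennreal (LINT v|circle_measure. \<bar>g z\<bar> powr p * re_kernel (of_real r * z) v)"
      using rv[OF z]
      by (intro nn_integral_eq_integral integrable_circle_cont continuous_intros c AE_I2)
         (auto intro!: mult_nonneg_nonneg re_kernel_nonneg)
    also have "(LINT v|circle_measure. \<bar>g z\<bar> powr p * re_kernel (of_real r * z) v) = \<bar>g z\<bar> powr p"
      using integral_re_kernel[OF rv[OF z]] by simp
    finally show "(\<integral>\<^sup>+ v. ennreal (\<bar>g z\<bar> powr p * re_kernel (of_real r * v) z) \<partial>circle_measure) = ennreal (\<bar>g z\<bar> powr p)" .
  qed
  also have "\<dots> = ennreal (LINT z|circle_measure. \<bar>g z\<bar> powr p)"
    by (intro nn_integral_eq_integral gp) auto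
  finally show ?thesis .
qed

text \<open>A holomorphic function that is real at the origin is controlled in \<open>L\<^sup>p\<close> by its real part. Integrate
  the upper bound for \<open>riesz_fun\<close> and use that the mean is nonnegative.\<close>

lemma circle_mean_norm_powr_le_Re:
  assumes F: "F holomorphic_on ball 0 1" and real0: "Im (F 0) = 0" and p: "p > 2"
    and r: "0 \<le> r" "r < 1"
  shows "(LINT z|circle_measure. norm (F (of_real r * z)) powr p)
    \<le> (p\<^sup>2 / 2) powr (p / 2) * (LINT z|circle_measure. (2 * (Re (F (of_real r * z)))\<^sup>2 + 1) powr (p / 2))"
proof -
  define \<alpha> where "\<alpha> = p / 2"
  define d where "d = 1 / (2 * \<alpha>\<^sup>2)"
  define H where "H = (\<lambda>z. F (of_real r * z))"
  have al: "\<alpha> > 1" and d: "d > 0" using p by (auto simp: \<alpha>_def d_def)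
  have "(\<lambda>z. of_real r * z :: complex) ` sphere 0 1 \<subseteq> ball 0 1" using r by (auto simp: norm_mult)
  then have H: "continuous_on (sphere 0 1) H"
    unfolding H_def
    by (intro continuous_on_compose2[OF holomorphic_on_imp_continuous_on[OF F]] continuous_intros)
  have pos: "2 * x\<^sup>2 + 1 > (0::real)" for x by (simp add: add_nonneg_pos)
  have c1: "continuous_on (sphere 0 1) (\<lambda>z. riesz_fun \<alpha> (Re (H z)) (Im (H z)))"
    by (intro continuous_intros H)
  have c2: "continuous_on (sphere 0 1) (\<lambda>z. ((Re (H z))\<^sup>2 + (Im (H z))\<^sup>2 + 1) powr \<alpha>)"
    by (intro continuous_intros H ballI) (metis riesz_base_pos less_irrefl)
  have c3: "continuous_on (sphere 0 1) (\<lambda>z. (2 * (Re (H z))\<^sup>2 + 1) powr \<alpha>)"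
    by (intro continuous_intros H ballI) (metis pos less_irrefl)
  have c4: "continuous_on (sphere 0 1) (\<lambda>z. norm (H z) powr p)"
    using p by (intro continuous_on_powr' continuous_intros H) auto
  have "0 \<le> (LINT z|circle_measure. riesz_fun \<alpha> (Re (H z)) (Im (H z)))"
    using riesz_fun_circle_mean_nonneg[OF F real0 al r]
    by (subst circle_integral_cont[OF c1]) (simp add: H_def)
  also have "\<dots> \<le> (LINT z|circle_measure. - d * ((Re (H z))\<^sup>2 + (Im (H z))\<^sup>2 + 1) powr \<alpha>
       + d powr (1 - \<alpha>) * (2 * (Re (H z))\<^sup>2 + 1) powr \<alpha>)"
    unfolding d_def
    by (intro integral_mono integrable_circle_cont continuous_intros c1 c2 c3 riesz_fun_upper_bound al)
  also have "\<dots> = - d * (LINT z|circle_measure. ((Re (H z))\<^sup>2 + (Im (H z))\<^sup>2 + 1) powr \<alpha>)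
       + d powr (1 - \<alpha>) * (LINT z|circle_measure. (2 * (Re (H z))\<^sup>2 + 1) powr \<alpha>)"
    using integrable_circle_cont[OF c2] integrable_circle_cont[OF c3] by simp
  finally have "d * (LINT z|circle_measure. ((Re (H z))\<^sup>2 + (Im (H z))\<^sup>2 + 1) powr \<alpha>)
       \<le> d * (d powr (- \<alpha>) * (LINT z|circle_measure. (2 * (Re (H z))\<^sup>2 + 1) powr \<alpha>))"
    using d by (simp add: powr_add[of d 1 "- \<alpha>", simplified])
  then have 1: "(LINT z|circle_measure. ((Re (H z))\<^sup>2 + (Im (H z))\<^sup>2 + 1) powr \<alpha>)
       \<le> d powr (- \<alpha>) * (LINT z|circle_measure. (2 * (Re (H z))\<^sup>2 + 1) powr \<alpha>)"
    using d by simp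
  have "(LINT z|circle_measure. norm (H z) powr p)
      \<le> (LINT z|circle_measure. ((Re (H z))\<^sup>2 + (Im (H z))\<^sup>2 + 1) powr \<alpha>)"
  proof (intro integral_mono integrable_circle_cont c2 c4)
    fix z
    have "norm (H z) powr p = ((norm (H z))\<^sup>2) powr \<alpha>"
      using powr_powr[of "norm (H z)" 2 \<alpha>] by (simp add: \<alpha>_def)
    also have "\<dots> \<le> ((Re (H z))\<^sup>2 + (Im (H z))\<^sup>2 + 1) powr \<alpha>"
      using al by (intro powr_mono2) (auto simp: cmod_power2)
    finally show "norm (H z) powr p \<le> ((Re (H z))\<^sup>2 + (Im (H z))\<^sup>2 + 1) powr \<alpha>" .
  qed
  also note 1
  also have "d powr (- \<alpha>) = (p\<^sup>2 / 2) powr (p / 2)"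
    using p by (simp add: d_def \<alpha>_def powr_minus powr_divide field_simps power2_eq_square powr_mult)
  finally show ?thesis unfolding H_def \<alpha>_def .
qed

lemma cauchy_transform_Lp_bound_real:
  fixes g :: "complex \<Rightarrow> real"
  assumes g: "integrable circle_measure g" and gp: "integrable circle_measure (\<lambda>z. \<bar>g z\<bar> powr p)" and p: "p > 2"
  shows "\<exists>B. \<forall>r\<in>{0..<1}. (LINT z|circle_measure. norm (cauchy_transform (\<lambda>z. of_real (g z)) (of_real r * z)) powr p) \<le> B"
proof -
  define F where "F = cauchy_transform (\<lambda>z. of_real (g z))"
  define I where "I = (LINT z|circle_measure. \<bar>g z\<bar> powr p)"
  have gc: "integrable circle_measure (\<lambda>z. complex_of_real (g z))" using g by simp
  have F: "F holomorphic_on ball 0 1" unfolding F_def by (rule holomorphic_cauchy_transform[OF gc])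
  have F0: "Im (F 0) = 0" by (simp add: F_def cauchy_transform_def)
  have ReF: "Re (F w) = (LINT z|circle_measure. g z * re_kernel w z)" if "norm w < 1" for w
  proof -
    have "Re (F w) = (LINT z|circle_measure. Re (of_real (g z) / (1 - w * cnj z)))"
      unfolding F_def cauchy_transform_def
      by (rule integral_Re[OF integrable_cauchy_integrand[OF gc that], symmetric])
    also have "\<dots> = (LINT z|circle_measure. g z * re_kernel w z)"
      by (simp add: re_kernel_def Re_divide)
    finally show ?thesis .
  qed
  have "(LINT z|circle_measure. norm (F (of_real r * z)) powr p)
      \<le> (p\<^sup>2 / 2) powr (p / 2) * (4 powr (p / 2) * I + 2 powr (p / 2))" if r: "r \<in> {0..<1}" for r
  proof -
    define u where "u = (\<lambda>z. Re (F (of_real r * z)))"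
    have "(\<lambda>z. of_real r * z :: complex) ` sphere 0 1 \<subseteq> ball 0 1" using r by (auto simp: norm_mult)
    then have u: "continuous_on (sphere 0 1) u"
      unfolding u_def
      by (intro continuous_on_compose2[OF holomorphic_on_imp_continuous_on[OF F]] continuous_intros)
    have pos: "2 * x\<^sup>2 + 1 > (0::real)" for x by (simp add: add_nonneg_pos)
    have c1: "continuous_on (sphere 0 1) (\<lambda>z. (2 * (u z)\<^sup>2 + 1) powr (p / 2))"
      by (intro continuous_intros u ballI) (metis pos less_irrefl)
    have c2: "continuous_on (sphere 0 1) (\<lambda>z. \<bar>u z\<bar> powr p)"
      using p by (intro continuous_on_powr' continuous_intros u) auto
    have pointwise: "(2 * x\<^sup>2 + 1) powr (p / 2) \<le> 4 powr (p / 2) * \<bar>x\<bar> powr p + 2 powr (p / 2)" for x :: real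
    proof (cases "2 * x\<^sup>2 \<le> 1")
      case True
      then have "(2 * x\<^sup>2 + 1) powr (p / 2) \<le> 2 powr (p / 2)"
        using p by (intro powr_mono2) auto
      then show ?thesis by (simp add: add_increasing)
    next
      case False
      then have "(2 * x\<^sup>2 + 1) powr (p / 2) \<le> (4 * x\<^sup>2) powr (p / 2)"
        using p by (intro powr_mono2) auto
      also have "\<dots> = 4 powr (p / 2) * (\<bar>x\<bar> powr 2) powr (p / 2)"
        by (simp add: powr_mult)
      also have "\<dots> = 4 powr (p / 2) * \<bar>x\<bar> powr p"
        unfolding powr_powr by simp
      finally show ?thesis by (simp add: add_increasing2)
    qed
    have "(\<integral>\<^sup>+ v. ennreal (\<bar>u v\<bar> powr p) \<partial>circle_measure) \<le> ennreal I"
    proof -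
      have "(\<integral>\<^sup>+ v. ennreal (\<bar>u v\<bar> powr p) \<partial>circle_measure)
        = (\<integral>\<^sup>+ v. ennreal (\<bar>LINT z|circle_measure. g z * re_kernel (of_real r * v) z\<bar> powr p) \<partial>circle_measure)"
        unfolding u_def using r by (intro nn_integral_cong) (simp add: ReF norm_mult)
      then show ?thesis
        using integral_re_kernel_powr_circle[OF g gp, of r] p r by (simp add: I_def)
    qed
    then have uI: "(LINT v|circle_measure. \<bar>u v\<bar> powr p) \<le> I"
      by (subst (asm) nn_integral_eq_integral) (auto simp: I_def intro!: integrable_circle_cont c2)
    have "(LINT z|circle_measure. norm (F (of_real r * z)) powr p)
      \<le> (p\<^sup>2 / 2) powr (p / 2) * (LINT z|circle_measure. (2 * (u z)\<^sup>2 + 1) powr (p / 2))"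
      unfolding u_def using r by (intro circle_mean_norm_powr_le_Re F F0 p) auto
    also have "(LINT z|circle_measure. (2 * (u z)\<^sup>2 + 1) powr (p / 2))
       \<le> (LINT z|circle_measure. 4 powr (p / 2) * \<bar>u z\<bar> powr p + 2 powr (p / 2))"
      by (intro integral_mono integrable_circle_cont continuous_intros c1 c2 pointwise)
    also have "\<dots> = 4 powr (p / 2) * (LINT z|circle_measure. \<bar>u z\<bar> powr p) + 2 powr (p / 2)"
      using integrable_circle_cont[OF c2] by simp
    also have "\<dots> \<le> 4 powr (p / 2) * I + 2 powr (p / 2)"
      using uI by simp
    finally show ?thesis by (simp add: mult_left_mono)
  qed
  then show ?thesis unfolding F_def by blast
qed

section \<open>Lebesgue spaces and weak convergence\<close>

lemma Lp_integrable:
  assumes f: "f \<in> Lp p" and p: "p \<ge> 1"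
  shows "integrable circle_measure f"
proof (rule Bochner_Integration.integrable_bound)
  show "integrable circle_measure (\<lambda>z. 1 + norm (f z) powr p)" using f by (simp add: Lp_def)
  show "f \<in> borel_measurable circle_measure" using f by (simp add: Lp_def)
  have "x \<le> 1 + x powr p" if "x \<ge> 0" for x :: real
  proof (cases "x \<le> 1")
    case False
    then have "x powr 1 \<le> x powr p" using p by (intro powr_mono) auto
    then show ?thesis using False by simp
  qed (simp add: add_increasing2)
  then show "AE z in circle_measure. norm (f z) \<le> norm (1 + norm (f z) powr p)"
    by (intro AE_I2) auto
qed

lemma Lp_measurable: "f \<in> Lp p \<Longrightarrow> f \<in> borel_measurable circle_measure"
  by (simp add: Lp_def)

lemma Lp_mono_norm:
  assumes f: "f \<in> Lp p" and g: "g \<in> borel_measurable circle_measure" and p: "p > 0"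
    and le: "AE z in circle_measure. norm (g z) \<le> B * norm (f z)" and B: "B \<ge> 0"
  shows "g \<in> Lp p"
proof -
  have "integrable circle_measure (\<lambda>z. norm (g z) powr p)"
  proof (rule Bochner_Integration.integrable_bound)
    show "integrable circle_measure (\<lambda>z. B powr p * norm (f z) powr p)" using f by (simp add: Lp_def)
    show "(\<lambda>z. norm (g z) powr p) \<in> borel_measurable circle_measure" using g by measurable
    show "AE z in circle_measure. norm (norm (g z) powr p) \<le> norm (B powr p * norm (f z) powr p)"
      using le
    proof eventually_elim
      case (elim z)
      have "norm (g z) powr p \<le> (B * norm (f z)) powr p" using elim p by (intro powr_mono2) auto
      then show ?case using B by (simp add: powr_mult)
    qed
  qed
  with g show ?thesis by (simp add: Lp_def)
qed

lemma Linf_subset_Lp: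
  assumes "f \<in> Linf" "p > 0"
  shows "f \<in> Lp p"
proof -
  from assms obtain B where B: "AE z in circle_measure. norm (f z) \<le> B" by (auto simp: Linf_def)
  have m: "f \<in> borel_measurable circle_measure" using assms by (simp add: Linf_def)
  have one: "(\<lambda>_. 1) \<in> Lp p" by (simp add: Lp_def)
  have le: "AE z in circle_measure. norm (f z) \<le> \<bar>B\<bar> * norm (1::complex)" using B by eventually_elim simp
  show ?thesis by (rule Lp_mono_norm[OF one m assms(2) le abs_ge_zero])
qed

lemma Lp_mult_Linf:
  assumes "f \<in> Lp p" "g \<in> Linf" "p > 0"
  shows "(\<lambda>z. f z * g z) \<in> Lp p" "(\<lambda>z. g z * f z) \<in> Lp p"
proof -
  from assms obtain B where B: "AE z in circle_measure. norm (g z) \<le> B" by (auto simp: Linf_def)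
  have m: "f \<in> borel_measurable circle_measure" "g \<in> borel_measurable circle_measure"
    using assms by (auto simp: Linf_def Lp_def)
  have "AE z in circle_measure. norm (f z * g z) \<le> \<bar>B\<bar> * norm (f z)"
    using B
  proof eventually_elim
    case (elim z)
    then have "norm (f z) * norm (g z) \<le> norm (f z) * \<bar>B\<bar>" by (intro mult_left_mono) auto
    then show ?case by (simp add: norm_mult mult.commute)
  qed
  then show "(\<lambda>z. f z * g z) \<in> Lp p"
    by (rule Lp_mono_norm[OF assms(1) borel_measurable_times[OF m] assms(3) _ abs_ge_zero])
  then show "(\<lambda>z. g z * f z) \<in> Lp p" by (simp add: mult.commute)
qed

lemma measurable_cnj_circle [measurable]:
  "f \<in> borel_measurable circle_measure \<Longrightarrow> (\<lambda>z. cnj (f z)) \<in> borel_measurable circle_measure"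
  by (rule borel_measurable_continuous_on[of cnj]) (intro continuous_intros)

lemma Lp_cnj: "f \<in> Lp p \<Longrightarrow> (\<lambda>z. cnj (f z)) \<in> Lp p"
  by (simp add: Lp_def measurable_cnj_circle)

text \<open>A crude substitute for Minkowski's inequality, sufficient because no constants are tracked.\<close>

lemma norm_add_powr_le:
  assumes "p > 0"
  shows "norm (x + y) powr p \<le> 2 powr p * (norm x powr p + norm (y :: 'a :: real_normed_vector) powr p)"
proof -
  have m: "norm (x + y) \<le> 2 * max (norm x) (norm y)" using norm_triangle_ineq[of x y] by linarith
  have "norm (x + y) powr p \<le> (2 * max (norm x) (norm y)) powr p"
    using m assms by (intro powr_mono2) auto
  also have "\<dots> = 2 powr p * max (norm x) (norm y) powr p" by (simp add: powr_mult)
  also have "\<dots> \<le> 2 powr p * (norm x powr p + norm y powr p)" by (simp add: max_def)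
  finally show ?thesis .
qed

lemma Lp_add:
  assumes "f \<in> Lp p" "g \<in> Lp p" "p > 0"
  shows "(\<lambda>z. f z + g z) \<in> Lp p"
proof -
  have m: "f \<in> borel_measurable circle_measure" "g \<in> borel_measurable circle_measure"
    using assms by (auto simp: Lp_def)
  have "integrable circle_measure (\<lambda>z. norm (f z + g z) powr p)"
  proof (rule Bochner_Integration.integrable_bound)
    show "integrable circle_measure (\<lambda>z. 2 powr p * (norm (f z) powr p + norm (g z) powr p))"
      using assms by (auto simp: Lp_def)
    show "(\<lambda>z. norm (f z + g z) powr p) \<in> borel_measurable circle_measure" using m by measurable
    show "AE z in circle_measure. norm (norm (f z + g z) powr p) \<le> norm (2 powr p * (norm (f z) powr p + norm (g z) powr p))"
      using norm_add_powr_le[OF assms(3)] by (intro AE_I2) auto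
  qed
  with m show ?thesis by (simp add: Lp_def)
qed

lemma Lp_uminus: "f \<in> Lp p \<Longrightarrow> (\<lambda>z. - f z) \<in> Lp p"
  by (simp add: Lp_def)

lemma Lp_diff: "f \<in> Lp p \<Longrightarrow> g \<in> Lp p \<Longrightarrow> p > 0 \<Longrightarrow> (\<lambda>z. f z - g z) \<in> Lp p"
  using Lp_add[of f p "\<lambda>z. - g z"] Lp_uminus[of g p] by simp

lemma Linf_cont: "continuous_on (sphere 0 1) f \<Longrightarrow> f \<in> Linf"
proof -
  assume c: "continuous_on (sphere 0 1) f"
  obtain B where "\<forall>x\<in>f ` sphere 0 1. norm x \<le> B"
    using compact_imp_bounded[OF compact_continuous_image[OF c compact_sphere]]
    unfolding bounded_iff by blast
  then show ?thesis unfolding Linf_def using measurable_circle_cont[OF c] by (auto intro!: exI[of _ B])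
qed

lemma Lp_cmult: "f \<in> Lp p \<Longrightarrow> p > 0 \<Longrightarrow> (\<lambda>z. c * f z) \<in> Lp p"
  by (rule Lp_mult_Linf(2)[OF _ Linf_cont[OF continuous_on_const]])

lemma Lp2_iff: "f \<in> Lp 2 \<longleftrightarrow> f \<in> borel_measurable circle_measure \<and> integrable circle_measure (\<lambda>z. (norm (f z))\<^sup>2)"
  by (simp add: Lp_def)

lemma L2_mult_integrable:
  assumes "f \<in> Lp 2" "g \<in> Lp 2"
  shows "integrable circle_measure (\<lambda>z. f z * g z)"
proof (rule Bochner_Integration.integrable_bound)
  show "integrable circle_measure (\<lambda>z. (norm (f z))\<^sup>2 + (norm (g z))\<^sup>2)"
    using assms by (auto simp: Lp2_iff)
  show "(\<lambda>z. f z * g z) \<in> borel_measurable circle_measure" using assms by (auto simp: Lp2_iff)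
  have "norm (f z * g z) \<le> norm ((norm (f z))\<^sup>2 + (norm (g z))\<^sup>2)" for z
  proof -
    have "norm (f z * g z) \<le> 2 * norm (f z) * norm (g z)" by (simp add: norm_mult)
    also have "\<dots> \<le> (norm (f z))\<^sup>2 + (norm (g z))\<^sup>2" by (rule sum_squares_bound)
    also have "\<dots> \<le> norm \<dots>" by simp
    finally show ?thesis .
  qed
  then show "AE z in circle_measure. norm (f z * g z) \<le> norm ((norm (f z))\<^sup>2 + (norm (g z))\<^sup>2)" by simp
qed

lemma L2_inner_integrable: "f \<in> Lp 2 \<Longrightarrow> g \<in> Lp 2 \<Longrightarrow> integrable circle_measure (\<lambda>z. f z * cnj (g z))"
  by (intro L2_mult_integrable Lp_cnj)

lemma cauchy_schwarz_L2:
  assumes "f \<in> Lp 2" "g \<in> Lp 2"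
  shows "norm (L2_inner f g) \<le> L2_norm f * L2_norm g"
proof -
  let ?f = "\<lambda>z. norm (f z)" and ?g = "\<lambda>z. norm (g z)"
  define a b c where "a = (LINT z|circle_measure. (?f z)\<^sup>2)" "b = (LINT z|circle_measure. (?g z)\<^sup>2)"
    "c = (LINT z|circle_measure. ?f z * ?g z)"
  have fi: "integrable circle_measure (\<lambda>z. (?f z)\<^sup>2)" "integrable circle_measure (\<lambda>z. (?g z)\<^sup>2)"
    using assms by (auto simp: Lp2_iff)
  have fg: "integrable circle_measure (\<lambda>z. ?f z * ?g z)"
    using integrable_norm[OF L2_mult_integrable[OF assms]] by (simp add: norm_mult)
  have "norm (L2_inner f g) \<le> (LINT z|circle_measure. norm (f z * cnj (g z)))"
    unfolding L2_inner_def by (rule integral_norm_bound)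
  then have le: "norm (L2_inner f g) \<le> c" by (simp add: norm_mult a_b_c_def)
  have nn: "a \<ge> 0" "b \<ge> 0" by (auto simp: a_b_c_def)
  \<comment> \<open>a quadratic polynomial in \<open>t\<close> that never becomes negative\<close>
  have quad: "0 \<le> a - 2 * t * c + t\<^sup>2 * b" for t
  proof -
    have "0 \<le> (LINT z|circle_measure. (?f z - t * ?g z)\<^sup>2)" by simp
    also have "\<dots> = (LINT z|circle_measure. (?f z)\<^sup>2 - 2 * t * (?f z * ?g z) + t\<^sup>2 * (?g z)\<^sup>2)"
      by (simp add: power2_diff power_mult_distrib algebra_simps)
    also have "\<dots> = a - 2 * t * c + t\<^sup>2 * b" using fi fg by (simp add: a_b_c_def)
    finally show ?thesis .
  qed
  have "c\<^sup>2 \<le> a * b"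
  proof (cases "b = 0")
    case True
    have "c = 0"
    proof (rule ccontr)
      assume "c \<noteq> 0"
      with quad[of "(a + 1) / (2 * c)"] True show False by simp
    qed
    with True show ?thesis by simp
  next
    case False
    with nn have "b > 0" by simp
    with quad[of "c / b"] show ?thesis by (simp add: field_simps power2_eq_square)
  qed
  then have "c \<le> sqrt (a * b)" by (rule real_le_rsqrt)
  with le show ?thesis by (simp add: L2_norm_def a_b_c_def real_sqrt_mult)
qed

lemma fatou_Lp:
  assumes p: "p > 0" and m: "\<And>n. g n \<in> Lp p" and C: "\<And>n. (LINT z|circle_measure. norm (g n z) powr p) \<le> C"
    and lim: "AE z in circle_measure. (\<lambda>n. g n z) \<longlonglongrightarrow> f z"
  shows "f \<in> Lp p" "(LINT z|circle_measure. norm (f z) powr p) \<le> C"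
proof -
  have gm: "g n \<in> borel_measurable circle_measure" for n using m by (simp add: Lp_def)
  have f: "f \<in> borel_measurable circle_measure" by (rule measurable_circle_AE_limit[OF gm lim])
  have C0: "C \<ge> 0" using C[of 0] by (rule order_trans[rotated]) simp
  have "(\<integral>\<^sup>+ z. ennreal (norm (f z) powr p) \<partial>circle_measure)
     = (\<integral>\<^sup>+ z. liminf (\<lambda>n. ennreal (norm (g n z) powr p)) \<partial>circle_measure)"
  proof (rule nn_integral_cong_AE)
    show "AE z in circle_measure. ennreal (norm (f z) powr p) = liminf (\<lambda>n. ennreal (norm (g n z) powr p))"
      using lim
    proof eventually_elim
      case (elim z)
      have "(\<lambda>n. norm (g n z) powr p) \<longlonglongrightarrow> norm (f z) powr p"
        using p by (intro tendsto_powr' tendsto_norm elim tendsto_const) auto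
      then have "(\<lambda>n. ennreal (norm (g n z) powr p)) \<longlonglongrightarrow> ennreal (norm (f z) powr p)"
        by (rule tendsto_ennrealI)
      from lim_imp_Liminf[OF _ this] show ?case by simp
    qed
  qed
  also have "\<dots> \<le> liminf (\<lambda>n. (\<integral>\<^sup>+ z. ennreal (norm (g n z) powr p) \<partial>circle_measure))"
    using gm by (intro nn_integral_liminf) measurable
  also have "\<dots> \<le> ennreal C"
  proof (rule Liminf_le)
    have "(\<integral>\<^sup>+ z. ennreal (norm (g n z) powr p) \<partial>circle_measure) \<le> ennreal C" for n
      using m[of n] C[of n] by (subst nn_integral_eq_integral) (auto simp: Lp_def ennreal_leI)
    then show "\<forall>\<^sub>F n in sequentially. (\<integral>\<^sup>+ z. ennreal (norm (g n z) powr p) \<partial>circle_measure) \<le> ennreal C"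
      by simp
  qed simp
  finally have fin: "(\<integral>\<^sup>+ z. ennreal (norm (f z) powr p) \<partial>circle_measure) \<le> ennreal C" .
  have "integrable circle_measure (\<lambda>z. norm (f z) powr p)"
    using f le_less_trans[OF fin ennreal_less_top] by (intro integrableI_nonneg) auto
  with f show "f \<in> Lp p" by (simp add: Lp_def)
  then show "(LINT z|circle_measure. norm (f z) powr p) \<le> C"
    using fin C0 by (subst (asm) nn_integral_eq_integral) (auto simp: Lp_def)
qed

text \<open>Split according to whether \<open>|g\<^sub>n - f| \<le> R |u|\<close>. Where this holds, \<open>|g\<^sub>n - f| |u|\<close> is dominated by
  \<open>R |u|\<^sup>2\<close> and dominated convergence applies; elsewhere it is at most \<open>|g\<^sub>n - f|\<^sup>2 / R\<close>, whose integral
  is at most \<open>4C / R\<close>.\<close>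

lemma weak_convergence_L2:
  assumes m: "\<And>n. g n \<in> Lp 2" and C: "\<And>n. (LINT z|circle_measure. (norm (g n z))\<^sup>2) \<le> C"
    and lim: "AE z in circle_measure. (\<lambda>n. g n z) \<longlonglongrightarrow> f z" and u: "u \<in> Lp 2"
  shows "(\<lambda>n. LINT z|circle_measure. g n z * u z) \<longlonglongrightarrow> (LINT z|circle_measure. f z * u z)"
proof -
  have f: "f \<in> Lp 2" and fC: "(LINT z|circle_measure. (norm (f z))\<^sup>2) \<le> C"
    using fatou_Lp[of 2 g C f] m C lim by auto
  have C0: "C \<ge> 0" using C[of 0] by (rule order_trans[rotated]) simp
  define d where "d = (\<lambda>n z. norm (g n z - f z))"
  have d2: "(\<lambda>z. g n z - f z) \<in> Lp 2" for n by (intro Lp_diff m f) simp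
  have di: "integrable circle_measure (\<lambda>z. (d n z)\<^sup>2)" for n
    using d2[of n] by (simp add: d_def Lp2_iff)
  have dm: "d n \<in> borel_measurable circle_measure" for n
    unfolding d_def using Lp_measurable[OF d2[of n]] by measurable
  have um: "u \<in> borel_measurable circle_measure" and ui: "integrable circle_measure (\<lambda>z. (norm (u z))\<^sup>2)"
    using u by (auto simp: Lp2_iff)
  have dC: "(LINT z|circle_measure. (d n z)\<^sup>2) \<le> 4 * C" for n
  proof -
    have "(LINT z|circle_measure. (d n z)\<^sup>2) \<le> (LINT z|circle_measure. 2 * (norm (g n z))\<^sup>2 + 2 * (norm (f z))\<^sup>2)"
    proof (rule integral_mono[OF di])
      show "integrable circle_measure (\<lambda>z. 2 * (norm (g n z))\<^sup>2 + 2 * (norm (f z))\<^sup>2)"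
        using m[of n] f by (auto simp: Lp2_iff)
      fix z
      have "(d n z)\<^sup>2 \<le> (norm (g n z) + norm (f z))\<^sup>2"
        unfolding d_def by (intro power_mono norm_triangle_ineq4) simp
      also have "\<dots> \<le> 2 * (norm (g n z))\<^sup>2 + 2 * (norm (f z))\<^sup>2"
        using sum_squares_bound[of "norm (g n z)" "norm (f z)"] by (simp add: power2_sum)
      finally show "(d n z)\<^sup>2 \<le> 2 * (norm (g n z))\<^sup>2 + 2 * (norm (f z))\<^sup>2" .
    qed
    also have "\<dots> = 2 * (LINT z|circle_measure. (norm (g n z))\<^sup>2) + 2 * (LINT z|circle_measure. (norm (f z))\<^sup>2)"
      using m[of n] f by (auto simp: Lp2_iff)
    finally show ?thesis using C[of n] fC by simp
  qed
  have dui: "integrable circle_measure (\<lambda>z. d n z * norm (u z))" for n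
    using integrable_norm[OF L2_mult_integrable[OF d2[of n] u]] by (simp add: norm_mult d_def)
  have lim0: "(\<lambda>n. LINT z|circle_measure. d n z * norm (u z)) \<longlonglongrightarrow> 0"
  proof (rule LIMSEQ_I)
    fix e :: real assume e: "e > 0"
    \<comment> \<open>large enough for \<open>4 * C / R < e / 2\<close>, and positive even if \<open>C = 0\<close>\<close>
    define R where "R = (8 * C + 1) / e"
    have R: "R > 0" using e C0 by (simp add: R_def)
    define t where "t = (\<lambda>n z. min (d n z * norm (u z)) (R * (norm (u z))\<^sup>2))"
    have tm: "t n \<in> borel_measurable circle_measure" for n
      unfolding t_def using dm um by measurable
    have t0: "t n z \<ge> 0" for n z using R by (simp add: t_def d_def)
    have ti: "integrable circle_measure (t n)" for n
      by (rule Bochner_Integration.integrable_bound[OF dui[of n] tm])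
        (use t0 in \<open>auto simp: t_def d_def\<close>)
    have "(\<lambda>n. LINT z|circle_measure. t n z) \<longlonglongrightarrow> (LINT z|circle_measure. 0)"
    proof (rule integral_dominated_convergence[where w = "\<lambda>z. R * (norm (u z))\<^sup>2"])
      show "AE z in circle_measure. (\<lambda>n. t n z) \<longlonglongrightarrow> 0"
        using lim
      proof eventually_elim
        case (elim z)
        have "(\<lambda>n. d n z) \<longlonglongrightarrow> 0"
          unfolding d_def using elim by (simp add: tendsto_norm_zero LIM_zero)
        then have "(\<lambda>n. min (d n z * norm (u z)) (R * (norm (u z))\<^sup>2)) \<longlonglongrightarrow> min (0 * norm (u z)) (R * (norm (u z))\<^sup>2)"
          by (intro tendsto_intros)
        then show ?case using R by (simp add: t_def)
      qed
      show "AE z in circle_measure. norm (t n z) \<le> R * (norm (u z))\<^sup>2" for n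
        using t0 by (intro AE_I2) (simp add: t_def)
    qed (use tm ui in auto)
    then have "\<forall>\<^sub>F n in sequentially. (LINT z|circle_measure. t n z) < e / 2"
      using e by (intro order_tendstoD(2)) auto
    then obtain N where N: "\<And>n. n \<ge> N \<Longrightarrow> (LINT z|circle_measure. t n z) < e / 2"
      by (auto simp: eventually_sequentially)
    have "norm ((LINT z|circle_measure. d n z * norm (u z)) - 0) < e" if "n \<ge> N" for n
    proof -
      have "(LINT z|circle_measure. d n z * norm (u z)) \<le> (LINT z|circle_measure. t n z + (d n z)\<^sup>2 / R)"
      proof (rule integral_mono[OF dui])
        show "integrable circle_measure (\<lambda>z. t n z + (d n z)\<^sup>2 / R)" using ti di by auto
        fix z
        show "d n z * norm (u z) \<le> t n z + (d n z)\<^sup>2 / R"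
        proof (cases "d n z \<le> R * norm (u z)")
          case True
          then have "d n z * norm (u z) \<le> R * norm (u z) * norm (u z)" by (intro mult_right_mono) auto
          then have "t n z = d n z * norm (u z)" by (simp add: t_def power2_eq_square mult.assoc)
          then show ?thesis using R by simp
        next
          case False
          then have "norm (u z) \<le> d n z / R" using R by (simp add: field_simps)
          then have "d n z * norm (u z) \<le> d n z * (d n z / R)" by (intro mult_left_mono) (auto simp: d_def)
          then show ?thesis using t0[of n z] by (simp add: power2_eq_square)
        qed
      qed
      also have "\<dots> = (LINT z|circle_measure. t n z) + (LINT z|circle_measure. (d n z)\<^sup>2) / R"
        using ti di by simp
      also have "\<dots> \<le> (LINT z|circle_measure. t n z) + 4 * C / R"
        using dC[of n] R by (simp add: divide_right_mono)
      also have "4 * C / R < e / 2"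
        using e C0 by (simp add: R_def field_simps)
      finally have "(LINT z|circle_measure. d n z * norm (u z)) < e" using N[OF that] by simp
      moreover have "0 \<le> (LINT z|circle_measure. d n z * norm (u z))"
        by (intro integral_nonneg_AE AE_I2) (simp add: d_def)
      ultimately show ?thesis by simp
    qed
    then show "\<exists>N. \<forall>n\<ge>N. norm ((LINT z|circle_measure. d n z * norm (u z)) - 0) < e" by blast
  qed
  show ?thesis
  proof (rule Lim_transform2)
    show "(\<lambda>n. LINT z|circle_measure. f z * u z) \<longlonglongrightarrow> (LINT z|circle_measure. f z * u z)" by simp
    show "(\<lambda>n. (LINT z|circle_measure. f z * u z) - (LINT z|circle_measure. g n z * u z)) \<longlonglongrightarrow> 0"
    proof (rule Lim_null_comparison[OF _ lim0], rule always_eventually, rule allI)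
      fix n
      have "(LINT z|circle_measure. f z * u z) - (LINT z|circle_measure. g n z * u z)
         = (LINT z|circle_measure. (f z - g n z) * u z)"
        using L2_mult_integrable[OF f u] L2_mult_integrable[OF m u]
        by (simp add: left_diff_distrib)
      also have "norm \<dots> \<le> (LINT z|circle_measure. norm ((f z - g n z) * u z))"
        by (rule integral_norm_bound)
      finally show "norm ((LINT z|circle_measure. f z * u z) - (LINT z|circle_measure. g n z * u z))
         \<le> (LINT z|circle_measure. d n z * norm (u z))"
        by (simp add: norm_mult d_def norm_minus_commute)
    qed
  qed
qed

section \<open>The theorem of M. Riesz for Cauchy transforms\<close>

lemma dilation_cont:
  assumes "F holomorphic_on ball 0 1" "r \<in> {0..<1}"
  shows "continuous_on (cball 0 1) (\<lambda>z. F (of_real r * z))"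
proof (intro continuous_on_compose2[OF holomorphic_on_imp_continuous_on[OF assms(1)]] continuous_intros)
  show "(\<lambda>z. of_real r * z :: complex) ` cball 0 1 \<subseteq> ball 0 1"
  proof (rule image_subsetI)
    fix z :: complex assume "z \<in> cball 0 1"
    then have "r * norm z \<le> r * 1" using assms(2) by (intro mult_left_mono) auto
    then show "of_real r * z \<in> ball 0 1" using assms(2) by (simp add: norm_mult)
  qed
qed

lemma dilation_Lp:
  assumes "F holomorphic_on ball 0 1" "r \<in> {0..<1}" "p > 0"
  shows "(\<lambda>z. F (of_real r * z)) \<in> Lp p"
  by (rule Linf_subset_Lp[OF Linf_cont assms(3)])
    (rule continuous_on_subset[OF dilation_cont[OF assms(1,2)]], auto)

text \<open>Apply the bound for real functions to the real and the imaginary part.\<close>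

lemma cauchy_transform_Lp_bound:
  assumes f: "f \<in> Lp p" and p: "p > 2"
  shows "\<exists>B. \<forall>r\<in>{0..<1}. (LINT z|circle_measure. norm (cauchy_transform f (of_real r * z)) powr p) \<le> B"
proof -
  have fi: "integrable circle_measure f" using f p by (intro Lp_integrable) auto
  have fm: "f \<in> borel_measurable circle_measure" using f by (rule Lp_measurable)
  have Rei: "integrable circle_measure (\<lambda>z. Re (f z))" and Imi: "integrable circle_measure (\<lambda>z. Im (f z))"
    using fi by auto
  have part: "integrable circle_measure (\<lambda>z. \<bar>h z\<bar> powr p)"
    if "h \<in> borel_measurable circle_measure" "\<And>z. \<bar>h z\<bar> \<le> norm (f z)" for h :: "complex \<Rightarrow> real"
  proof -
    have "(\<lambda>z. complex_of_real (h z)) \<in> Lp p"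
      using that p by (intro Lp_mono_norm[OF f, of _ 1] AE_I2) auto
    then show ?thesis by (simp add: Lp_def)
  qed
  have Rep: "integrable circle_measure (\<lambda>z. \<bar>Re (f z)\<bar> powr p)"
    and Imp: "integrable circle_measure (\<lambda>z. \<bar>Im (f z)\<bar> powr p)"
    using part[OF borel_measurable_integrable[OF Rei] abs_Re_le_cmod]
      part[OF borel_measurable_integrable[OF Imi] abs_Im_le_cmod] .
  define U where "U = cauchy_transform (\<lambda>z. of_real (Re (f z)))"
  define V where "V = cauchy_transform (\<lambda>z. of_real (Im (f z)))"
  obtain A B where A: "\<And>r. r \<in> {0..<1} \<Longrightarrow> (LINT z|circle_measure. norm (U (of_real r * z)) powr p) \<le> A"
    and B: "\<And>r. r \<in> {0..<1} \<Longrightarrow> (LINT z|circle_measure. norm (V (of_real r * z)) powr p) \<le> B"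
    using cauchy_transform_Lp_bound_real[OF Rei Rep p] cauchy_transform_Lp_bound_real[OF Imi Imp p] unfolding U_def V_def by blast
  have hol: "U holomorphic_on ball 0 1" "V holomorphic_on ball 0 1" "cauchy_transform f holomorphic_on ball 0 1"
    unfolding U_def V_def using Rei Imi fi by (auto intro!: holomorphic_cauchy_transform)
  have split: "cauchy_transform f w = U w + \<i> * V w" if "norm w < 1" for w
  proof -
    have i: "integrable circle_measure (\<lambda>z. of_real (Re (f z)) / (1 - w * cnj z))"
      "integrable circle_measure (\<lambda>z. of_real (Im (f z)) / (1 - w * cnj z))"
      using Rei Imi that by (auto intro!: integrable_cauchy_integrand)
    have "cauchy_transform f w = (LINT z|circle_measure. of_real (Re (f z)) / (1 - w * cnj z)
        + \<i> * (of_real (Im (f z)) / (1 - w * cnj z)))"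
      unfolding cauchy_transform_def
    proof (rule Bochner_Integration.integral_cong[OF refl])
      fix z
      have "f z = of_real (Re (f z)) + \<i> * of_real (Im (f z))" by (rule complex_eq)
      then show "f z / (1 - w * cnj z) = of_real (Re (f z)) / (1 - w * cnj z)
          + \<i> * (of_real (Im (f z)) / (1 - w * cnj z))"
        by (metis add_divide_distrib times_divide_eq_right)
    qed
    also have "\<dots> = U w + \<i> * V w" unfolding U_def V_def cauchy_transform_def
      using i by (simp del: times_divide_eq_right)
    finally show ?thesis .
  qed
  have "(LINT z|circle_measure. norm (cauchy_transform f (of_real r * z)) powr p) \<le> 2 powr p * (A + B)"
    if r: "r \<in> {0..<1}" for r
  proof -
    have i: "integrable circle_measure (\<lambda>z. norm (H (of_real r * z)) powr p)" if "H holomorphic_on ball 0 1" for H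
      using dilation_Lp[OF that r, of p] p by (simp add: Lp_def)
    have "(LINT z|circle_measure. norm (cauchy_transform f (of_real r * z)) powr p)
       \<le> (LINT z|circle_measure. 2 powr p * (norm (U (of_real r * z)) powr p + norm (V (of_real r * z)) powr p))"
    proof (intro integral_mono i hol)
      show "integrable circle_measure (\<lambda>z. 2 powr p * (norm (U (of_real r * z)) powr p + norm (V (of_real r * z)) powr p))"
        using i[OF hol(1)] i[OF hol(2)] by auto
      fix z assume "z \<in> space circle_measure"
      then have "norm (of_real r * z) < 1" using r by (simp add: norm_mult)
      from split[OF this] show "norm (cauchy_transform f (of_real r * z)) powr p
         \<le> 2 powr p * (norm (U (of_real r * z)) powr p + norm (V (of_real r * z)) powr p)"
        using norm_add_powr_le[of p "U (of_real r * z)" "\<i> * V (of_real r * z)"] p by (simp add: norm_mult)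
    qed
    also have "\<dots> = 2 powr p * ((LINT z|circle_measure. norm (U (of_real r * z)) powr p)
         + (LINT z|circle_measure. norm (V (of_real r * z)) powr p))"
      using i[OF hol(1)] i[OF hol(2)] by simp
    also have "\<dots> \<le> 2 powr p * (A + B)"
      using A[OF r] B[OF r] by (intro mult_left_mono add_mono) auto
    finally show ?thesis .
  qed
  then show ?thesis by blast
qed

section \<open>Boundary values and Hardy spaces\<close>

lemma has_nt_limit_radial:
  assumes "has_nt_limit F z l" "norm z = 1" "\<And>n. r n \<in> {0..<1}" "r \<longlonglongrightarrow> 1"
  shows "(\<lambda>n. F (of_real (r n) * z)) \<longlonglongrightarrow> l"
proof -
  have "(F \<longlongrightarrow> l) (at z within stolz_angle z 2)" using assms(1) by (simp add: has_nt_limit_def)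
  moreover have "filterlim (\<lambda>n. of_real (r n) * z) (at z within stolz_angle z 2) sequentially"
  proof -
    have "(\<lambda>n. of_real (r n) * z) \<longlonglongrightarrow> of_real 1 * z" by (intro tendsto_intros assms(4))
    moreover have "of_real (r n) * z \<in> stolz_angle z 2 \<and> of_real (r n) * z \<noteq> z" for n
    proof -
      have r: "0 \<le> r n" "r n < 1" using assms(3)[of n] by auto
      have "of_real (r n) * z - z = of_real (r n - 1) * z" by (simp add: algebra_simps)
      then have "norm (of_real (r n) * z - z) = 1 - r n" using r assms(2) by (simp add: norm_mult del: of_real_diff)
      then show ?thesis using r assms(2) by (auto simp: stolz_angle_def norm_mult)
    qed
    ultimately show ?thesis unfolding filterlim_at by simp
  qed
  ultimately show ?thesis by (rule filterlim_compose)
qed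

definition radii :: "nat \<Rightarrow> real" where "radii n = 1 - inverse (of_nat (Suc n))"

lemma radii: "radii n \<in> {0..<1}" "radii \<longlonglongrightarrow> 1"
proof -
  show "radii n \<in> {0..<1}" by (auto simp: radii_def field_simps)
  show "radii \<longlonglongrightarrow> 1" unfolding radii_def
    using tendsto_diff[OF tendsto_const LIMSEQ_inverse_real_of_nat, of 1] by simp
qed

lemma has_nt_limit_bdry:
  assumes "has_nt_limit F z l" "norm z = 1"
  shows "bdry F z = l"
  unfolding bdry_def
proof (rule the_equality)
  show "has_nt_limit F z l" by (rule assms(1))
next
  fix l' assume "has_nt_limit F z l'"
  from has_nt_limit_radial[OF this assms(2) radii] has_nt_limit_radial[OF assms radii]
  show "l' = l" by (rule LIMSEQ_unique)
qed

lemma has_nt_limit_isCont: "isCont F z \<Longrightarrow> has_nt_limit F z (F z)"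
  unfolding has_nt_limit_def isCont_def by (auto intro: tendsto_within_subset)

lemma has_nt_limit_ops:
  assumes "has_nt_limit F z a" "has_nt_limit G z b"
  shows "has_nt_limit (\<lambda>w. F w * G w) z (a * b)" "has_nt_limit (\<lambda>w. F w - G w) z (a - b)"
    "b \<noteq> 0 \<Longrightarrow> has_nt_limit (\<lambda>w. F w / G w) z (a / b)"
  using assms unfolding has_nt_limit_def by (auto intro!: tendsto_intros)

definition boundary_fun :: "(complex \<Rightarrow> complex) \<Rightarrow> (complex \<Rightarrow> complex) \<Rightarrow> bool" where
  "boundary_fun F f \<longleftrightarrow> (AE z in circle_measure. has_nt_limit F z (f z))"

lemma boundary_fun_radial:
  assumes "boundary_fun F f" "\<And>n. r n \<in> {0..<1}" "r \<longlonglongrightarrow> 1"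
  shows "AE z in circle_measure. (\<lambda>n. F (of_real (r n) * z)) \<longlonglongrightarrow> f z"
  using assms(1) AE_space unfolding boundary_fun_def
  by eventually_elim (auto intro: has_nt_limit_radial assms)

lemma boundary_fun_isCont: "(\<And>z. norm z = 1 \<Longrightarrow> isCont F z) \<Longrightarrow> boundary_fun F F"
  unfolding boundary_fun_def by (intro AE_I2 has_nt_limit_isCont) auto

lemma boundary_fun_ops:
  assumes "boundary_fun F f" "boundary_fun G g"
  shows "boundary_fun (\<lambda>w. F w * G w) (\<lambda>z. f z * g z)" "boundary_fun (\<lambda>w. F w - G w) (\<lambda>z. f z - g z)"
    "AE z in circle_measure. g z \<noteq> 0 \<Longrightarrow> boundary_fun (\<lambda>w. F w / G w) (\<lambda>z. f z / g z)"
proof -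
  show "boundary_fun (\<lambda>w. F w * G w) (\<lambda>z. f z * g z)" "boundary_fun (\<lambda>w. F w - G w) (\<lambda>z. f z - g z)"
    using assms unfolding boundary_fun_def by (eventually_elim; simp add: has_nt_limit_ops)+
  assume "AE z in circle_measure. g z \<noteq> 0"
  with assms show "boundary_fun (\<lambda>w. F w / G w) (\<lambda>z. f z / g z)"
    unfolding boundary_fun_def by eventually_elim (simp add: has_nt_limit_ops)
qed

lemma hardy_disc_boundary:
  assumes F: "F \<in> hardy_disc p" and f: "boundary_fun F f" and p: "p > 0"
  shows "f \<in> hardy p"
proof -
  have hol: "F holomorphic_on ball 0 1" using F by (simp add: hardy_disc_def)
  obtain C where C: "\<And>r. r \<in> {0..<1} \<Longrightarrow> (LINT z|circle_measure. norm (F (of_real r * z)) powr p) \<le> C"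
    using F unfolding hardy_disc_def mem_Collect_eq by blast
  have "f \<in> Lp p"
    using fatou_Lp[OF p dilation_Lp[OF hol radii(1) p] C[OF radii(1)] boundary_fun_radial[OF f radii]] by blast
  with F f show ?thesis unfolding hardy_def boundary_fun_def by blast
qed

lemma hardy_weak_radial:
  assumes F: "F \<in> hardy_disc 2" and f: "boundary_fun F f" and u: "u \<in> Lp 2"
  shows "(\<lambda>n. LINT z|circle_measure. F (of_real (radii n) * z) * u z) \<longlonglongrightarrow> (LINT z|circle_measure. f z * u z)"
proof -
  have hol: "F holomorphic_on ball 0 1" using F by (simp add: hardy_disc_def)
  obtain C where C: "\<And>r. r \<in> {0..<1} \<Longrightarrow> (LINT z|circle_measure. norm (F (of_real r * z)) powr 2) \<le> C"
    using F unfolding hardy_disc_def mem_Collect_eq by blast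
  show ?thesis
    using C[OF radii(1)]
    by (intro weak_convergence_L2[OF dilation_Lp[OF hol radii(1)] _ boundary_fun_radial[OF f radii] u]) auto
qed

lemma cauchy_kernel_Linf: "norm w < 1 \<Longrightarrow> (\<lambda>z. 1 / (1 - w * cnj z)) \<in> Linf"
  by (intro Linf_cont continuous_cauchy_kernel)

text \<open>The formula holds for each dilation of \<open>F\<close>, and the dilations converge weakly to the boundary
  function.\<close>

lemma hardy_cauchy_formula:
  assumes F: "F \<in> hardy_disc 2" and f: "boundary_fun F f" and w: "norm w < 1"
  shows "(LINT z|circle_measure. f z / (1 - w * cnj z)) = F w"
proof (rule LIMSEQ_unique)
  have hol: "F holomorphic_on ball 0 1" using F by (simp add: hardy_disc_def)
  have "(\<lambda>z. 1 / (1 - w * cnj z)) \<in> Lp 2" using w by (intro Linf_subset_Lp cauchy_kernel_Linf) auto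
  from hardy_weak_radial[OF F f this]
  show "(\<lambda>n. LINT z|circle_measure. F (of_real (radii n) * z) / (1 - w * cnj z)) \<longlonglongrightarrow> (LINT z|circle_measure. f z / (1 - w * cnj z))"
    by simp
  have "(LINT z|circle_measure. F (of_real (radii n) * z) / (1 - w * cnj z)) = F (of_real (radii n) * w)" for n
  proof (rule circle_cauchy_formula[OF dilation_cont[OF hol radii(1)] _ w])
    have "(\<lambda>z. of_real (radii n) * z :: complex) ` ball 0 1 \<subseteq> ball 0 1"
    proof (rule image_subsetI)
      fix z :: complex assume "z \<in> ball 0 1"
      moreover have "radii n * norm z \<le> 1 * norm z" using radii(1)[of n] by (intro mult_right_mono) auto
      ultimately show "of_real (radii n) * z \<in> ball 0 1" using radii(1)[of n] by (simp add: norm_mult)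
    qed
    then show "(\<lambda>z. F (of_real (radii n) * z)) holomorphic_on ball 0 1"
      using holomorphic_on_compose_gen[of "\<lambda>z. of_real (radii n) * z" "ball 0 1" F "ball 0 1"] hol
      by (simp add: o_def holomorphic_intros)
  qed
  moreover have "(\<lambda>n. F (of_real (radii n) * w)) \<longlonglongrightarrow> F w"
  proof -
    have "isCont F w" using holomorphic_on_imp_continuous_on[OF hol] w
      by (simp add: continuous_on_eq_continuous_at)
    moreover have "(\<lambda>n. of_real (radii n) * w) \<longlonglongrightarrow> of_real 1 * w" by (intro tendsto_intros radii)
    ultimately show ?thesis using isCont_tendsto_compose[of w F] by simp
  qed
  ultimately show "(\<lambda>n. LINT z|circle_measure. F (of_real (radii n) * z) / (1 - w * cnj z)) \<longlonglongrightarrow> F w" by simp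
qed

lemma hardy_disc_inf_bound:
  assumes "B \<in> hardy_disc_inf"
  shows "\<exists>M. \<forall>z. norm z < 1 \<longrightarrow> norm (B z) \<le> M"
proof -
  obtain M where "\<forall>x\<in>B ` ball 0 1. norm x \<le> M"
    using assms unfolding hardy_disc_inf_def bounded_iff by blast
  then show ?thesis by (intro exI[of _ M]) auto
qed

lemma hardy_disc_inf_mult:
  assumes B: "B \<in> hardy_disc_inf" and F: "F \<in> hardy_disc p" and p: "p > 0"
  shows "(\<lambda>z. B z * F z) \<in> hardy_disc p"
proof -
  have hB: "B holomorphic_on ball 0 1" and hF: "F holomorphic_on ball 0 1"
    using B F by (auto simp: hardy_disc_def hardy_disc_inf_def)
  obtain M where M: "\<And>z. norm z < 1 \<Longrightarrow> norm (B z) \<le> M"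
    using hardy_disc_inf_bound[OF B] by blast
  obtain C where C: "\<And>r. r \<in> {0..<1} \<Longrightarrow> (LINT z|circle_measure. norm (F (of_real r * z)) powr p) \<le> C"
    using F unfolding hardy_disc_def mem_Collect_eq by blast
  have M0: "M \<ge> 0" using order_trans[OF norm_ge_zero M[of 0]] by simp
  have hBF: "(\<lambda>z. B z * F z) holomorphic_on ball 0 1" by (intro holomorphic_intros hB hF)
  have "(LINT z|circle_measure. norm (B (of_real r * z) * F (of_real r * z)) powr p) \<le> M powr p * C"
    if r: "r \<in> {0..<1}" for r
  proof -
    have "(LINT z|circle_measure. norm (B (of_real r * z) * F (of_real r * z)) powr p)
      \<le> (LINT z|circle_measure. M powr p * norm (F (of_real r * z)) powr p)"
    proof (rule integral_mono)
      show "integrable circle_measure (\<lambda>z. norm (B (of_real r * z) * F (of_real r * z)) powr p)"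
        using dilation_Lp[OF hBF r p] by (simp add: Lp_def)
      show "integrable circle_measure (\<lambda>z. M powr p * norm (F (of_real r * z)) powr p)"
        using dilation_Lp[OF hF r p] by (simp add: Lp_def)
      fix z :: complex assume "z \<in> space circle_measure"
      then have "norm (B (of_real r * z)) \<le> M" using r by (intro M) (simp add: norm_mult)
      then have "(norm (B (of_real r * z)) * norm (F (of_real r * z))) powr p \<le> (M * norm (F (of_real r * z))) powr p"
        using p by (intro powr_mono2 mult_right_mono) auto
      then show "norm (B (of_real r * z) * F (of_real r * z)) powr p \<le> M powr p * norm (F (of_real r * z)) powr p"
        using M0 by (simp add: norm_mult powr_mult)
    qed
    also have "\<dots> \<le> M powr p * C"
      using dilation_Lp[OF hF r p] C[OF r] by (simp add: Lp_def mult_left_mono)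
    finally show ?thesis .
  qed
  with hBF show ?thesis unfolding hardy_disc_def mem_Collect_eq by blast
qed

lemma const_hardy_disc: "(\<lambda>_. 1) \<in> hardy_disc p"
  unfolding hardy_disc_def by (auto intro!: exI[of _ 1])

lemma hardy_disc_inf_subset: "B \<in> hardy_disc_inf \<Longrightarrow> p > 0 \<Longrightarrow> B \<in> hardy_disc p"
  using hardy_disc_inf_mult[OF _ const_hardy_disc] by simp

lemma hardy_disc_inf_cont:
  assumes "B holomorphic_on ball 0 1" "continuous_on (cball 0 1) B"
  shows "B \<in> hardy_disc_inf"
proof -
  have "bounded (B ` cball 0 1)" by (intro compact_imp_bounded compact_continuous_image assms compact_cball)
  then have "bounded (B ` ball 0 1)" by (rule bounded_subset) auto
  with assms show ?thesis by (simp add: hardy_disc_inf_def)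
qed

lemma hardy_disc_inf_boundary:
  assumes B: "B \<in> hardy_disc_inf" and b: "boundary_fun B b"
  shows "b \<in> hardy_inf"
proof -
  obtain M where M: "\<And>z. norm z < 1 \<Longrightarrow> norm (B z) \<le> M"
    using hardy_disc_inf_bound[OF B] by blast
  have "b \<in> hardy 1" by (intro hardy_disc_boundary[of B] hardy_disc_inf_subset B b) auto
  then have "b \<in> borel_measurable circle_measure" by (simp add: hardy_def Lp_def)
  moreover have "AE z in circle_measure. norm (b z) \<le> M"
    using boundary_fun_radial[OF b radii] AE_space
  proof eventually_elim
    case (elim z)
    have "norm (of_real (radii n) * z) < 1" for n using radii(1)[of n] elim(2) by (simp add: norm_mult)
    then show ?case using M tendsto_norm[OF elim(1)] by (intro Lim_bounded[of _ _ 0]) auto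
  qed
  ultimately show ?thesis using B b unfolding hardy_inf_def Linf_def boundary_fun_def by blast
qed

lemma L2_inner_commute: "L2_inner g f = cnj (L2_inner f g)"
  unfolding L2_inner_def Bochner_Integration.integral_cnj[symmetric] by (simp add: mult.commute)

lemma L2_inner_self: "L2_inner f f = of_real (LINT z|circle_measure. (norm (f z))\<^sup>2)"
  unfolding L2_inner_def integral_complex_of_real[symmetric] by (simp only: complex_norm_square)

lemma hardy_disc_infI:
  assumes "F holomorphic_on ball 0 1" "\<And>z. norm z < 1 \<Longrightarrow> norm (F z) \<le> M"
  shows "F \<in> hardy_disc_inf"
  using assms unfolding hardy_disc_inf_def bounded_iff by (auto intro!: exI[of _ M])

lemma hardy_disc_inf_holomorphic: "F \<in> hardy_disc_inf \<Longrightarrow> F holomorphic_on ball 0 1"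
  by (simp add: hardy_disc_inf_def)

lemma has_nt_limit_const: "has_nt_limit (\<lambda>_. c) z c"
  by (simp add: has_nt_limit_def)

lemma boundary_fun_const: "boundary_fun (\<lambda>_. c) (\<lambda>_. c)"
  by (simp add: boundary_fun_def has_nt_limit_const)

lemma hardy_disc_inf_times:
  assumes "A \<in> hardy_disc_inf" "B \<in> hardy_disc_inf"
  shows "(\<lambda>z. A z * B z) \<in> hardy_disc_inf"
proof -
  obtain M N where M: "\<forall>z. norm z < 1 \<longrightarrow> norm (A z) \<le> M" and N: "\<forall>z. norm z < 1 \<longrightarrow> norm (B z) \<le> N"
    using hardy_disc_inf_bound assms by meson
  have b: "norm (A z * B z) \<le> M * N" if "norm z < 1" for z
    using M N that order_trans[OF norm_ge_zero, of "A z" M] by (simp add: norm_mult mult_mono)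
  have h: "(\<lambda>z. A z * B z) holomorphic_on ball 0 1"
    by (intro holomorphic_intros hardy_disc_inf_holomorphic assms)
  show ?thesis by (rule hardy_disc_infI[OF h b])
qed

lemma hardy_disc_inf_diff:
  assumes "A \<in> hardy_disc_inf" "B \<in> hardy_disc_inf"
  shows "(\<lambda>z. A z - B z) \<in> hardy_disc_inf"
proof -
  obtain M N where M: "\<forall>z. norm z < 1 \<longrightarrow> norm (A z) \<le> M" and N: "\<forall>z. norm z < 1 \<longrightarrow> norm (B z) \<le> N"
    using hardy_disc_inf_bound assms by meson
  have b: "norm (A z - B z) \<le> M + N" if "norm z < 1" for z
    using M N that norm_triangle_ineq4[of "A z" "B z"] by (meson add_mono order_trans)
  have h: "(\<lambda>z. A z - B z) holomorphic_on ball 0 1"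
    by (intro holomorphic_intros hardy_disc_inf_holomorphic assms)
  show ?thesis by (rule hardy_disc_infI[OF h b])
qed

lemma hardy_disc_inf_const: "(\<lambda>_. c) \<in> hardy_disc_inf"
  by (intro hardy_disc_inf_cont) auto

lemma hardy_disc_inf_ident: "(\<lambda>z. z) \<in> hardy_disc_inf"
  by (intro hardy_disc_inf_cont continuous_intros holomorphic_intros)

lemma szego_denominator:
  assumes "norm w < 1" "norm z \<le> 1"
  shows "1 - cnj w * z \<noteq> 0"
proof
  assume "1 - cnj w * z = 0"
  then have "norm (cnj w * z) = 1" by (metis eq_iff_diff_eq_0 norm_one)
  moreover have "norm w * norm z \<le> norm w * 1" using assms by (intro mult_left_mono) auto
  ultimately show False using assms by (simp add: norm_mult)
qed

lemma szego_hardy_disc_inf: "norm w < 1 \<Longrightarrow> (\<lambda>z. 1 / (1 - cnj w * z)) \<in> hardy_disc_inf"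
  using szego_denominator by (intro hardy_disc_inf_cont continuous_intros holomorphic_intros) auto

lemma szego_boundary: "norm w < 1 \<Longrightarrow> boundary_fun (\<lambda>z. 1 / (1 - cnj w * z)) (\<lambda>z. 1 / (1 - cnj w * z))"
  using szego_denominator by (intro boundary_fun_isCont continuous_intros) auto

text \<open>Backward shifts at \<open>w\<close>: dividing out a zero in the disc keeps a bounded function bounded.\<close>

lemma difference_quotient_hardy_disc_inf:
  assumes F: "F \<in> hardy_disc_inf" and w: "norm w < 1"
  shows "(\<lambda>z. if z = w then deriv F w else (F z - F w) / (z - w)) \<in> hardy_disc_inf" (is "?Q \<in> _")
proof -
  have hol: "?Q holomorphic_on ball 0 1"
    using F by (intro pole_lemma_open) (auto simp: hardy_disc_inf_def)
  obtain M where M: "\<And>z. norm z < 1 \<Longrightarrow> norm (F z) \<le> M" using hardy_disc_inf_bound[OF F] by blast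
  define d where "d = (1 - norm w) / 2"
  have d: "d > 0" using w by (simp add: d_def)
  have sub: "cball w d \<subseteq> ball 0 1"
  proof
    fix z assume "z \<in> cball w d"
    then have "norm (z - w) \<le> d" by (simp add: dist_norm norm_minus_commute)
    moreover have "norm z \<le> norm w + norm (z - w)" using norm_triangle_ineq[of w "z - w"] by simp
    ultimately show "z \<in> ball 0 1" using w by (simp add: d_def field_simps)
  qed
  have "bounded (?Q ` cball w d)"
    by (intro compact_imp_bounded compact_continuous_image compact_cball
        continuous_on_subset[OF holomorphic_on_imp_continuous_on[OF hol] sub])
  then obtain N where N: "\<forall>x\<in>?Q ` cball w d. norm x \<le> N" unfolding bounded_iff by blast
  have "norm (?Q z) \<le> max N (2 * M / d)" if z: "norm z < 1" for z
  proof (cases "z \<in> cball w d")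
    case True
    then show ?thesis using N by (intro max.coboundedI1) blast
  next
    case False
    then have dz: "norm (z - w) > d" by (simp add: dist_norm norm_minus_commute)
    then have "z \<noteq> w" using d by auto
    then have "norm (?Q z) = norm (F z - F w) / norm (z - w)" by (simp add: norm_divide)
    also have "\<dots> \<le> (M + M) / d"
      using dz d M[OF z] M[OF w] norm_triangle_ineq4[of "F z" "F w"] order_trans[OF norm_ge_zero M[OF w]]
      by (intro frac_le) auto
    finally show ?thesis by (intro max.coboundedI2) (simp add: field_simps)
  qed
  then show ?thesis by (rule hardy_disc_infI[OF hol])
qed

lemma difference_quotient_boundary:
  assumes f: "boundary_fun F f" and w: "norm w < 1"
  shows "boundary_fun (\<lambda>z. if z = w then deriv F w else (F z - F w) / (z - w)) (\<lambda>z. (f z - F w) / (z - w))"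
  using f AE_space unfolding boundary_fun_def
proof eventually_elim
  case (elim z)
  then have zw: "z \<noteq> w" using w by auto
  have "has_nt_limit (\<lambda>z. F z - F w) z (f z - F w)"
    by (rule has_nt_limit_ops(2)[OF elim(1) has_nt_limit_const])
  moreover have "has_nt_limit (\<lambda>z. z - w) z (z - w)"
    by (rule has_nt_limit_isCont) (intro continuous_intros)
  ultimately have lim: "has_nt_limit (\<lambda>z. (F z - F w) / (z - w)) z ((f z - F w) / (z - w))"
    using zw by (intro has_nt_limit_ops(3)) auto
  have eq: "\<forall>\<^sub>F x in at z within S. (F x - F w) / (x - w) = (if x = w then deriv F w else (F x - F w) / (x - w))" for S
  proof -
    have "\<forall>\<^sub>F x in at z within S. x \<noteq> w"
      using tendsto_imp_eventually_ne[OF tendsto_ident_at zw] .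
    then show ?thesis by eventually_elim simp
  qed
  show ?case using lim unfolding has_nt_limit_def by (simp only: tendsto_cong[OF eq])
qed

lemma hardy_2I:
  assumes "F \<in> hardy_disc 2" "boundary_fun F f"
  shows "f \<in> hardy 2"
  using hardy_disc_boundary[OF assms] by simp

lemma hardy_2E:
  assumes "f \<in> hardy 2"
  obtains F where "F \<in> hardy_disc 2" "boundary_fun F f" "f \<in> Lp 2"
  using assms unfolding hardy_def boundary_fun_def by blast

text \<open>The integral means of a Hardy function are at most those of its boundary function; the constant
  \<open>10\<close> in place of \<open>1\<close> is the price for averaging with \<open>re_kernel\<close>, which reproduces
  \<open>(F w + F 0) / 2\<close> instead of \<open>F w\<close>.\<close>

lemma circle_integral_means_le:
  assumes F: "F \<in> hardy_disc 2" and f: "boundary_fun F f" and r: "r \<in> {0..<1}"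
  shows "(LINT z|circle_measure. norm (F (of_real r * z)) powr 2) \<le> 10 * (LINT z|circle_measure. (norm (f z))\<^sup>2)"
proof -
  have hol: "F holomorphic_on ball 0 1" using F by (simp add: hardy_disc_def)
  have f2: "f \<in> Lp 2" using hardy_2I[OF F f] by (simp add: hardy_def)
  have fi: "integrable circle_measure f" using f2 by (rule Lp_integrable) simp
  define I where "I = (LINT z|circle_measure. (norm (f z))\<^sup>2)"
  define g where "g = (\<lambda>z. norm (f z))"
  have g: "integrable circle_measure g" using fi by (simp add: g_def)
  have gp: "integrable circle_measure (\<lambda>z. \<bar>g z\<bar> powr 2)" using f2 by (simp add: g_def Lp2_iff)
  \<comment> \<open>the kernel averages the value at \<open>w\<close> and the value at \<open>0\<close>\<close>
  have avg: "norm (F w + F 0) / 2 \<le> \<bar>LINT z|circle_measure. g z * re_kernel w z\<bar>" if w: "norm w < 1" for w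
  proof -
    have "(\<lambda>z. 1 / (1 - cnj w * z) * F z) \<in> hardy_disc 2"
      by (intro hardy_disc_inf_mult szego_hardy_disc_inf w F) simp
    moreover have "boundary_fun (\<lambda>z. 1 / (1 - cnj w * z) * F z) (\<lambda>z. 1 / (1 - cnj w * z) * f z)"
      by (intro boundary_fun_ops szego_boundary w f)
    ultimately have 0: "(LINT z|circle_measure. f z / (1 - cnj w * z)) = F 0"
      using hardy_cauchy_formula[of "\<lambda>z. 1 / (1 - cnj w * z) * F z" _ 0] by simp
    have 1: "(LINT z|circle_measure. f z / (1 - w * cnj z)) = F w"
      by (rule hardy_cauchy_formula[OF F f w])
    have i1: "integrable circle_measure (\<lambda>z. f z / (1 - w * cnj z))"
      by (rule integrable_cauchy_integrand[OF fi w])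
    have c: "continuous_on (sphere 0 1) (\<lambda>z. 1 / (1 - cnj w * z))"
      using szego_denominator[OF w] by (intro continuous_intros) auto
    have i0: "integrable circle_measure (\<lambda>z. f z / (1 - cnj w * z))"
      using integrable_mult_cont[OF fi c] by simp
    have "F w + F 0 = (LINT z|circle_measure. f z / (1 - w * cnj z) + f z / (1 - cnj w * z))"
      using i0 i1 0 1 by simp
    also have "\<dots> = (LINT z|circle_measure. 2 * (f z * of_real (re_kernel w z)))"
    proof (rule Bochner_Integration.integral_cong[OF refl])
      fix z
      have "complex_of_real (2 * Re (1 / (1 - w * cnj z))) = 1 / (1 - w * cnj z) + cnj (1 / (1 - w * cnj z))"
        by (rule complex_add_cnj[symmetric])
      then have *: "2 * complex_of_real (re_kernel w z) = 1 / (1 - w * cnj z) + 1 / (1 - cnj w * z)"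
        by (simp add: re_kernel_def)
      have "2 * (f z * of_real (re_kernel w z)) = f z * (2 * complex_of_real (re_kernel w z))"
        by simp
      then show "f z / (1 - w * cnj z) + f z / (1 - cnj w * z) = 2 * (f z * of_real (re_kernel w z))"
        unfolding * by (simp add: distrib_left)
    qed
    also have "\<dots> = 2 * (LINT z|circle_measure. f z * of_real (re_kernel w z))" by simp
    finally have "norm (F w + F 0) / 2 = norm (LINT z|circle_measure. f z * of_real (re_kernel w z))"
      by (simp add: norm_mult)
    also have "\<dots> \<le> (LINT z|circle_measure. norm (f z * of_real (re_kernel w z)))"
      by (rule integral_norm_bound)
    also have "\<dots> = (LINT z|circle_measure. g z * re_kernel w z)"
      using w by (intro Bochner_Integration.integral_cong) (auto simp: norm_mult g_def re_kernel_nonneg)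
    finally show ?thesis by simp
  qed
  have F0: "(norm (F 0))\<^sup>2 \<le> I"
  proof -
    have "(norm (F 0)) powr 2 \<le> \<bar>LINT z|circle_measure. g z * re_kernel 0 z\<bar> powr 2"
      using avg[of 0] by (intro powr_mono2) (auto simp: norm_mult simp flip: mult_2)
    also have "\<dots> \<le> (LINT z|circle_measure. \<bar>g z\<bar> powr 2 * re_kernel 0 z)"
      by (rule powr_integral_re_kernel_le[OF g gp]) auto
    finally show ?thesis by (simp add: re_kernel_def I_def g_def)
  qed
  have Fr: "(\<lambda>z. F (of_real r * z)) \<in> Lp 2" by (rule dilation_Lp[OF hol r]) simp
  have Fr0: "(\<lambda>z. F (of_real r * z) + F 0) \<in> Lp 2"
    by (rule dilation_Lp[of "\<lambda>z. F z + F 0"]) (use r in \<open>auto intro!: holomorphic_intros hol\<close>)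
  define J where "J = (LINT z|circle_measure. (norm (F (of_real r * z) + F 0))\<^sup>2)"
  have J: "J \<le> 4 * I"
  proof -
    have "(\<integral>\<^sup>+ v. ennreal ((norm (F (of_real r * v) + F 0) / 2)\<^sup>2) \<partial>circle_measure)
      \<le> (\<integral>\<^sup>+ v. ennreal (\<bar>LINT z|circle_measure. g z * re_kernel (of_real r * v) z\<bar> powr 2) \<partial>circle_measure)"
    proof (rule nn_integral_mono, rule ennreal_leI)
      fix v :: complex assume "v \<in> space circle_measure"
      then have "norm (of_real r * v) < 1" using r by (simp add: norm_mult)
      from avg[OF this]
      have "(norm (F (of_real r * v) + F 0) / 2)\<^sup>2 \<le> \<bar>LINT z|circle_measure. g z * re_kernel (of_real r * v) z\<bar>\<^sup>2"
        by (intro power_mono) auto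
      then show "(norm (F (of_real r * v) + F 0) / 2)\<^sup>2 \<le> \<bar>LINT z|circle_measure. g z * re_kernel (of_real r * v) z\<bar> powr 2"
        by simp
    qed
    also have "\<dots> \<le> ennreal (LINT z|circle_measure. \<bar>g z\<bar> powr 2)"
      using r by (intro integral_re_kernel_powr_circle[OF g gp]) auto
    also have "\<dots> = ennreal I" by (simp add: I_def g_def)
    finally have "(\<integral>\<^sup>+ v. ennreal ((norm (F (of_real r * v) + F 0) / 2)\<^sup>2) \<partial>circle_measure) \<le> ennreal I" .
    moreover have "integrable circle_measure (\<lambda>v. (norm (F (of_real r * v) + F 0) / 2)\<^sup>2)"
      using Fr0 by (simp add: Lp2_iff power_divide)
    ultimately have "(LINT v|circle_measure. (norm (F (of_real r * v) + F 0) / 2)\<^sup>2) \<le> I"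
      by (subst (asm) nn_integral_eq_integral) (auto simp: I_def)
    then show ?thesis by (simp add: J_def power_divide)
  qed
  have "(LINT z|circle_measure. norm (F (of_real r * z)) powr 2) = (LINT z|circle_measure. (norm (F (of_real r * z)))\<^sup>2)"
    by simp
  also have "\<dots> \<le> (LINT z|circle_measure. 2 * (norm (F (of_real r * z) + F 0))\<^sup>2 + 2 * (norm (F 0))\<^sup>2)"
  proof (rule integral_mono)
    show "integrable circle_measure (\<lambda>z. (norm (F (of_real r * z)))\<^sup>2)" using Fr by (simp add: Lp2_iff)
    show "integrable circle_measure (\<lambda>z. 2 * (norm (F (of_real r * z) + F 0))\<^sup>2 + 2 * (norm (F 0))\<^sup>2)"
      using Fr0 by (simp add: Lp2_iff)
    fix z
    let ?x = "norm (F (of_real r * z) + F 0)" and ?y = "norm (F 0)"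
    have "norm (F (of_real r * z)) \<le> ?x + ?y"
      using norm_triangle_ineq4[of "F (of_real r * z) + F 0" "F 0"] by simp
    then have "(norm (F (of_real r * z)))\<^sup>2 \<le> (?x + ?y)\<^sup>2" by (intro power_mono) auto
    also have "\<dots> \<le> 2 * ?x\<^sup>2 + 2 * ?y\<^sup>2" using sum_squares_bound[of ?x ?y] by (simp add: power2_sum)
    finally show "(norm (F (of_real r * z)))\<^sup>2 \<le> 2 * ?x\<^sup>2 + 2 * ?y\<^sup>2" .
  qed
  also have "\<dots> = 2 * J + 2 * (norm (F 0))\<^sup>2"
    using Fr0 by (simp add: Lp2_iff J_def)
  also have "\<dots> \<le> 10 * I" using J F0 by simp
  finally show ?thesis by (simp add: I_def)
qed

section \<open>Reproducing kernels of a model space\<close>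

locale inner =
  fixes \<Theta> :: "complex \<Rightarrow> complex"
  assumes inner: "inner_function \<Theta>"
begin

abbreviation "\<theta> \<equiv> bdry \<Theta>"

lemma Theta_hardy_disc_inf: "\<Theta> \<in> hardy_disc_inf"
  using inner by (simp add: inner_function_def)

lemma Theta_boundary: "boundary_fun \<Theta> \<theta>"
  and norm_theta: "AE z in circle_measure. norm (\<theta> z) = 1"
proof -
  have *: "AE z in circle_measure. has_nt_limit \<Theta> z (\<theta> z) \<and> norm (\<theta> z) = 1"
  proof -
    have "AE z in circle_measure. \<exists>l. has_nt_limit \<Theta> z l \<and> norm l = 1"
      using inner by (simp add: inner_function_def)
    then show ?thesis using AE_space
    proof eventually_elim
      case (elim z)
      then obtain l where l: "has_nt_limit \<Theta> z l" "norm l = 1" by blast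
      have "norm z = 1" using elim by simp
      from has_nt_limit_bdry[OF l(1) this] l show ?case by simp
    qed
  qed
  from * show "boundary_fun \<Theta> \<theta>" unfolding boundary_fun_def by eventually_elim simp
  from * show "AE z in circle_measure. norm (\<theta> z) = 1" by eventually_elim simp
qed

lemma theta_unimodular: "AE z in circle_measure. \<theta> z * cnj (\<theta> z) = 1"
  using norm_theta by eventually_elim (simp add: complex_norm_square[symmetric])

lemma theta_Linf: "\<theta> \<in> Linf"
  using hardy_disc_inf_boundary[OF Theta_hardy_disc_inf Theta_boundary] by (simp add: hardy_inf_def)

text \<open>The reproducing kernel at \<open>w\<close> as a function in the disc; \<open>model_kernel\<close> is its boundary function.\<close>

definition disc_kernel :: "complex \<Rightarrow> complex \<Rightarrow> complex" where
  "disc_kernel w z = (1 - cnj (\<Theta> w) * \<Theta> z) / (1 - cnj w * z)"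

definition model_kernel :: "complex \<Rightarrow> complex \<Rightarrow> complex" where
  "model_kernel w z = (1 - cnj (\<Theta> w) * \<theta> z) / (1 - cnj w * z)"

lemma disc_kernel_hardy_disc_inf:
  assumes "norm w < 1"
  shows "disc_kernel w \<in> hardy_disc_inf"
proof -
  have "(\<lambda>z. (1 - cnj (\<Theta> w) * \<Theta> z) * (1 / (1 - cnj w * z))) \<in> hardy_disc_inf"
    by (intro hardy_disc_inf_times hardy_disc_inf_diff hardy_disc_inf_const Theta_hardy_disc_inf
        szego_hardy_disc_inf assms)
  then show ?thesis by (simp add: disc_kernel_def[abs_def])
qed

lemma disc_kernel_boundary:
  assumes "norm w < 1"
  shows "boundary_fun (disc_kernel w) (model_kernel w)"
proof -
  have "boundary_fun (\<lambda>z. (1 - cnj (\<Theta> w) * \<Theta> z) * (1 / (1 - cnj w * z))) (\<lambda>z. (1 - cnj (\<Theta> w) * \<theta> z) * (1 / (1 - cnj w * z)))"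
    by (intro boundary_fun_ops Theta_boundary szego_boundary assms boundary_fun_const)
  then show ?thesis by (simp add: disc_kernel_def[abs_def] model_kernel_def[abs_def])
qed

lemma model_kernel_Linf: "norm w < 1 \<Longrightarrow> model_kernel w \<in> Linf"
  using hardy_disc_inf_boundary[OF disc_kernel_hardy_disc_inf disc_kernel_boundary] by (simp add: hardy_inf_def)

text \<open>Since \<open>|\<Theta>| = 1\<close> on the circle, pairing with \<open>\<Theta> h\<close> gives the Cauchy integrals of \<open>\<Theta> h\<close> and of
  \<open>\<Theta> w \<cdot> h\<close>, and both have the value \<open>\<Theta> w \<cdot> h w\<close>.\<close>

lemma model_kernel_model:
  assumes w: "norm w < 1"
  shows "model_kernel w \<in> model_space \<Theta>"
  unfolding model_space_def mem_Collect_eq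
proof (intro conjI ballI)
  show "model_kernel w \<in> hardy 2"
    by (intro hardy_2I[OF hardy_disc_inf_subset disc_kernel_boundary] disc_kernel_hardy_disc_inf w) simp
  fix h assume "h \<in> hardy 2"
  then obtain H where H: "H \<in> hardy_disc 2" "boundary_fun H h" "h \<in> Lp 2" by (rule hardy_2E)
  have TH: "(\<lambda>z. \<Theta> z * H z) \<in> hardy_disc 2" "boundary_fun (\<lambda>z. \<Theta> z * H z) (\<lambda>z. \<theta> z * h z)"
    by (intro hardy_disc_inf_mult Theta_hardy_disc_inf H boundary_fun_ops Theta_boundary; simp)+
  have thh: "(\<lambda>z. \<theta> z * h z) \<in> Lp 2" by (intro Lp_mult_Linf(2) H theta_Linf) simp
  have i: "integrable circle_measure (\<lambda>z. \<theta> z * h z / (1 - w * cnj z))" "integrable circle_measure (\<lambda>z. h z / (1 - w * cnj z))"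
    using integrable_cauchy_integrand[OF Lp_integrable[OF thh] w] integrable_cauchy_integrand[OF Lp_integrable[OF H(3)] w]
    by auto
  have "L2_inner (\<lambda>z. \<theta> z * h z) (model_kernel w) = (LINT z|circle_measure. \<theta> z * h z / (1 - w * cnj z) - \<Theta> w * (h z / (1 - w * cnj z)))"
    unfolding L2_inner_def
  proof (rule integral_cong_AE)
    show "AE z in circle_measure. \<theta> z * h z * cnj (model_kernel w z) = \<theta> z * h z / (1 - w * cnj z) - \<Theta> w * (h z / (1 - w * cnj z))"
      using theta_unimodular
    proof eventually_elim
      case (elim z)
      have "\<theta> z * h z * cnj (model_kernel w z) = (\<theta> z * h z - \<Theta> w * (\<theta> z * cnj (\<theta> z)) * h z) / (1 - w * cnj z)"
        by (simp add: model_kernel_def algebra_simps)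
      then show ?case unfolding elim by (simp add: diff_divide_distrib)
    qed
    show "(\<lambda>z. \<theta> z * h z * cnj (model_kernel w z)) \<in> borel_measurable circle_measure"
      using thh model_kernel_Linf[OF w] by (auto simp: Lp_def Linf_def intro!: borel_measurable_times measurable_cnj_circle)
    show "(\<lambda>z. \<theta> z * h z / (1 - w * cnj z) - \<Theta> w * (h z / (1 - w * cnj z))) \<in> borel_measurable circle_measure"
      using i by (intro borel_measurable_diff borel_measurable_times borel_measurable_const borel_measurable_integrable)
  qed
  also have "\<dots> = \<Theta> w * H w - \<Theta> w * H w"
    using i hardy_cauchy_formula[OF TH w] hardy_cauchy_formula[OF H(1,2) w]
    by (simp del: times_divide_eq_right)
  finally show "L2_inner (model_kernel w) (\<lambda>z. \<theta> z * h z) = 0"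
    by (subst L2_inner_commute) simp
qed

lemma model_space_Lp: "f \<in> model_space \<Theta> \<Longrightarrow> f \<in> Lp 2"
  by (simp add: model_space_def hardy_def)

text \<open>The part of the kernel that contains \<open>\<Theta>\<close> is orthogonal to \<open>f\<close>; the other part is the Cauchy kernel.\<close>

lemma reproducing:
  assumes f: "f \<in> model_space \<Theta>" and F: "F \<in> hardy_disc 2" "boundary_fun F f" and w: "norm w < 1"
  shows "L2_inner f (model_kernel w) = F w"
proof -
  have f2: "f \<in> Lp 2" by (rule model_space_Lp[OF f])
  have i: "integrable circle_measure (\<lambda>z. f z / (1 - w * cnj z))"
    by (rule integrable_cauchy_integrand[OF Lp_integrable[OF f2] w]) simp
  have c: "(\<lambda>z. 1 / (1 - cnj w * z)) \<in> hardy 2"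
    by (intro hardy_2I[OF hardy_disc_inf_subset szego_boundary] szego_hardy_disc_inf w) simp
  have 0: "L2_inner f (\<lambda>z. \<theta> z * (1 / (1 - cnj w * z))) = 0"
    using f c unfolding model_space_def mem_Collect_eq by (elim conjE bspec)
  have c2: "(\<lambda>z. 1 / (1 - cnj w * z)) \<in> Lp 2"
    using c unfolding hardy_def by blast
  have i2: "integrable circle_measure (\<lambda>z. f z * cnj (\<theta> z * (1 / (1 - cnj w * z))))"
    by (rule L2_inner_integrable[OF f2 Lp_mult_Linf(2)[OF c2 theta_Linf]]) simp
  have "L2_inner f (model_kernel w) =
      (LINT z|circle_measure. f z / (1 - w * cnj z) - \<Theta> w * (f z * cnj (\<theta> z * (1 / (1 - cnj w * z)))))"
    unfolding L2_inner_def
    by (rule Bochner_Integration.integral_cong[OF refl])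
       (simp add: model_kernel_def diff_divide_distrib right_diff_distrib)
  also have "\<dots> = F w - \<Theta> w * L2_inner f (\<lambda>z. \<theta> z * (1 / (1 - cnj w * z)))"
    unfolding L2_inner_def hardy_cauchy_formula[OF F w, symmetric]
      Bochner_Integration.integral_diff[OF i integrable_mult_right[OF i2]] integral_mult_right_zero ..
  finally show ?thesis using 0 by simp
qed

text \<open>The reproducing property, applied to the kernel itself.\<close>

lemma model_kernel_norm:
  assumes w: "norm w < 1"
  shows "(LINT z|circle_measure. (norm (model_kernel w z))\<^sup>2) * (1 - (norm w)\<^sup>2) = 1 - (norm (\<Theta> w))\<^sup>2"
proof -
  have "L2_inner (model_kernel w) (model_kernel w) = disc_kernel w w"
    by (intro reproducing model_kernel_model hardy_disc_inf_subset disc_kernel_hardy_disc_inf disc_kernel_boundary w) simp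
  then have "complex_of_real (LINT z|circle_measure. (norm (model_kernel w z))\<^sup>2)
     = of_real ((1 - (norm (\<Theta> w))\<^sup>2) / (1 - (norm w)\<^sup>2))"
    unfolding L2_inner_self disc_kernel_def
    by (simp add: complex_norm_square mult.commute flip: of_real_power)
  then have "(LINT z|circle_measure. (norm (model_kernel w z))\<^sup>2) = (1 - (norm (\<Theta> w))\<^sup>2) / (1 - (norm w)\<^sup>2)"
    by (simp only: of_real_eq_iff)
  moreover have "(norm w)\<^sup>2 < 1" using w by (simp add: power_less_one_iff)
  ultimately show ?thesis by simp
qed

lemma norm_Theta_le: "norm w < 1 \<Longrightarrow> norm (\<Theta> w) \<le> 1"
proof -
  assume w: "norm w < 1"
  then have "(norm w)\<^sup>2 < 1" by (simp add: power_less_one_iff)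
  then have "0 \<le> (LINT z|circle_measure. (norm (model_kernel w z))\<^sup>2) * (1 - (norm w)\<^sup>2)"
    by (intro mult_nonneg_nonneg) auto
  then show ?thesis unfolding model_kernel_norm[OF w] by (simp add: power2_le_iff_abs_le abs_square_le_1)
qed

lemma norm_Theta_0: "norm (\<Theta> 0) < 1"
proof (rule ccontr)
  assume "\<not> norm (\<Theta> 0) < 1"
  then have "norm (\<Theta> z) \<le> norm (\<Theta> 0)" if "z \<in> ball 0 1" for z
    using norm_Theta_le[of z] that by simp
  moreover have "\<Theta> holomorphic_on ball 0 1" using Theta_hardy_disc_inf by (simp add: hardy_disc_inf_def)
  ultimately have "\<Theta> constant_on ball 0 1"
    by (intro maximum_modulus_principle[of \<Theta> "ball 0 1" "ball 0 1" 0]) auto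
  then show False using inner by (simp add: inner_function_def)
qed

end

section \<open>The kernel at a boundary point with an angular derivative\<close>

lemma L2_inner_mult_left:
  "L2_inner (\<lambda>z. c * f z) g = c * L2_inner f g"
  unfolding L2_inner_def by (simp add: mult.assoc)

lemma L2_inner_add_left:
  assumes "f \<in> Lp 2" "g \<in> Lp 2" "h \<in> Lp 2"
  shows "L2_inner (\<lambda>z. f z + g z) h = L2_inner f h + L2_inner g h"
  unfolding L2_inner_def using L2_inner_integrable[OF assms(1,3)] L2_inner_integrable[OF assms(2,3)]
  by (simp add: distrib_right)

lemma L2_norm_mult: "L2_norm (\<lambda>z. c * f z) = norm c * L2_norm f"
  by (simp add: L2_norm_def norm_mult power_mult_distrib real_sqrt_mult)

lemma model_space_scale:
  assumes "f \<in> model_space \<Theta>"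
  shows "(\<lambda>z. c * f z) \<in> model_space \<Theta>"
proof -
  have "f \<in> hardy 2" using assms by (simp add: model_space_def)
  then obtain F where F: "F \<in> hardy_disc 2" "boundary_fun F f" by (rule hardy_2E)
  have "(\<lambda>z. c * f z) \<in> hardy 2"
    by (rule hardy_2I[OF hardy_disc_inf_mult[OF hardy_disc_inf_const F(1)] boundary_fun_ops(1)[OF boundary_fun_const F(2)]]) simp
  then show ?thesis using assms by (simp add: model_space_def L2_inner_mult_left)
qed

locale inner_angular = inner +
  fixes \<zeta> :: complex
  assumes zeta: "norm \<zeta> = 1" and angular: "has_angular_derivative \<Theta> \<zeta>"
begin

abbreviation "c \<equiv> \<theta> \<zeta>"
abbreviation "k \<equiv> kernel_fun \<Theta> \<zeta>"

lemma c_limit: "has_nt_limit \<Theta> \<zeta> c" and norm_c: "norm c = 1"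
proof -
  obtain l where l: "has_nt_limit \<Theta> \<zeta> l" "norm l = 1" using angular by (auto simp: has_angular_derivative_def)
  with has_nt_limit_bdry[OF l(1) zeta] show "has_nt_limit \<Theta> \<zeta> c" "norm c = 1" by auto
qed

lemma c_cnj: "c * cnj c = 1" "cnj c * c = 1" and zeta_cnj: "\<zeta> * cnj \<zeta> = 1" "cnj \<zeta> * \<zeta> = 1"
  using norm_c zeta by (simp_all add: complex_norm_square[symmetric] mult.commute)

text \<open>The derivative is bounded near \<open>\<zeta>\<close> on the radius, so the mean value inequality applies between
  points of the radius; then let the outer point tend to \<open>\<zeta>\<close>.\<close>

lemma radial_lipschitz: "\<exists>M d. d > 0 \<and> (\<forall>r\<in>{0..<1}. 1 - d < r \<longrightarrow> norm (c - \<Theta> (of_real r * \<zeta>)) \<le> M * (1 - r))"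
proof -
  obtain D where "has_nt_limit (deriv \<Theta>) \<zeta> D" using angular by (auto simp: has_angular_derivative_def)
  then have "(deriv \<Theta> \<longlongrightarrow> D) (at \<zeta> within stolz_angle \<zeta> 2)" by (simp add: has_nt_limit_def)
  then have "((\<lambda>z. norm (deriv \<Theta> z)) \<longlongrightarrow> norm D) (at \<zeta> within stolz_angle \<zeta> 2)" by (rule tendsto_norm)
  then have "\<forall>\<^sub>F z in at \<zeta> within stolz_angle \<zeta> 2. norm (deriv \<Theta> z) < norm D + 1"
    by (rule order_tendstoD(2)) simp
  then obtain d where d: "d > 0"
    "\<And>z. z \<in> stolz_angle \<zeta> 2 \<Longrightarrow> z \<noteq> \<zeta> \<Longrightarrow> dist z \<zeta> < d \<Longrightarrow> norm (deriv \<Theta> z) < norm D + 1"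
    unfolding eventually_at by blast
  have hol: "\<Theta> holomorphic_on ball 0 1" by (rule hardy_disc_inf_holomorphic[OF Theta_hardy_disc_inf])
  have "norm (c - \<Theta> (of_real r * \<zeta>)) \<le> (norm D + 1) * (1 - r)" if r: "r \<in> {0..<1}" "1 - d < r" for r
  proof -
    have bound: "norm (\<Theta> (of_real s * \<zeta>) - \<Theta> (of_real r * \<zeta>)) \<le> (norm D + 1) * (1 - r)" if s: "r < s" "s < 1" for s
    proof -
      define S where "S = (\<lambda>t. of_real t * \<zeta>) ` {r..s}"
      have "linear (\<lambda>t::real. of_real t * \<zeta>)"
        by (rule linearI) (simp_all add: distrib_right scaleR_conv_of_real)
      then have cS: "convex S" unfolding S_def
        by (rule convex_linear_image) (rule convex_closed_interval)
      have inS: "z \<in> ball 0 1 \<and> norm (deriv \<Theta> z) \<le> norm D + 1" if "z \<in> S" for z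
      proof -
        have "\<exists>t\<in>{r..s}. z = of_real t * \<zeta>" using that unfolding S_def image_iff .
        then obtain t where ts: "t \<in> {r..s}" and t1: "z = of_real t * \<zeta>" by (rule bexE)
        have t: "z = of_real t * \<zeta>" "r \<le> t" "t \<le> s" using ts by (auto intro: t1)
        have t01: "0 \<le> t" "t < 1" using t(2,3) r(1) s(2) unfolding atLeastLessThan_iff by linarith+
        have "z - \<zeta> = of_real (t - 1) * \<zeta>" by (simp add: t algebra_simps)
        then have dist: "norm (z - \<zeta>) = 1 - t" using t01 zeta by (simp add: norm_mult del: of_real_diff)
        have nz: "norm z = t" unfolding t(1) using t01 zeta by (simp add: norm_mult)
        have "z \<noteq> \<zeta>"
        proof
          assume "z = \<zeta>"
          with nz zeta t01(2) show False by simp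
        qed
        moreover have "z \<in> stolz_angle \<zeta> 2"
          unfolding stolz_angle_def mem_Collect_eq dist nz using t01 nz by (simp add: dist_norm)
        moreover have "dist z \<zeta> < d" unfolding dist_norm dist using t(2) r(2) by linarith
        ultimately have "norm (deriv \<Theta> z) < norm D + 1" by (intro d(2))
        moreover have "norm z < 1" using nz t01(2) by simp
        ultimately show ?thesis by simp
      qed
      have "norm (\<Theta> (of_real s * \<zeta>) - \<Theta> (of_real r * \<zeta>)) \<le> (norm D + 1) * norm (of_real s * \<zeta> - of_real r * \<zeta>)"
      proof (rule field_differentiable_bound[OF cS, where f' = "deriv \<Theta>"])
        fix z assume "z \<in> S"
        then have "z \<in> ball 0 1" using inS by blast
        then show "(\<Theta> has_field_derivative deriv \<Theta> z) (at z within S)"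
          by (rule has_field_derivative_at_within[OF holomorphic_derivI[OF hol open_ball]])
      next
        show "norm (deriv \<Theta> z) \<le> norm D + 1" if "z \<in> S" for z using inS[OF that] by simp
        show "of_real s * \<zeta> \<in> S" unfolding S_def by (rule image_eqI[OF refl]) (use s in simp)
        show "of_real r * \<zeta> \<in> S" unfolding S_def by (rule image_eqI[OF refl]) (use s in simp)
      qed
      also have "norm (of_real s * \<zeta> - of_real r * \<zeta>) = s - r"
      proof -
        have "of_real s * \<zeta> - of_real r * \<zeta> = of_real (s - r) * \<zeta>" by (simp add: algebra_simps)
        then show ?thesis using s zeta by (simp add: norm_mult del: of_real_diff)
      qed
      also have "(norm D + 1) * (s - r) \<le> (norm D + 1) * (1 - r)"
        using s by (intro mult_left_mono) auto
      finally show ?thesis .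
    qed
    have "(\<lambda>n. norm (\<Theta> (of_real (radii n) * \<zeta>) - \<Theta> (of_real r * \<zeta>))) \<longlonglongrightarrow> norm (c - \<Theta> (of_real r * \<zeta>))"
      by (intro tendsto_intros has_nt_limit_radial[OF c_limit zeta radii])
    moreover have "\<forall>\<^sub>F n in sequentially. norm (\<Theta> (of_real (radii n) * \<zeta>) - \<Theta> (of_real r * \<zeta>)) \<le> (norm D + 1) * (1 - r)"
    proof -
      have "\<forall>\<^sub>F n in sequentially. r < radii n" using radii(2) r by (intro order_tendstoD(1)) auto
      then show ?thesis
      proof eventually_elim
        case (elim n)
        then show ?case using bound[of "radii n"] radii(1)[of n] by simp
      qed
    qed
    ultimately show ?thesis by (rule tendsto_upperbound) simp
  qed
  with d(1) show ?thesis by blast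
qed

text \<open>Both factors of \<open>1 - |\<Theta> w|\<^sup>2 = (1 - |\<Theta> w|)(1 + |\<Theta> w|)\<close> are under control, the first one because
  \<open>1 - |\<Theta> w| \<le> |\<Theta> \<zeta> - \<Theta> w|\<close> is at most a multiple of \<open>1 - |w|\<close>.\<close>

lemma bounded_kernel_sequence:
  "\<exists>r C. (\<forall>n. r n \<in> {0..<1}) \<and> r \<longlonglongrightarrow> 1 \<and>
     (\<forall>n. (LINT z|circle_measure. (norm (model_kernel (of_real (r n) * \<zeta>) z))\<^sup>2) \<le> C)"
proof -
  obtain M d where d: "d > 0"
    and M: "\<And>r. r \<in> {0..<1} \<Longrightarrow> 1 - d < r \<Longrightarrow> norm (c - \<Theta> (of_real r * \<zeta>)) \<le> M * (1 - r)"
    using radial_lipschitz by blast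
  define e where "e = min d 1 / 2"
  have e: "0 < e" "e < d" "e < 1" using d by (auto simp: e_def)
  define r where "r = (\<lambda>n. 1 - e * inverse (real (Suc n)))"
  have r1: "1 - d < r n" "r n \<in> {0..<1}" for n
  proof -
    have "e * inverse (real (Suc n)) \<le> e" using e by (simp add: field_simps)
    moreover have "0 < e * inverse (real (Suc n))" using e by simp
    ultimately show "1 - d < r n" "r n \<in> {0..<1}"
      using e unfolding r_def atLeastLessThan_iff by linarith+
  qed
  have "(\<lambda>n. 1 - e * inverse (real (Suc n))) \<longlonglongrightarrow> 1 - e * 0"
    by (intro tendsto_intros LIMSEQ_inverse_real_of_nat)
  then have r2: "r \<longlonglongrightarrow> 1" by (simp add: r_def)
  have "(LINT z|circle_measure. (norm (model_kernel (of_real (r n) * \<zeta>) z))\<^sup>2) \<le> 2 * M" for n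
  proof -
    let ?w = "of_real (r n) * \<zeta>"
    define N where "N = (LINT z|circle_measure. (norm (model_kernel ?w z))\<^sup>2)"
    have rn: "0 \<le> r n" "r n < 1" using r1[of n] by auto
    then have nw: "norm ?w = r n" using zeta by (simp add: norm_mult)
    have T: "norm (\<Theta> ?w) \<le> 1" using norm_Theta_le[of ?w] nw rn by simp
    have le: "1 - norm (\<Theta> ?w) \<le> M * (1 - r n)"
      using M[OF r1(2,1), of n] norm_triangle_ineq2[of c "\<Theta> ?w"] norm_c by linarith
    have "N * (1 - (r n)\<^sup>2) = 1 - (norm (\<Theta> ?w))\<^sup>2"
      using model_kernel_norm[of ?w] nw rn by (simp add: N_def)
    also have "\<dots> = (1 - norm (\<Theta> ?w)) * (1 + norm (\<Theta> ?w))" by (simp add: power2_eq_square algebra_simps)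
    also have "\<dots> \<le> (M * (1 - r n)) * 2"
      using T le by (intro mult_mono order_trans[OF _ le]) auto
    finally have "N * (1 + r n) * (1 - r n) \<le> (2 * M) * (1 - r n)"
      by (simp add: power2_eq_square algebra_simps)
    then have "N * (1 + r n) \<le> 2 * M" using rn by simp
    moreover have "N * 1 \<le> N * (1 + r n)" using rn by (intro mult_left_mono) (auto simp: N_def)
    ultimately show ?thesis by (simp add: N_def)
  qed
  with r1(2) r2 show ?thesis by blast
qed

text \<open>One sequence of radii is chosen once and for all; every limit to \<open>\<zeta>\<close> below is taken along the
  corresponding points \<open>approach n\<close>.\<close>

definition approach_radius :: "nat \<Rightarrow> real" where
  "approach_radius = (SOME r. \<exists>C. (\<forall>n. r n \<in> {0..<1}) \<and> r \<longlonglongrightarrow> 1 \<and>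
     (\<forall>n. (LINT z|circle_measure. (norm (model_kernel (of_real (r n) * \<zeta>) z))\<^sup>2) \<le> C))"

definition approach :: "nat \<Rightarrow> complex" where "approach n = of_real (approach_radius n) * \<zeta>"

lemma approach_radius: "approach_radius n \<in> {0..<1}" "approach_radius \<longlonglongrightarrow> 1"
  and approach_bound: "\<exists>C. \<forall>n. (LINT z|circle_measure. (norm (model_kernel (approach n) z))\<^sup>2) \<le> C"
  using someI_ex[OF bounded_kernel_sequence] unfolding approach_radius_def[symmetric] approach_def by blast+

lemma norm_approach: "norm (approach n) < 1"
  using approach_radius(1)[of n] zeta by (simp add: approach_def norm_mult)

lemma approach_limit: "approach \<longlonglongrightarrow> \<zeta>"
proof -
  have "(\<lambda>n. of_real (approach_radius n) * \<zeta>) \<longlonglongrightarrow> of_real 1 * \<zeta>" by (intro tendsto_intros approach_radius)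
  then show ?thesis by (simp add: approach_def[abs_def])
qed

lemma Theta_approach_limit: "(\<lambda>n. \<Theta> (approach n)) \<longlonglongrightarrow> c"
  unfolding approach_def by (rule has_nt_limit_radial[OF c_limit zeta approach_radius])

lemma zeta_denominator: "norm z \<le> 1 \<Longrightarrow> z \<noteq> \<zeta> \<Longrightarrow> 1 - cnj \<zeta> * z \<noteq> 0"
proof
  assume "z \<noteq> \<zeta>" "1 - cnj \<zeta> * z = 0"
  then have "\<zeta> * (cnj \<zeta> * z) = \<zeta>" by simp
  then have "z = \<zeta>" using zeta_cnj by (simp add: mult.assoc[symmetric])
  with \<open>z \<noteq> \<zeta>\<close> show False by simp
qed

lemma kernel_boundary: "boundary_fun (boundary_kernel \<Theta> \<zeta>) k"
  and kernel_AE: "AE z in circle_measure. k z = (1 - cnj c * \<theta> z) / (1 - cnj \<zeta> * z)"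
proof -
  have *: "AE z in circle_measure. has_nt_limit (boundary_kernel \<Theta> \<zeta>) z (k z)
      \<and> k z = (1 - cnj c * \<theta> z) / (1 - cnj \<zeta> * z)"
    using Theta_boundary[unfolded boundary_fun_def] AE_circle_neq[of \<zeta>] AE_space
  proof eventually_elim
    case (elim z)
    then have z: "norm z = 1" by simp
    have "has_nt_limit (\<lambda>z. 1 - cnj c * \<Theta> z) z (1 - cnj c * \<theta> z)"
      by (rule has_nt_limit_ops(2)[OF has_nt_limit_const has_nt_limit_ops(1)[OF has_nt_limit_const elim(1)]])
    moreover have "has_nt_limit (\<lambda>z. 1 - cnj \<zeta> * z) z (1 - cnj \<zeta> * z)"
      by (rule has_nt_limit_isCont) (intro continuous_intros)
    moreover have "1 - cnj \<zeta> * z \<noteq> 0" using z elim by (intro zeta_denominator) auto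
    ultimately have "has_nt_limit (boundary_kernel \<Theta> \<zeta>) z ((1 - cnj c * \<theta> z) / (1 - cnj \<zeta> * z))"
      unfolding boundary_kernel_def[abs_def] by (rule has_nt_limit_ops(3))
    with has_nt_limit_bdry[OF this z] show ?case by (simp add: kernel_fun_def)
  qed
  from * show "boundary_fun (boundary_kernel \<Theta> \<zeta>) k" unfolding boundary_fun_def by eventually_elim blast
  from * show "AE z in circle_measure. k z = (1 - cnj c * \<theta> z) / (1 - cnj \<zeta> * z)" by eventually_elim blast
qed

lemma model_kernel_limit: "AE z in circle_measure. (\<lambda>n. model_kernel (approach n) z) \<longlonglongrightarrow> k z"
  using kernel_AE AE_circle_neq[of \<zeta>] AE_space
proof eventually_elim
  case (elim z)
  have "(\<lambda>n. model_kernel (approach n) z) \<longlonglongrightarrow> (1 - cnj c * \<theta> z) / (1 - cnj \<zeta> * z)"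
    unfolding model_kernel_def using elim zeta_denominator[of z]
    by (intro tendsto_intros Theta_approach_limit approach_limit) auto
  then show ?case using elim by simp
qed

lemma model_kernel_Lp2: "norm w < 1 \<Longrightarrow> model_kernel w \<in> Lp 2"
  by (rule model_space_Lp[OF model_kernel_model])

lemma kernel_weak:
  assumes u: "u \<in> Lp 2"
  shows "(\<lambda>n. LINT z|circle_measure. model_kernel (approach n) z * u z) \<longlonglongrightarrow> (LINT z|circle_measure. k z * u z)"
proof -
  obtain C where "\<And>n. (LINT z|circle_measure. (norm (model_kernel (approach n) z))\<^sup>2) \<le> C" using approach_bound by blast
  then show ?thesis by (rule weak_convergence_L2[OF model_kernel_Lp2[OF norm_approach] _ model_kernel_limit u])
qed

lemma boundary_kernel_holomorphic: "boundary_kernel \<Theta> \<zeta> holomorphic_on ball 0 1"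
  unfolding boundary_kernel_def[abs_def]
proof (intro holomorphic_intros hardy_disc_inf_holomorphic Theta_hardy_disc_inf)
  fix z :: complex assume "z \<in> ball 0 1"
  then show "1 - cnj \<zeta> * z \<noteq> 0" using zeta by (intro zeta_denominator) auto
qed

text \<open>On each circle of radius \<open>s < 1\<close> the kernels at \<open>approach n\<close> converge everywhere, and their means are
  bounded uniformly in \<open>s\<close> and \<open>n\<close>; apply Fatou's lemma.\<close>

lemma boundary_kernel_hardy_disc: "boundary_kernel \<Theta> \<zeta> \<in> hardy_disc 2"
proof -
  obtain C where C: "\<And>n. (LINT z|circle_measure. (norm (model_kernel (approach n) z))\<^sup>2) \<le> C" using approach_bound by blast
  have "(LINT z|circle_measure. norm (boundary_kernel \<Theta> \<zeta> (of_real s * z)) powr 2) \<le> 10 * C" if s: "s \<in> {0..<1}" for s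
  proof (rule fatou_Lp(2)[where g = "\<lambda>n z. disc_kernel (approach n) (of_real s * z)"])
    show "(\<lambda>z. disc_kernel (approach n) (of_real s * z)) \<in> Lp 2" for n
      by (rule dilation_Lp[OF hardy_disc_inf_holomorphic[OF disc_kernel_hardy_disc_inf[OF norm_approach]] s]) simp
    show "(LINT z|circle_measure. norm (disc_kernel (approach n) (of_real s * z)) powr 2) \<le> 10 * C" for n
    proof -
      have "disc_kernel (approach n) \<in> hardy_disc 2"
        by (rule hardy_disc_inf_subset[OF disc_kernel_hardy_disc_inf[OF norm_approach]]) simp
      from circle_integral_means_le[OF this disc_kernel_boundary[OF norm_approach] s] C[of n] show ?thesis by linarith
    qed
    show "AE z in circle_measure. (\<lambda>n. disc_kernel (approach n) (of_real s * z)) \<longlonglongrightarrow> boundary_kernel \<Theta> \<zeta> (of_real s * z)"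
    proof (rule AE_I2)
      fix z :: complex assume "z \<in> space circle_measure"
      then have n: "norm (of_real s * z) < 1" using s by (simp add: norm_mult)
      then have "1 - cnj \<zeta> * (of_real s * z) \<noteq> 0" using zeta by (intro zeta_denominator) auto
      then show "(\<lambda>n. disc_kernel (approach n) (of_real s * z)) \<longlonglongrightarrow> boundary_kernel \<Theta> \<zeta> (of_real s * z)"
        unfolding disc_kernel_def boundary_kernel_def
        by (intro tendsto_intros Theta_approach_limit approach_limit)
    qed
  qed simp
  then show ?thesis using boundary_kernel_holomorphic unfolding hardy_disc_def by blast
qed

text \<open>Orthogonality to \<open>\<Theta> h\<close> passes to the weak limit.\<close>

lemma kernel_model: "k \<in> model_space \<Theta>"
  unfolding model_space_def mem_Collect_eq
proof (intro conjI ballI)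
  show "k \<in> hardy 2" by (rule hardy_2I[OF boundary_kernel_hardy_disc kernel_boundary])
  fix h assume h: "h \<in> hardy 2"
  then have "h \<in> Lp 2" by (simp add: hardy_def)
  then have "(\<lambda>z. cnj (\<theta> z * h z)) \<in> Lp 2" by (intro Lp_cnj Lp_mult_Linf(2) theta_Linf) simp_all
  from kernel_weak[OF this]
  have "(\<lambda>n. L2_inner (model_kernel (approach n)) (\<lambda>z. \<theta> z * h z)) \<longlonglongrightarrow> L2_inner k (\<lambda>z. \<theta> z * h z)"
    unfolding L2_inner_def .
  moreover have "L2_inner (model_kernel (approach n)) (\<lambda>z. \<theta> z * h z) = 0" for n
    using model_kernel_model[OF norm_approach[of n]] h unfolding model_space_def by blast
  ultimately show "L2_inner k (\<lambda>z. \<theta> z * h z) = 0" by (simp add: LIMSEQ_const_iff)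
qed

lemma kernel_Lp2: "k \<in> Lp 2"
  by (rule model_space_Lp[OF kernel_model])

section \<open>A symbol of the rank one operator\<close>

text \<open>On the circle this is \<open>1 / (z - w)\<close>, but in the form that displays it as the conjugate of the Hardy
  function \<open>z / (1 - cnj w \<cdot> z)\<close>, which vanishes at the origin. Accordingly \<open>conj_kernel\<close> is
  \<open>(\<Theta> - \<Theta> w) / (z - w)\<close>, the image of the kernel under the natural conjugation of the model
  space.\<close>

definition conj_szego :: "complex \<Rightarrow> complex \<Rightarrow> complex" where
  "conj_szego w z = cnj z * (1 / (1 - w * cnj z))"

definition conj_kernel :: "complex \<Rightarrow> complex \<Rightarrow> complex" where
  "conj_kernel w z = (\<theta> z - \<Theta> w) * conj_szego w z"

lemma conj_szego_eq:
  assumes "norm w < 1" "norm z = 1"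
  shows "conj_szego w z = 1 / (z - w)"
proof -
  have "z * cnj z = 1" using assms by (simp add: complex_norm_square[symmetric])
  then have "z - w = z * (1 - w * cnj z)" by (simp add: algebra_simps)
  moreover have "z \<noteq> 0" using assms by auto
  ultimately have "1 / (z - w) = 1 / z * (1 / (1 - w * cnj z))" by simp
  also have "1 / z = cnj z" using \<open>z * cnj z = 1\<close> \<open>z \<noteq> 0\<close> by (simp add: field_simps)
  finally show ?thesis by (simp add: conj_szego_def)
qed

lemma conj_szego_Linf: "norm w < 1 \<Longrightarrow> conj_szego w \<in> Linf"
  unfolding conj_szego_def[abs_def] by (intro Linf_cont continuous_intros continuous_cauchy_kernel)

text \<open>With \<open>q = (f - F w) / (z - w)\<close> and \<open>v = z h / (1 - cnj w \<cdot> z)\<close> the integrand on the left differs from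
  \<open>F w\<close> times the one on the right by multiples of \<open>\<Theta> q \<cdot> cnj h\<close>, \<open>cnj v\<close> and \<open>f \<cdot> cnj (\<Theta> v)\<close>. The first and
  the last one integrate to zero because \<open>h\<close> and \<open>f\<close> are orthogonal to \<open>\<Theta> H\<^sup>2\<close>, and \<open>cnj v\<close> does
  because \<open>v\<close> vanishes at the origin.\<close>

lemma symbol_identity_interior:
  assumes f: "f \<in> model_space \<Theta>" and F: "F \<in> hardy_disc_inf" "boundary_fun F f"
    and h: "h \<in> model_space \<Theta>" and w: "norm w < 1"
  shows "(LINT z|circle_measure. (conj_kernel w z + \<Theta> w * (cnj z * cnj (model_kernel w z))) * (f z * cnj (h z)))
     = F w * (LINT z|circle_measure. conj_kernel w z * cnj (h z))"
proof -
  have f2: "f \<in> Lp 2" and h2: "h \<in> Lp 2" using f h by (auto intro: model_space_Lp)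
  have fb: "f \<in> Linf" using hardy_disc_inf_boundary[OF F] by (simp add: hardy_inf_def)
  obtain H where H: "H \<in> hardy_disc 2" "boundary_fun H h"
    using h by (auto simp: model_space_def elim: hardy_2E)
  define Q where "Q = (\<lambda>z. if z = w then deriv F w else (F z - F w) / (z - w))"
  define q where "q = (\<lambda>z. (f z - F w) / (z - w))"
  define v where "v = (\<lambda>z. z * (1 / (1 - cnj w * z)) * h z)"
  have Q: "Q \<in> hardy_disc_inf" "boundary_fun Q q"
    unfolding Q_def q_def by (intro difference_quotient_hardy_disc_inf difference_quotient_boundary F w)+
  have q: "q \<in> hardy 2" by (intro hardy_2I[OF hardy_disc_inf_subset Q(2)] Q(1)) simp
  have zc: "(\<lambda>z. z * (1 / (1 - cnj w * z))) \<in> hardy_disc_inf"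
    "boundary_fun (\<lambda>z. z * (1 / (1 - cnj w * z))) (\<lambda>z. z * (1 / (1 - cnj w * z)))"
    by (intro hardy_disc_inf_times hardy_disc_inf_ident szego_hardy_disc_inf w)
       (intro boundary_fun_ops(1) boundary_fun_isCont[of "\<lambda>z. z"] szego_boundary w continuous_ident)
  have V: "(\<lambda>z. z * (1 / (1 - cnj w * z)) * H z) \<in> hardy_disc 2"
    "boundary_fun (\<lambda>z. z * (1 / (1 - cnj w * z)) * H z) v"
    unfolding v_def by (intro hardy_disc_inf_mult zc H boundary_fun_ops(1); simp)+
  have v: "v \<in> hardy 2" by (rule hardy_2I[OF V])
  have v2: "v \<in> Lp 2" and q2: "q \<in> Lp 2" using v q by (auto simp: hardy_def)
  have cv: "cnj (v z) = conj_szego w z * cnj (h z)" for z by (simp add: v_def conj_szego_def)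
  have I1: "L2_inner h (\<lambda>z. \<theta> z * q z) = 0" using h q unfolding model_space_def by blast
  have I4: "L2_inner f (\<lambda>z. \<theta> z * v z) = 0" using f v unfolding model_space_def by blast
  have I3: "(LINT z|circle_measure. cnj (v z)) = 0"
    using hardy_cauchy_formula[OF V, of 0] by simp
  have i0: "integrable circle_measure (\<lambda>z. conj_kernel w z * cnj (h z))"
    unfolding conj_kernel_def
    by (intro L2_mult_integrable Lp_cnj h2 Linf_subset_Lp Lp_mult_Linf(1) Lp_diff theta_Linf conj_szego_Linf w) (auto intro: Linf_cont)
  have i1: "integrable circle_measure (\<lambda>z. \<theta> z * q z * cnj (h z))"
    by (intro L2_inner_integrable Lp_mult_Linf(2) q2 h2 theta_Linf) simp
  have i3: "integrable circle_measure (\<lambda>z. cnj (v z))"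
    using Lp_integrable[OF v2] by simp
  have i4: "integrable circle_measure (\<lambda>z. f z * cnj (\<theta> z * v z))"
    by (intro L2_inner_integrable f2 Lp_mult_Linf(2) v2 theta_Linf) simp
  note j0 = integrable_mult_right[OF i0, of "F w"] and j3 = integrable_mult_right[OF i3, of "\<Theta> w * F w"]
    and j4 = integrable_mult_right[OF i4, of "(\<Theta> w)\<^sup>2"]
  have kb: "model_kernel w \<in> Linf" by (rule model_kernel_Linf[OF w])
  have "(LINT z|circle_measure. (conj_kernel w z + \<Theta> w * (cnj z * cnj (model_kernel w z))) * (f z * cnj (h z)))
    = (LINT z|circle_measure. F w * (conj_kernel w z * cnj (h z)) + \<theta> z * q z * cnj (h z)
        + \<Theta> w * F w * cnj (v z) - (\<Theta> w)\<^sup>2 * (f z * cnj (\<theta> z * v z)))"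
  proof (rule integral_cong_AE)
    have [measurable]: "f \<in> borel_measurable circle_measure" "h \<in> borel_measurable circle_measure"
      "\<theta> \<in> borel_measurable circle_measure" "conj_szego w \<in> borel_measurable circle_measure"
      "model_kernel w \<in> borel_measurable circle_measure" "cnj \<in> borel_measurable circle_measure"
      using f2 h2 theta_Linf conj_szego_Linf[OF w] kb
      by (auto simp: Lp_def Linf_def intro!: measurable_circle_cont continuous_intros)
    show "(\<lambda>z. (conj_kernel w z + \<Theta> w * (cnj z * cnj (model_kernel w z))) * (f z * cnj (h z))) \<in> borel_measurable circle_measure"
      unfolding conj_kernel_def by measurable
    show "(\<lambda>z. F w * (conj_kernel w z * cnj (h z)) + \<theta> z * q z * cnj (h z)
        + \<Theta> w * F w * cnj (v z) - (\<Theta> w)\<^sup>2 * (f z * cnj (\<theta> z * v z))) \<in> borel_measurable circle_measure"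
      using i0 i1 i3 i4 by (intro borel_measurable_diff borel_measurable_add borel_measurable_times
          borel_measurable_const borel_measurable_integrable)
    show "AE z in circle_measure. (conj_kernel w z + \<Theta> w * (cnj z * cnj (model_kernel w z))) * (f z * cnj (h z)) =
        F w * (conj_kernel w z * cnj (h z)) + \<theta> z * q z * cnj (h z)
        + \<Theta> w * F w * cnj (v z) - (\<Theta> w)\<^sup>2 * (f z * cnj (\<theta> z * v z))"
    proof (rule AE_I2)
      fix z :: complex assume "z \<in> space circle_measure"
      then have z: "norm z = 1" by simp
      have qe: "q z = (f z - F w) * conj_szego w z" using conj_szego_eq[OF w z] by (simp add: q_def)
      have ke: "cnj z * cnj (model_kernel w z) = (1 - \<Theta> w * cnj (\<theta> z)) * conj_szego w z"
        by (simp add: model_kernel_def conj_szego_def mult_ac)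
      have ve: "cnj (\<theta> z * v z) = cnj (\<theta> z) * (conj_szego w z * cnj (h z))" by (simp add: cv)
      show "(conj_kernel w z + \<Theta> w * (cnj z * cnj (model_kernel w z))) * (f z * cnj (h z)) =
        F w * (conj_kernel w z * cnj (h z)) + \<theta> z * q z * cnj (h z)
        + \<Theta> w * F w * cnj (v z) - (\<Theta> w)\<^sup>2 * (f z * cnj (\<theta> z * v z))"
        unfolding qe ke ve cv conj_kernel_def by (simp add: algebra_simps power2_eq_square)
    qed
  qed
  also have "\<dots> = F w * (LINT z|circle_measure. conj_kernel w z * cnj (h z)) + (LINT z|circle_measure. \<theta> z * q z * cnj (h z))
        + \<Theta> w * F w * (LINT z|circle_measure. cnj (v z)) - (\<Theta> w)\<^sup>2 * (LINT z|circle_measure. f z * cnj (\<theta> z * v z))"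
    unfolding Bochner_Integration.integral_diff[OF Bochner_Integration.integrable_add[OF Bochner_Integration.integrable_add[OF j0 i1] j3] j4]
      Bochner_Integration.integral_add[OF Bochner_Integration.integrable_add[OF j0 i1] j3]
      Bochner_Integration.integral_add[OF j0 i1] integral_mult_right_zero ..
  also have "(LINT z|circle_measure. \<theta> z * q z * cnj (h z)) = 0"
    using I1 L2_inner_commute[of "\<lambda>z. \<theta> z * q z" h] by (simp add: L2_inner_def)
  also have "(LINT z|circle_measure. f z * cnj (\<theta> z * v z)) = 0"
    using I4 by (simp add: L2_inner_def)
  finally show ?thesis using I3 by simp
qed

text \<open>Modulo symbols of the zero operator this is \<open>k + cnj k - 1\<close>, because
  \<open>(1 - \<zeta> \<cdot> cnj z) \<cdot> cnj k = 1 - \<Theta> \<zeta> \<cdot> cnj \<Theta>\<close>. The form used here is the one that appears as a limit of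
  the symbols at interior points.\<close>

definition kernel_symbol :: "complex \<Rightarrow> complex" where
  "kernel_symbol z = k z + \<zeta> * (cnj z * cnj (k z))"

text \<open>Let \<open>w\<close> tend to \<open>\<zeta>\<close> in \<open>symbol_identity_interior\<close>. All integrals converge because the kernels and the
  conjugate kernels, which have the same modulus on the circle, converge weakly; here boundedness of
  \<open>f\<close> is essential, for \<open>f \<cdot> cnj h\<close> has to be square integrable. The conjugate kernels tend to
  \<open>\<Theta> \<zeta> \<cdot> cnj \<zeta> \<cdot> k\<close>, and this unimodular factor cancels at the end.\<close>

lemma symbol_identity:
  assumes f: "f \<in> model_space \<Theta>" "f \<in> hardy_inf" and h: "h \<in> model_space \<Theta>"
  shows "(LINT z|circle_measure. kernel_symbol z * f z * cnj (h z)) = L2_inner f k * L2_inner k h"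
proof -
  obtain F where F: "F \<in> hardy_disc_inf" "boundary_fun F f"
    using f(2) unfolding hardy_inf_def boundary_fun_def by blast
  have F2: "F \<in> hardy_disc 2" by (rule hardy_disc_inf_subset[OF F(1)]) simp
  have fb: "f \<in> Linf" using f(2) by (simp add: hardy_inf_def)
  have f2: "f \<in> Lp 2" and h2: "h \<in> Lp 2" using f h by (auto intro: model_space_Lp)
  have ch: "(\<lambda>z. cnj (h z)) \<in> Lp 2" by (rule Lp_cnj[OF h2])
  have u: "(\<lambda>z. f z * cnj (h z)) \<in> Lp 2" by (rule Lp_mult_Linf(2)[OF ch fb]) simp
  obtain C where C: "\<And>n. (LINT z|circle_measure. (norm (model_kernel (approach n) z))\<^sup>2) \<le> C" using approach_bound by blast
  have cnjLinf: "cnj \<in> Linf" by (intro Linf_cont continuous_intros)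
  have ck2: "conj_kernel w \<in> Lp 2" if "norm w < 1" for w
    unfolding conj_kernel_def[abs_def]
    by (intro Lp_mult_Linf(1) Lp_diff Linf_subset_Lp theta_Linf conj_szego_Linf that Linf_cont) auto
  have ck_norm: "AE z in circle_measure. norm (conj_kernel w z) = norm (model_kernel w z)" if w: "norm w < 1" for w
    using theta_unimodular norm_theta AE_space
  proof eventually_elim
    case (elim z)
    have "\<theta> z - \<Theta> w = \<theta> z * cnj (1 - cnj (\<Theta> w) * \<theta> z)"
      using elim(1) by (simp add: algebra_simps)
    then have 1: "norm (\<theta> z - \<Theta> w) = norm (1 - cnj (\<Theta> w) * \<theta> z)"
      using elim(2) by (metis complex_mod_cnj mult_1 norm_mult)
    have "cnj (1 - cnj w * z) = 1 - w * cnj z" by simp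
    then have "norm (1 - w * cnj z) = norm (1 - cnj w * z)" by (metis complex_mod_cnj)
    then have 2: "norm (conj_szego w z) = 1 / norm (1 - cnj w * z)"
      using elim(3) by (simp add: conj_szego_def norm_mult norm_divide)
    show ?case using 1 2 by (simp add: conj_kernel_def model_kernel_def norm_mult norm_divide)
  qed
  have ckC: "(LINT z|circle_measure. (norm (conj_kernel (approach n) z))\<^sup>2) \<le> C" for n
  proof -
    have "(LINT z|circle_measure. (norm (conj_kernel (approach n) z))\<^sup>2) = (LINT z|circle_measure. (norm (model_kernel (approach n) z))\<^sup>2)"
    proof (rule integral_cong_AE)
      show "AE z in circle_measure. (norm (conj_kernel (approach n) z))\<^sup>2 = (norm (model_kernel (approach n) z))\<^sup>2"
        using ck_norm[OF norm_approach[of n]] by eventually_elim simp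
    qed (use ck2[OF norm_approach[of n]] model_kernel_Lp2[OF norm_approach[of n]] in \<open>auto simp: Lp2_iff\<close>)
    then show ?thesis using C by simp
  qed
  have ck_lim: "AE z in circle_measure. (\<lambda>n. conj_kernel (approach n) z) \<longlonglongrightarrow> c * cnj \<zeta> * k z"
    using kernel_AE AE_circle_neq[of \<zeta>] AE_space
  proof eventually_elim
    case (elim z)
    have z: "z * cnj z = 1" using elim(3) by (simp add: complex_norm_square[symmetric])
    have d: "1 - cnj \<zeta> * z \<noteq> 0" using elim by (intro zeta_denominator) auto
    have d': "1 - \<zeta> * cnj z \<noteq> 0"
    proof
      assume "1 - \<zeta> * cnj z = 0"
      then have "cnj (1 - \<zeta> * cnj z) = cnj 0" by (rule arg_cong)
      with d show False by simp
    qed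
    have "(\<lambda>n. conj_kernel (approach n) z) \<longlonglongrightarrow> (\<theta> z - c) * (cnj z * (1 / (1 - \<zeta> * cnj z)))"
      unfolding conj_kernel_def conj_szego_def using d' by (intro tendsto_intros Theta_approach_limit approach_limit)
    also have "(\<theta> z - c) * (cnj z * (1 / (1 - \<zeta> * cnj z))) = c * cnj \<zeta> * k z"
    proof -
      have a: "\<theta> z - c = - c * (1 - cnj c * \<theta> z)"
      proof -
        have "- c * (1 - cnj c * \<theta> z) = (c * cnj c) * \<theta> z - c" by (simp add: algebra_simps)
        then show ?thesis by (simp add: c_cnj)
      qed
      have b: "cnj z * (1 - cnj \<zeta> * z) = - cnj \<zeta> * (1 - \<zeta> * cnj z)"
      proof -
        have "cnj z * (1 - cnj \<zeta> * z) = cnj z - cnj \<zeta> * (z * cnj z)" by (simp add: algebra_simps)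
        also have "\<dots> = (cnj \<zeta> * \<zeta>) * cnj z - cnj \<zeta>" by (simp add: z zeta_cnj)
        finally show ?thesis by (simp add: algebra_simps)
      qed
      have "cnj z * (1 / (1 - \<zeta> * cnj z)) = - cnj \<zeta> / (1 - cnj \<zeta> * z)"
        using b by (simp only: times_divide_eq_right mult_1_right frac_eq_eq[OF d' d])
      then show ?thesis unfolding a elim(1) by simp
    qed
    finally show ?case .
  qed
  have L1: "(\<lambda>n. LINT z|circle_measure. conj_kernel (approach n) z * x z) \<longlonglongrightarrow> (LINT z|circle_measure. c * cnj \<zeta> * k z * x z)"
    if "x \<in> Lp 2" for x
    by (rule weak_convergence_L2[OF ck2[OF norm_approach] ckC ck_lim that])
  have ckm: "(\<lambda>z. cnj z * cnj (model_kernel (approach n) z)) \<in> Lp 2" for n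
    by (rule Lp_mult_Linf(2)[OF Lp_cnj[OF model_kernel_Lp2[OF norm_approach]] cnjLinf]) simp
  have L2: "(\<lambda>n. LINT z|circle_measure. cnj z * cnj (model_kernel (approach n) z) * (f z * cnj (h z)))
      \<longlonglongrightarrow> (LINT z|circle_measure. cnj z * cnj (k z) * (f z * cnj (h z)))"
  proof (rule weak_convergence_L2[OF ckm _ _ u])
    show "(LINT z|circle_measure. (norm (cnj z * cnj (model_kernel (approach n) z)))\<^sup>2) \<le> C" for n
    proof -
      have "(LINT z|circle_measure. (norm (cnj z * cnj (model_kernel (approach n) z)))\<^sup>2) = (LINT z|circle_measure. (norm (model_kernel (approach n) z))\<^sup>2)"
        by (rule Bochner_Integration.integral_cong) (auto simp: norm_mult)
      then show ?thesis using C by simp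
    qed
    show "AE z in circle_measure. (\<lambda>n. cnj z * cnj (model_kernel (approach n) z)) \<longlonglongrightarrow> cnj z * cnj (k z)"
      using model_kernel_limit by eventually_elim (intro tendsto_intros)
  qed
  have L3: "(\<lambda>n. F (approach n)) \<longlonglongrightarrow> L2_inner f k"
  proof -
    have "(\<lambda>n. cnj (LINT z|circle_measure. model_kernel (approach n) z * cnj (f z))) \<longlonglongrightarrow> cnj (LINT z|circle_measure. k z * cnj (f z))"
      by (intro tendsto_cnj kernel_weak Lp_cnj f2)
    moreover have "cnj (LINT z|circle_measure. x z * cnj (f z)) = L2_inner f x" for x
      using L2_inner_commute[of f x] by (simp add: L2_inner_def)
    ultimately have "(\<lambda>n. L2_inner f (model_kernel (approach n))) \<longlonglongrightarrow> L2_inner f k" by simp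
    then show ?thesis by (simp add: reproducing[OF f(1) F2 F(2) norm_approach])
  qed
  have lhs: "(\<lambda>n. (LINT z|circle_measure. (conj_kernel (approach n) z + \<Theta> (approach n) * (cnj z * cnj (model_kernel (approach n) z))) * (f z * cnj (h z))))
     \<longlonglongrightarrow> (LINT z|circle_measure. c * cnj \<zeta> * k z * (f z * cnj (h z))) + c * (LINT z|circle_measure. cnj z * cnj (k z) * (f z * cnj (h z)))"
  proof -
    have "(LINT z|circle_measure. (conj_kernel (approach n) z + \<Theta> (approach n) * (cnj z * cnj (model_kernel (approach n) z))) * (f z * cnj (h z)))
      = (LINT z|circle_measure. conj_kernel (approach n) z * (f z * cnj (h z))) + \<Theta> (approach n) * (LINT z|circle_measure. cnj z * cnj (model_kernel (approach n) z) * (f z * cnj (h z)))" for n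
    proof -
      have "(LINT z|circle_measure. (conj_kernel (approach n) z + \<Theta> (approach n) * (cnj z * cnj (model_kernel (approach n) z))) * (f z * cnj (h z)))
        = (LINT z|circle_measure. conj_kernel (approach n) z * (f z * cnj (h z)) + \<Theta> (approach n) * (cnj z * cnj (model_kernel (approach n) z) * (f z * cnj (h z))))"
        by (rule Bochner_Integration.integral_cong) (simp_all add: algebra_simps)
      also have "\<dots> = (LINT z|circle_measure. conj_kernel (approach n) z * (f z * cnj (h z))) + (LINT z|circle_measure. \<Theta> (approach n) * (cnj z * cnj (model_kernel (approach n) z) * (f z * cnj (h z))))"
        by (intro Bochner_Integration.integral_add L2_mult_integrable[OF ck2[OF norm_approach] u] integrable_mult_right L2_mult_integrable[OF ckm u])
      finally show ?thesis by (simp only: integral_mult_right_zero)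
    qed
    then show ?thesis by (simp only:) (intro tendsto_add tendsto_mult L1[OF u] L2 Theta_approach_limit)
  qed
  have rhs: "(\<lambda>n. F (approach n) * (LINT z|circle_measure. conj_kernel (approach n) z * cnj (h z)))
     \<longlonglongrightarrow> L2_inner f k * (LINT z|circle_measure. c * cnj \<zeta> * k z * cnj (h z))"
    by (intro tendsto_mult L3 L1 ch)
  have "(LINT z|circle_measure. c * cnj \<zeta> * k z * (f z * cnj (h z))) + c * (LINT z|circle_measure. cnj z * cnj (k z) * (f z * cnj (h z)))
      = L2_inner f k * (LINT z|circle_measure. c * cnj \<zeta> * k z * cnj (h z))"
    by (rule LIMSEQ_unique[OF lhs]) (use rhs in \<open>simp only: symbol_identity_interior[OF f(1) F h norm_approach]\<close>)
  also have "(LINT z|circle_measure. c * cnj \<zeta> * k z * (f z * cnj (h z))) = c * cnj \<zeta> * (LINT z|circle_measure. k z * (f z * cnj (h z)))"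
    by (simp only: mult.assoc integral_mult_right_zero)
  also have "(LINT z|circle_measure. c * cnj \<zeta> * k z * cnj (h z)) = c * cnj \<zeta> * L2_inner k h"
    by (simp only: L2_inner_def mult.assoc integral_mult_right_zero)
  finally have "cnj c * \<zeta> * (c * cnj \<zeta> * (LINT z|circle_measure. k z * (f z * cnj (h z))) + c * (LINT z|circle_measure. cnj z * cnj (k z) * (f z * cnj (h z))))
     = cnj c * \<zeta> * (L2_inner f k * (c * cnj \<zeta> * L2_inner k h))" by simp
  then have "(cnj c * c) * (\<zeta> * cnj \<zeta>) * (LINT z|circle_measure. k z * (f z * cnj (h z))) + (cnj c * c) * \<zeta> * (LINT z|circle_measure. cnj z * cnj (k z) * (f z * cnj (h z)))
     = (cnj c * c) * (\<zeta> * cnj \<zeta>) * (L2_inner f k * L2_inner k h)" by (simp add: algebra_simps)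
  then have main: "(LINT z|circle_measure. k z * (f z * cnj (h z))) + \<zeta> * (LINT z|circle_measure. cnj z * cnj (k z) * (f z * cnj (h z))) = L2_inner f k * L2_inner k h"
    by (simp add: c_cnj zeta_cnj)
  have ck: "(\<lambda>z. cnj z * cnj (k z)) \<in> Lp 2" by (rule Lp_mult_Linf(2)[OF Lp_cnj[OF kernel_Lp2] cnjLinf]) simp
  have "(LINT z|circle_measure. kernel_symbol z * f z * cnj (h z))
    = (LINT z|circle_measure. k z * (f z * cnj (h z)) + \<zeta> * (cnj z * cnj (k z) * (f z * cnj (h z))))"
    by (rule Bochner_Integration.integral_cong) (simp_all add: kernel_symbol_def algebra_simps)
  also have "\<dots> = (LINT z|circle_measure. k z * (f z * cnj (h z))) + (LINT z|circle_measure. \<zeta> * (cnj z * cnj (k z) * (f z * cnj (h z))))"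
    by (intro Bochner_Integration.integral_add L2_mult_integrable[OF kernel_Lp2 u] integrable_mult_right L2_mult_integrable[OF ck u])
  finally show ?thesis using main by (simp only: integral_mult_right_zero)
qed

lemma kernel_symbol_Lp:
  assumes "k \<in> Lp p" "p > 0"
  shows "kernel_symbol \<in> Lp p"
proof -
  have "cnj \<in> Linf" by (intro Linf_cont continuous_intros)
  then have "(\<lambda>z. cnj z * cnj (k z)) \<in> Lp p" by (rule Lp_mult_Linf(2)[OF Lp_cnj[OF assms(1)] _ assms(2)])
  then show ?thesis unfolding kernel_symbol_def[abs_def]
    by (intro Lp_add Lp_cmult assms)
qed

lemma rank_one_bounded: "bounded_operator_on (model_space \<Theta>) (rank_one k k)"
  unfolding bounded_operator_on_def
proof (intro conjI ballI allI exI)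
  fix f assume f: "f \<in> model_space \<Theta>"
  then have f2: "f \<in> Lp 2" by (rule model_space_Lp)
  show "rank_one k k f \<in> model_space \<Theta>" unfolding rank_one_def by (rule model_space_scale[OF kernel_model])
  show "AE z in circle_measure. rank_one k k (\<lambda>w. a * f w) z = a * rank_one k k f z" for a
    by (simp add: rank_one_def L2_inner_mult_left)
  have "L2_norm (rank_one k k f) = norm (L2_inner f k) * L2_norm k"
    unfolding rank_one_def by (rule L2_norm_mult)
  also have "\<dots> \<le> (L2_norm f * L2_norm k) * L2_norm k"
    by (intro mult_right_mono cauchy_schwarz_L2 f2 kernel_Lp2) (simp add: L2_norm_def)
  finally show "L2_norm (rank_one k k f) \<le> (L2_norm k * L2_norm k) * L2_norm f" by (simp add: mult_ac)
  fix g assume "g \<in> model_space \<Theta>"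
  then have "g \<in> Lp 2" by (rule model_space_Lp)
  then show "AE z in circle_measure. rank_one k k (\<lambda>w. f w + g w) z = rank_one k k f z + rank_one k k g z"
    by (simp add: rank_one_def L2_inner_add_left[OF f2 _ kernel_Lp2] distrib_right)
qed

lemma is_symbol_kernel_symbol: "is_symbol \<Theta> (rank_one k k) kernel_symbol"
  unfolding is_symbol_def
proof (intro conjI ballI rank_one_bounded)
  show s2: "kernel_symbol \<in> Lp 2" by (rule kernel_symbol_Lp[OF kernel_Lp2]) simp
  fix f assume f: "f \<in> model_space \<Theta> \<inter> hardy_inf"
  then have fb: "f \<in> Linf" by (simp add: hardy_inf_def)
  have sf: "(\<lambda>z. kernel_symbol z * f z) \<in> Lp 2" by (rule Lp_mult_Linf(1)[OF s2 fb]) simp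
  show "is_orth_proj (model_space \<Theta>) (\<lambda>z. kernel_symbol z * f z) (rank_one k k f)"
    unfolding is_orth_proj_def
  proof (intro conjI ballI)
    show "rank_one k k f \<in> model_space \<Theta>" unfolding rank_one_def by (rule model_space_scale[OF kernel_model])
    fix h assume h: "h \<in> model_space \<Theta>"
    then have h2: "h \<in> Lp 2" by (rule model_space_Lp)
    have "L2_inner (\<lambda>z. kernel_symbol z * f z + (- L2_inner f k) * k z) h
        = L2_inner (\<lambda>z. kernel_symbol z * f z) h + L2_inner (\<lambda>z. (- L2_inner f k) * k z) h"
      by (rule L2_inner_add_left[OF sf Lp_cmult[OF kernel_Lp2] h2]) simp
    also have "L2_inner (\<lambda>z. kernel_symbol z * f z) h = L2_inner f k * L2_inner k h"
      unfolding L2_inner_def[of _ h] using symbol_identity[of f h] f h by (simp add: L2_inner_def[of k h])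
    also have "L2_inner (\<lambda>z. (- L2_inner f k) * k z) h = - L2_inner f k * L2_inner k h"
      by (rule L2_inner_mult_left)
    finally show "L2_inner (\<lambda>z. kernel_symbol z * f z - rank_one k k f z) h = 0"
      by (simp add: rank_one_def)
  qed
qed

section \<open>Integrability of the kernel from a symbol\<close>

text \<open>The image of \<open>k\<^sub>0\<close> under the operator is \<open>a k\<close> with \<open>a = \<langle>k\<^sub>0, k\<rangle> = cnj (K 0)\<close>, where \<open>K\<close> is the kernel
  in the disc. This is not zero, since \<open>|\<Theta> 0| < 1 = |\<Theta> \<zeta>|\<close>. Pairing the defining property of a symbol
  with the kernels \<open>k\<^sub>w\<close> expresses \<open>a K w\<close> through two Cauchy transforms of functions in \<open>L\<^sup>p\<close>.\<close>

lemma kernel_Lp_if_symbol: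
  assumes psi: "\<psi> \<in> Lp p" and p: "p > 2" and sym: "is_symbol \<Theta> (rank_one k k) \<psi>"
  shows "k \<in> Lp p"
proof -
  define a where "a = L2_inner (model_kernel 0) k"
  define v where "v = (\<lambda>z. \<psi> z * model_kernel 0 z)"
  define vt where "vt = (\<lambda>z. v z * cnj (\<theta> z))"
  have k0: "model_kernel 0 \<in> model_space \<Theta> \<inter> hardy_inf"
    using model_kernel_model[of 0] hardy_disc_inf_boundary[OF disc_kernel_hardy_disc_inf disc_kernel_boundary, of 0] by simp
  have psi2: "\<psi> \<in> Lp 2" using sym by (simp add: is_symbol_def)
  have k0b: "model_kernel 0 \<in> Linf" by (rule model_kernel_Linf) simp
  have tb: "(\<lambda>z. cnj (\<theta> z)) \<in> Linf" using theta_Linf by (simp add: Linf_def measurable_cnj_circle)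
  have v: "v \<in> Lp p" "v \<in> Lp 2" unfolding v_def using p by (auto intro!: Lp_mult_Linf(1)[OF _ k0b] psi psi2)
  have vt: "vt \<in> Lp p" "vt \<in> Lp 2" unfolding vt_def using p by (auto intro!: Lp_mult_Linf(1)[OF _ tb] v)
  have a0: "a \<noteq> 0"
  proof -
    have "a = cnj (boundary_kernel \<Theta> \<zeta> 0)"
      unfolding a_def
      using L2_inner_commute[of "model_kernel 0" k] reproducing[OF kernel_model boundary_kernel_hardy_disc kernel_boundary, of 0] by simp
    moreover have "boundary_kernel \<Theta> \<zeta> 0 \<noteq> 0"
    proof
      assume "boundary_kernel \<Theta> \<zeta> 0 = 0"
      then have "cnj c * \<Theta> 0 = 1" by (simp add: boundary_kernel_def)
      then have "norm c * norm (\<Theta> 0) = 1" by (metis complex_mod_cnj norm_mult norm_one)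
      then show False using norm_c norm_Theta_0 by simp
    qed
    ultimately show ?thesis by simp
  qed
  have orth: "L2_inner (\<lambda>z. v z - a * k z) h = 0" if "h \<in> model_space \<Theta>" for h
  proof -
    have "is_orth_proj (model_space \<Theta>) (\<lambda>z. \<psi> z * model_kernel 0 z) (rank_one k k (model_kernel 0))"
      using sym k0 unfolding is_symbol_def by blast
    then show ?thesis using that by (simp add: is_orth_proj_def rank_one_def v_def a_def)
  qed
  have decomp: "a * boundary_kernel \<Theta> \<zeta> w = cauchy_transform v w + - \<Theta> w * cauchy_transform vt w"
    if w: "norm w < 1" for w
  proof -
    have m: "model_kernel w \<in> model_space \<Theta>" by (rule model_kernel_model[OF w])
    have "0 = L2_inner (\<lambda>z. v z + (- a) * k z) (model_kernel w)" using orth[OF m] by simp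
    also have "\<dots> = L2_inner v (model_kernel w) + (- a) * L2_inner k (model_kernel w)"
      by (subst L2_inner_add_left[OF v(2) Lp_cmult[OF kernel_Lp2] model_space_Lp[OF m]], simp, simp only: L2_inner_mult_left)
    also have "L2_inner k (model_kernel w) = boundary_kernel \<Theta> \<zeta> w"
      by (rule reproducing[OF kernel_model boundary_kernel_hardy_disc kernel_boundary w])
    finally have 1: "a * boundary_kernel \<Theta> \<zeta> w = L2_inner v (model_kernel w)" by (simp add: add_eq_0_iff)
    have i: "integrable circle_measure (\<lambda>z. v z / (1 - w * cnj z))" "integrable circle_measure (\<lambda>z. vt z / (1 - w * cnj z))"
      using integrable_cauchy_integrand[OF Lp_integrable[OF v(2)] w] integrable_cauchy_integrand[OF Lp_integrable[OF vt(2)] w] by auto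
    have "L2_inner v (model_kernel w) = (LINT z|circle_measure. v z / (1 - w * cnj z) + - \<Theta> w * (vt z / (1 - w * cnj z)))"
      unfolding L2_inner_def
      by (rule Bochner_Integration.integral_cong[OF refl])
         (simp add: model_kernel_def vt_def diff_divide_distrib right_diff_distrib)
    also have "\<dots> = cauchy_transform v w + - \<Theta> w * cauchy_transform vt w"
      unfolding Bochner_Integration.integral_add[OF i(1) integrable_mult_right[OF i(2)]]
        integral_mult_right_zero cauchy_transform_def ..
    finally show ?thesis using 1 by simp
  qed
  obtain A B where A: "\<And>r. r \<in> {0..<1} \<Longrightarrow> (LINT z|circle_measure. norm (cauchy_transform v (of_real r * z)) powr p) \<le> A"
    and B: "\<And>r. r \<in> {0..<1} \<Longrightarrow> (LINT z|circle_measure. norm (cauchy_transform vt (of_real r * z)) powr p) \<le> B"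
    using cauchy_transform_Lp_bound[OF v(1) p] cauchy_transform_Lp_bound[OF vt(1) p] by blast
  have hol: "cauchy_transform v holomorphic_on ball 0 1" "cauchy_transform vt holomorphic_on ball 0 1"
    using holomorphic_cauchy_transform[OF Lp_integrable[OF v(2)]] holomorphic_cauchy_transform[OF Lp_integrable[OF vt(2)]] by auto
  define K where "K = (\<lambda>w. a * boundary_kernel \<Theta> \<zeta> w)"
  have Kh: "K holomorphic_on ball 0 1" unfolding K_def by (intro holomorphic_intros boundary_kernel_holomorphic)
  have "(\<lambda>z. a * k z) \<in> Lp p"
  proof (rule fatou_Lp(1)[where g = "\<lambda>n z. K (of_real (radii n) * z)"])
    show "(\<lambda>z. K (of_real (radii n) * z)) \<in> Lp p" for n using p by (intro dilation_Lp Kh radii) simp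
    show "AE z in circle_measure. (\<lambda>n. K (of_real (radii n) * z)) \<longlonglongrightarrow> a * k z"
      unfolding K_def by (rule boundary_fun_radial[OF boundary_fun_ops(1)[OF boundary_fun_const kernel_boundary] radii])
    show "(LINT z|circle_measure. norm (K (of_real (radii n) * z)) powr p) \<le> 2 powr p * (A + B)" for n
    proof -
      have p0: "p > 0" using p by simp
      have i: "integrable circle_measure (\<lambda>z. norm (cauchy_transform v (of_real (radii n) * z)) powr p)"
        "integrable circle_measure (\<lambda>z. norm (cauchy_transform vt (of_real (radii n) * z)) powr p)"
        "integrable circle_measure (\<lambda>z. norm (K (of_real (radii n) * z)) powr p)"
        using dilation_Lp[OF hol(1) radii(1) p0, of n] dilation_Lp[OF hol(2) radii(1) p0, of n] dilation_Lp[OF Kh radii(1) p0, of n]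
        by (auto simp: Lp_def)
      have "(LINT z|circle_measure. norm (K (of_real (radii n) * z)) powr p)
        \<le> (LINT z|circle_measure. 2 powr p * (norm (cauchy_transform v (of_real (radii n) * z)) powr p
             + norm (cauchy_transform vt (of_real (radii n) * z)) powr p))"
      proof (rule integral_mono[OF i(3)])
        show "integrable circle_measure (\<lambda>z. 2 powr p * (norm (cauchy_transform v (of_real (radii n) * z)) powr p
             + norm (cauchy_transform vt (of_real (radii n) * z)) powr p))" using i by auto
        fix z :: complex assume "z \<in> space circle_measure"
        then have w: "norm (of_real (radii n) * z) < 1" using radii(1)[of n] by (simp add: norm_mult)
        let ?w = "of_real (radii n) * z"
        have "norm (K ?w) powr p \<le> 2 powr p * (norm (cauchy_transform v ?w) powr p + norm (- \<Theta> ?w * cauchy_transform vt ?w) powr p)"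
          unfolding K_def decomp[OF w] by (rule norm_add_powr_le[OF p0])
        also have "norm (- \<Theta> ?w * cauchy_transform vt ?w) powr p \<le> norm (cauchy_transform vt ?w) powr p"
          using norm_Theta_le[OF w] p0 by (intro powr_mono2) (auto simp: norm_mult mult_left_le_one_le)
        finally show "norm (K ?w) powr p \<le> 2 powr p * (norm (cauchy_transform v ?w) powr p + norm (cauchy_transform vt ?w) powr p)"
          by (simp add: mult_left_mono)
      qed
      also have "\<dots> = 2 powr p * ((LINT z|circle_measure. norm (cauchy_transform v (of_real (radii n) * z)) powr p)
           + (LINT z|circle_measure. norm (cauchy_transform vt (of_real (radii n) * z)) powr p))"
        using i by simp
      also have "\<dots> \<le> 2 powr p * (A + B)"
        using A[OF radii(1)] B[OF radii(1)] by (intro mult_left_mono add_mono) auto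
      finally show ?thesis .
    qed
  qed (use p in simp)
  from Lp_cmult[OF this, of "1 / a"] show ?thesis using a0 p by simp
qed

end

theorem theorem5p3:
  fixes \<Theta> :: "complex \<Rightarrow> complex" and \<zeta> :: complex
  assumes "inner_function \<Theta>"
    and "\<zeta> \<in> sphere 0 1"
    and "has_angular_derivative \<Theta> \<zeta>"
  shows "(\<forall>p>2. (\<exists>\<psi>\<in>Lp p. is_symbol \<Theta> (rank_one (kernel_fun \<Theta> \<zeta>) (kernel_fun \<Theta> \<zeta>)) \<psi>)
                  \<longleftrightarrow> kernel_fun \<Theta> \<zeta> \<in> Lp p) \<and>
         ((\<exists>p>2. kernel_fun \<Theta> \<zeta> \<notin> Lp p) \<longrightarrow>
            bounded_truncated_toeplitz \<Theta> (rank_one (kernel_fun \<Theta> \<zeta>) (kernel_fun \<Theta> \<zeta>)) \<and>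
            \<not> (\<exists>\<psi>\<in>Linf. is_symbol \<Theta> (rank_one (kernel_fun \<Theta> \<zeta>) (kernel_fun \<Theta> \<zeta>)) \<psi>))"
proof -
  interpret inner_angular \<Theta> \<zeta>
    by unfold_locales (use assms in auto)
  have equiv: "(\<exists>\<psi>\<in>Lp p. is_symbol \<Theta> (rank_one k k) \<psi>) \<longleftrightarrow> k \<in> Lp p" if p: "p > 2" for p
  proof
    assume "\<exists>\<psi>\<in>Lp p. is_symbol \<Theta> (rank_one k k) \<psi>"
    then show "k \<in> Lp p" using kernel_Lp_if_symbol p by blast
  next
    assume "k \<in> Lp p"
    then have "kernel_symbol \<in> Lp p" using p by (intro kernel_symbol_Lp) auto
    then show "\<exists>\<psi>\<in>Lp p. is_symbol \<Theta> (rank_one k k) \<psi>" using is_symbol_kernel_symbol by blast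
  qed
  show ?thesis
  proof (intro conjI allI impI)
    show "(\<exists>\<psi>\<in>Lp p. is_symbol \<Theta> (rank_one k k) \<psi>) \<longleftrightarrow> k \<in> Lp p" if "p > 2" for p
      using equiv that .
    show "bounded_truncated_toeplitz \<Theta> (rank_one k k)"
      unfolding bounded_truncated_toeplitz_def using is_symbol_kernel_symbol by blast
    assume "\<exists>p>2. k \<notin> Lp p"
    then obtain p where p: "p > 2" "k \<notin> Lp p" by blast
    show "\<not> (\<exists>\<psi>\<in>Linf. is_symbol \<Theta> (rank_one k k) \<psi>)"
    proof
      assume "\<exists>\<psi>\<in>Linf. is_symbol \<Theta> (rank_one k k) \<psi>"
      then obtain \<psi> where psi: "\<psi> \<in> Linf" "is_symbol \<Theta> (rank_one k k) \<psi>" by blast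
      have "\<psi> \<in> Lp p" using psi(1) p(1) by (intro Linf_subset_Lp) auto
      then show False using kernel_Lp_if_symbol psi(2) p by blast
    qed
  qed
qed

end
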